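(* Working in $\mathsf{ZF}$ (without the axiom of choice): for every infinite set $M$, there is no surjection from $\omega\times M$ onto $\mathcal{P}(M)$.
   Context: $\mathcal{P}(M)$ denotes the power set of $M$, and $\omega$ the set of natural numbers. The ambient theory is $\mathsf{ZF}$, without any form of the axiom of choice. *)

theory Defs imports Main begin

text \<open>
  HOL proves the axiom of choice, so a statement of ZF about the sets of HOL would come with
  choice. We therefore work in an arbitrary model of first-order ZF: a type with a binary
  relation that satisfies the axioms. All set-theoretic notions below (ordered pair, function,
  natural number, finite, ...) are those of the model, that is, all quantifiers range over its
  elements; the relation is not assumed to be well-founded from outside, nor its \<open>\<omega>\<close> standard.
\<close>

text \<open>First-order formulas of set theory, with named variables \<open>0, 1, ...\<close>.\<close>

datatype fm =
    Mem nat nat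
  | Equ nat nat
  | Neg fm
  | Conj fm fm
  | Forall nat fm

primrec sat :: "('a \<Rightarrow> 'a \<Rightarrow> bool) \<Rightarrow> (nat \<Rightarrow> 'a) \<Rightarrow> fm \<Rightarrow> bool" where
  "sat E e (Mem i j) \<longleftrightarrow> E (e i) (e j)"
| "sat E e (Equ i j) \<longleftrightarrow> e i = e j"
| "sat E e (Neg p) \<longleftrightarrow> \<not> sat E e p"
| "sat E e (Conj p q) \<longleftrightarrow> sat E e p \<and> sat E e q"
| "sat E e (Forall i p) \<longleftrightarrow> (\<forall>a. sat E (e(i := a)) p)"

locale set_structure =
  fixes mem :: "'a \<Rightarrow> 'a \<Rightarrow> bool" (infix "\<epsilon>" 50)
begin

definition is_empty :: "'a \<Rightarrow> bool" where
  "is_empty x \<longleftrightarrow> (\<forall>z. \<not> z \<epsilon> x)"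

definition is_successor :: "'a \<Rightarrow> 'a \<Rightarrow> bool" where
  "is_successor s x \<longleftrightarrow> (\<forall>z. z \<epsilon> s \<longleftrightarrow> z \<epsilon> x \<or> z = x)"

definition is_inductive :: "'a \<Rightarrow> bool" where
  "is_inductive I \<longleftrightarrow>
     (\<exists>x. x \<epsilon> I \<and> is_empty x) \<and> (\<forall>x. x \<epsilon> I \<longrightarrow> (\<exists>s. s \<epsilon> I \<and> is_successor s x))"

definition is_omega :: "'a \<Rightarrow> bool" where
  "is_omega W \<longleftrightarrow> (\<forall>n. n \<epsilon> W \<longleftrightarrow> (\<forall>I. is_inductive I \<longrightarrow> n \<epsilon> I))"

definition is_powerset :: "'a \<Rightarrow> 'a \<Rightarrow> bool" where
  "is_powerset P M \<longleftrightarrow> (\<forall>x. x \<epsilon> P \<longleftrightarrow> (\<forall>z. z \<epsilon> x \<longrightarrow> z \<epsilon> M))"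

definition is_upair :: "'a \<Rightarrow> 'a \<Rightarrow> 'a \<Rightarrow> bool" where
  "is_upair u a b \<longleftrightarrow> (\<forall>z. z \<epsilon> u \<longleftrightarrow> z = a \<or> z = b)"

text \<open>Kuratowski: \<open>p = {{a}, {a, b}}\<close>.\<close>

definition is_pair :: "'a \<Rightarrow> 'a \<Rightarrow> 'a \<Rightarrow> bool" where
  "is_pair p a b \<longleftrightarrow> (\<forall>z. z \<epsilon> p \<longleftrightarrow> is_upair z a a \<or> is_upair z a b)"

definition is_product :: "'a \<Rightarrow> 'a \<Rightarrow> 'a \<Rightarrow> bool" where
  "is_product C A B \<longleftrightarrow> (\<forall>p. p \<epsilon> C \<longleftrightarrow> (\<exists>a b. a \<epsilon> A \<and> b \<epsilon> B \<and> is_pair p a b))"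

definition maps_to :: "'a \<Rightarrow> 'a \<Rightarrow> 'a \<Rightarrow> bool" where
  "maps_to f a b \<longleftrightarrow> (\<exists>p. p \<epsilon> f \<and> is_pair p a b)"

definition is_function :: "'a \<Rightarrow> 'a \<Rightarrow> 'a \<Rightarrow> bool" where
  "is_function f A B \<longleftrightarrow>
     (\<forall>p. p \<epsilon> f \<longrightarrow> (\<exists>a b. a \<epsilon> A \<and> b \<epsilon> B \<and> is_pair p a b)) \<and>
     (\<forall>a. a \<epsilon> A \<longrightarrow> (\<exists>!b. maps_to f a b))"

definition is_surjection :: "'a \<Rightarrow> 'a \<Rightarrow> 'a \<Rightarrow> bool" where
  "is_surjection f A B \<longleftrightarrow>
     is_function f A B \<and> (\<forall>b. b \<epsilon> B \<longrightarrow> (\<exists>a. a \<epsilon> A \<and> maps_to f a b))"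

definition is_injection :: "'a \<Rightarrow> 'a \<Rightarrow> 'a \<Rightarrow> bool" where
  "is_injection f A B \<longleftrightarrow>
     is_function f A B \<and> (\<forall>a a' b. maps_to f a b \<and> maps_to f a' b \<longrightarrow> a = a')"

definition finite_set :: "'a \<Rightarrow> bool" where
  "finite_set M \<longleftrightarrow>
     (\<exists>W n f. is_omega W \<and> n \<epsilon> W \<and> is_injection f n M \<and> is_surjection f n M)"

text \<open>Not merely Dedekind-infinite, which without choice is a stronger property.\<close>

definition infinite_set :: "'a \<Rightarrow> bool" where
  "infinite_set M \<longleftrightarrow> \<not> finite_set M"

end

text \<open>
  The schemata range over first-order formulas only (with parameters, supplied by the
  assignment \<open>e\<close>). Quantifying over arbitrary HOL predicates instead would give second-order ZF,
  whose models inherit choice from HOL.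
\<close>

locale ZF = set_structure +
  assumes extensionality: "\<forall>x y. (\<forall>z. z \<epsilon> x \<longleftrightarrow> z \<epsilon> y) \<longrightarrow> x = y"
    and foundation: "\<forall>x. (\<exists>y. y \<epsilon> x) \<longrightarrow> (\<exists>y. y \<epsilon> x \<and> \<not> (\<exists>z. z \<epsilon> x \<and> z \<epsilon> y))"
    and pairing: "\<forall>a b. \<exists>u. is_upair u a b"
    and union: "\<forall>A. \<exists>U. \<forall>z. z \<epsilon> U \<longleftrightarrow> (\<exists>x. x \<epsilon> A \<and> z \<epsilon> x)"
    and powerset: "\<forall>A. \<exists>P. is_powerset P A"
    and infinity: "\<exists>I. is_inductive I"
    and separation:
      "\<forall>\<phi> i e A. \<exists>B. \<forall>x. x \<epsilon> B \<longleftrightarrow> x \<epsilon> A \<and> sat (\<epsilon>) (e(i := x)) \<phi>"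
    and replacement:
      "\<forall>\<phi> i j e A. i \<noteq> j \<longrightarrow>
         (\<forall>x y y'. x \<epsilon> A \<and> sat (\<epsilon>) (e(i := x, j := y)) \<phi> \<and> sat (\<epsilon>) (e(i := x, j := y')) \<phi>
            \<longrightarrow> y = y') \<longrightarrow>
         (\<exists>B. \<forall>y. y \<epsilon> B \<longleftrightarrow> (\<exists>x. x \<epsilon> A \<and> sat (\<epsilon>) (e(i := x, j := y)) \<phi>))"

end

theory Submission imports Defs begin

text \<open>
  Suppose \<open>f\<close> maps \<open>\<omega> \<times> M\<close> onto the power set of \<open>M\<close>, and let \<open>\<theta>\<close> be the least ordinal onto
  which \<open>M\<close> does not map. Counting finite subsets of \<open>M\<close> gives \<open>\<omega> < \<theta>\<close>.

  First, \<open>\<omega> \<times> M\<close> maps onto \<open>\<theta>\<close>. If some infinite \<open>\<lambda> < \<theta>\<close> maps onto all ordinals below \<open>\<theta>\<close>,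
  then these ordinals are types of well-orders on subsets of \<open>\<lambda>\<close>, which are coded by subsets of
  \<open>M\<close>. Otherwise every ordinal below \<open>\<theta>\<close> is the type of a chain \<open>{f (n, y) | y \<in> Y}\<close> under
  inclusion, for some \<open>n\<close> and some \<open>Y \<subseteq> M\<close>.

  Second, this is impossible. Let \<open>g n : M \<rightarrow> \<theta>\<close> be the sections of a surjection and call
  \<open>A \<subseteq> M\<close> tame if the order types of the images \<open>g n [A]\<close> have a supremum below \<open>\<theta>\<close>. Given
  disjoint pieces of \<open>M\<close> with an index \<open>n\<close> chosen for each, sending \<open>x\<close> to the rank of \<open>g n x\<close>
  in the image of its piece maps \<open>M\<close> onto the supremum of the order types, which is therefore below
  \<open>\<theta>\<close>. Hence a set that is partitioned into fewer than \<open>\<theta>\<close> tame pieces is tame, and there is no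
  infinite sequence of disjoint sets that are not tame. Partitioning by \<open>g 0, g 1, ...\<close> one finds a
  point all of whose cells are not tame, and the sets of points that leave these cells at stage \<open>n\<close>
  contradict one of the two facts.
\<close>

text \<open>The obstacle is that \<open>\<theta>\<close> may have cofinality
  \<open>\<omega>\<close>. Each ordinal below \<open>\<theta>\<close> is an image of
  \<open>M\<close>, but without choice surjections cannot be selected for countably many of them at
  once. So the order types of the images \<open>g n [A]\<close> all lie below
  \<open>\<theta>\<close>, while their supremum may be \<open>\<theta>\<close> itself; tameness says
  that this does not happen. What replaces the missing selection is that disjoint pieces can be
  treated by one map, because a point determines its own piece. Indices are picked only as least
  ordinals.

  The chain comes from a single surjection \<open>h\<close> of \<open>M\<close> onto some
  \<open>m < \<theta>\<close>: the sets \<open>{x | h x < c}\<close> with \<open>c < m\<close> grow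
  strictly with \<open>c\<close>, and \<open>f\<close> sorts them by the sections in which they
  occur. If every section held only a short part, a fixed smaller ordinal would map onto
  \<open>m\<close>; so some section holds a long part.

  The schemata of the model accept first-order formulas only, so every separation, replacement and
  induction needs a certificate of definability. All terms are total with a fixed default value,
  which separates this check from questions of existence.\<close>

named_theorems definability

section \<open>Definable predicates\<close>

primrec vars :: "fm \<Rightarrow> nat set" where
  "vars (Mem i j) = {i, j}"
| "vars (Equ i j) = {i, j}"
| "vars (Neg p) = vars p"
| "vars (Conj p q) = vars p \<union> vars q"
| "vars (Forall i p) = insert i (vars p)"

text \<open>Bound variables count in \<open>vars\<close>, so one above the largest renamed name is
  fresh and nothing is captured under \<open>Forall\<close>.\<close>

primrec ren :: "(nat \<Rightarrow> nat) \<Rightarrow> fm \<Rightarrow> fm" where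
  "ren s (Mem i j) = Mem (s i) (s j)"
| "ren s (Equ i j) = Equ (s i) (s j)"
| "ren s (Neg p) = Neg (ren s p)"
| "ren s (Conj p q) = Conj (ren s p) (ren s q)"
| "ren s (Forall i p) =
     (let j = Suc (Max (insert 0 (s ` vars p))) in Forall j (ren (s(i := j)) p))"

lemma finite_vars: "finite (vars p)"
  by (induction p) auto

lemma sat_cong: "(\<And>i. i \<in> vars p \<Longrightarrow> e i = e' i) \<Longrightarrow> sat E e p \<longleftrightarrow> sat E e' p"
proof (induction p arbitrary: e e')
  case (Forall i p)
  have "sat E (e(i := a)) p \<longleftrightarrow> sat E (e'(i := a)) p" for a
    by (rule Forall.IH) (use Forall.prems in auto)
  then show ?case by simp
next
  case (Conj p q)
  have "sat E e p \<longleftrightarrow> sat E e' p" "sat E e q \<longleftrightarrow> sat E e' q"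
    by (rule Conj.IH; use Conj.prems in simp)+
  then show ?case by simp
next
  case (Neg p)
  have "sat E e p \<longleftrightarrow> sat E e' p" by (rule Neg.IH, use Neg.prems in auto)
  then show ?case by simp
qed auto

lemma sat_ren: "sat E e (ren s p) \<longleftrightarrow> sat E (\<lambda>n. e (s n)) p"
proof (induction p arbitrary: e s)
  case (Forall i p)
  define j where "j = Suc (Max (insert 0 (s ` vars p)))"
  have fresh: "s n \<noteq> j" if "n \<in> vars p" for n
  proof -
    have "s n \<le> Max (insert 0 (s ` vars p))"
      using that by (intro Max_ge) (auto simp: finite_vars)
    then show ?thesis by (simp add: j_def)
  qed
  have "sat E (\<lambda>n. (e(j := a)) ((s(i := j)) n)) p \<longleftrightarrow> sat E ((\<lambda>n. e (s n))(i := a)) p" for a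
    by (rule sat_cong) (use fresh in auto)
  then show ?case
    by (simp add: Let_def Forall.IH flip: j_def)
qed auto

definition mix :: "(nat \<Rightarrow> 'a) \<Rightarrow> (nat \<Rightarrow> 'a) \<Rightarrow> nat \<Rightarrow> 'a" where
  "mix e p n = (if even n then e (n div 2) else p (n div 2))"

context set_structure begin

text \<open>
  Variables are read off an environment in the style of de Bruijn: under a binder the bound value
  becomes entry \<open>0\<close>. Parameters of the formula live in the odd entries of \<^const>\<open>mix\<close>, so every
  fixed value of the model may occur in a definable predicate.
\<close>

definition definable :: "((nat \<Rightarrow> 'a) \<Rightarrow> bool) \<Rightarrow> bool" where
  "definable P \<longleftrightarrow> (\<exists>\<phi> p. \<forall>e. P e \<longleftrightarrow> sat mem (mix e p) \<phi>)"

definition definable_term :: "((nat \<Rightarrow> 'a) \<Rightarrow> 'a) \<Rightarrow> bool" where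
  "definable_term t \<longleftrightarrow> definable (\<lambda>e. e 0 = t (\<lambda>n. e (Suc n)))"

lemma definableI: "(\<And>e. P e \<longleftrightarrow> sat mem (mix e p) \<phi>) \<Longrightarrow> definable P"
  unfolding definable_def by blast

lemma definable_ren:
  assumes "definable P" shows "definable (\<lambda>e. P (\<lambda>n. e (s n)))"
proof -
  obtain \<phi> p where *: "\<And>e. P e \<longleftrightarrow> sat mem (mix e p) \<phi>"
    using assms unfolding definable_def by blast
  define r where "r n = (if even n then 2 * s (n div 2) else n)" for n
  have "(\<lambda>n. mix e p (r n)) = mix (\<lambda>n. e (s n)) p" for e
    by (auto simp: mix_def r_def)
  then show ?thesis
    by (intro definableI[where p = p and \<phi> = "ren r \<phi>"]) (simp add: sat_ren *)
qed

lemma definable_not: "definable P \<Longrightarrow> definable (\<lambda>e. \<not> P e)"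
  unfolding definable_def by (metis sat.simps(3))

text \<open>The two formulas come with separate parameter sequences, which are interleaved into
  \<open>mix p q\<close>. Parameter \<open>k\<close> of the first then sits at entry
  \<open>4 * k + 1\<close> and that of the second at \<open>4 * k + 3\<close>, which is where
  \<open>r\<close> and \<open>s\<close> send it.\<close>

lemma definable_conj:
  assumes "definable P" "definable Q" shows "definable (\<lambda>e. P e \<and> Q e)"
proof -
  obtain \<phi> p where P: "\<And>e. P e \<longleftrightarrow> sat mem (mix e p) \<phi>"
    using assms unfolding definable_def by blast
  obtain \<psi> q where Q: "\<And>e. Q e \<longleftrightarrow> sat mem (mix e q) \<psi>"
    using assms unfolding definable_def by blast
  define r where "r n = (if even n then n else 4 * (n div 2) + 1)" for n :: nat
  define s where "s n = (if even n then n else 4 * (n div 2) + 3)" for n :: nat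
  have *: "(4 * k + 1) div 2 = 2 * k" "(4 * k + 3) div 2 = 2 * k + 1" for k :: nat
    by auto
  have "mix e (mix p q) (r n) = mix e p n" for e n
    using *(1)[of "n div 2"] by (auto simp: mix_def r_def elim!: oddE)
  moreover have "mix e (mix p q) (s n) = mix e q n" for e n
    using *(2)[of "n div 2"] by (auto simp: mix_def s_def elim!: oddE)
  ultimately show ?thesis
    by (intro definableI[where p = "mix p q" and \<phi> = "Conj (ren r \<phi>) (ren s \<psi>)"])
      (simp add: sat_ren P Q)
qed

text \<open>All parameters move up by one place, which frees variable \<open>1\<close> for the
  quantifier. The renaming \<open>r\<close> sends entry \<open>0\<close> there, shifts the
  environment down by one and follows the parameters.\<close>

lemma definable_all:
  assumes "definable (\<lambda>e. P (e 0) (\<lambda>n. e (Suc n)))" shows "definable (\<lambda>e. \<forall>x. P x e)"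
proof -
  obtain \<phi> p where P: "\<And>e. P (e 0) (\<lambda>n. e (Suc n)) \<longleftrightarrow> sat mem (mix e p) \<phi>"
    using assms unfolding definable_def by blast
  define r where "r n = (if n = 0 then 1 else if even n then n - 2 else n + 2)" for n :: nat
  define q where "q n = p (n - 1)" for n
  have "(\<lambda>n. ((mix e q)(1 := x)) (r n)) = mix (case_nat x e) p" for e x
  proof
    fix n show "((mix e q)(1 := x)) (r n) = mix (case_nat x e) p n"
    proof (cases "even n")
      case True
      then show ?thesis
        by (cases "n div 2") (auto simp: mix_def r_def elim!: evenE)
    next
      case False
      then show ?thesis by (auto simp: mix_def r_def q_def elim!: oddE)
    qed
  qed
  then have "P x e \<longleftrightarrow> sat mem ((mix e q)(1 := x)) (ren r \<phi>)" for x e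
    using P[of "case_nat x e"] by (simp add: sat_ren)
  then show ?thesis
    by (intro definableI[where p = q and \<phi> = "Forall 1 (ren r \<phi>)"]) simp
qed

lemma definable_const: "definable (\<lambda>e. c)"
proof -
  have "definable (\<lambda>e. True)" by (rule definableI[where \<phi> = "Equ 0 0"]) simp
  then show ?thesis using definable_not[of "\<lambda>e. True"] by (cases c) auto
qed

lemma definable_term_var: "definable_term (\<lambda>e. e i)"
  unfolding definable_term_def by (rule definableI[where \<phi> = "Equ 0 (2 * Suc i)"]) (simp add: mix_def)

lemma definable_term_const: "definable_term (\<lambda>e. c)"
  unfolding definable_term_def by (rule definableI[where \<phi> = "Equ 0 1" and p = "\<lambda>_. c"]) (simp add: mix_def)

lemma definable_term_shift: "definable_term t \<Longrightarrow> definable_term (\<lambda>e. t (\<lambda>n. e (s n)))"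
  unfolding definable_term_def by (drule definable_ren[where s = "case_nat 0 (\<lambda>n. Suc (s n))"]) simp

lemma definable_imp: "definable P \<Longrightarrow> definable Q \<Longrightarrow> definable (\<lambda>e. P e \<longrightarrow> Q e)"
  using definable_not[OF definable_conj[of P "\<lambda>e. \<not> Q e"]] definable_not[of Q] by simp

lemma definable_disj: "definable P \<Longrightarrow> definable Q \<Longrightarrow> definable (\<lambda>e. P e \<or> Q e)"
  using definable_imp[of "\<lambda>e. \<not> P e" Q] definable_not[of P] by (simp add: disj_imp)

lemma definable_iff: "definable P \<Longrightarrow> definable Q \<Longrightarrow> definable (\<lambda>e. P e \<longleftrightarrow> Q e)"
  using definable_conj[OF definable_imp[of P Q] definable_imp[of Q P]] by (simp add: iff_conv_conj_imp)

lemma definable_ex: "definable (\<lambda>e. P (e 0) (\<lambda>n. e (Suc n))) \<Longrightarrow> definable (\<lambda>e. \<exists>x. P x e)"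
  using definable_not[OF definable_all[of "\<lambda>x e. \<not> P x e"]] definable_not[of "\<lambda>e. P (e 0) (\<lambda>n. e (Suc n))"] by simp

text \<open>The language has no function symbols, so substituting a term means asserting that some
  \<open>x\<close> equal to its value satisfies \<open>P\<close>.\<close>

lemma definable_let:
  assumes "definable_term t" "definable (\<lambda>e. P (e 0) (\<lambda>n. e (Suc n)))" shows "definable (\<lambda>e. P (t e) e)"
proof -
  have "definable (\<lambda>e. \<exists>x. x = t e \<and> P x e)"
    by (intro definable_ex definable_conj) (use assms in \<open>simp_all add: definable_term_def\<close>)
  then show ?thesis by simp
qed

lemma definable_subst1:
  assumes "definable (\<lambda>e. P (e 0))" "definable_term t" shows "definable (\<lambda>e. P (t e))"
  by (rule definable_let[where P = "\<lambda>x e. P x"]) fact+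

lemma definable_subst2:
  assumes "definable (\<lambda>e. P (e 0) (e 1))" "definable_term t" "definable_term u" shows "definable (\<lambda>e. P (t e) (u e))"
  apply (rule definable_let[OF assms(2), where P = "\<lambda>x e. P x (u e)"])
  apply (rule definable_let[OF definable_term_shift[OF assms(3), of Suc], where P = "\<lambda>y e. P (e 0) y"])
  \<comment> \<open>Each nested let pushes its value to entry \<open>0\<close>, so the arguments end
    up in reverse order and \<open>1 - n\<close> turns them round.\<close>
  using definable_ren[OF assms(1), of "\<lambda>n. 1 - n"] by simp

lemma definable_subst3:
  assumes "definable (\<lambda>e. P (e 0) (e 1) (e 2))" "definable_term t" "definable_term u" "definable_term v"
  shows "definable (\<lambda>e. P (t e) (u e) (v e))"
  apply (rule definable_let[OF assms(2), where P = "\<lambda>x e. P x (u e) (v e)"])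
  apply (rule definable_let[OF definable_term_shift[OF assms(3), of Suc], where P = "\<lambda>y e. P (e 0) y (v (\<lambda>n. e (Suc n)))"])
  apply (rule definable_let[OF definable_term_shift[OF assms(4), of "\<lambda>n. Suc (Suc n)"], where P = "\<lambda>y e. P (e (Suc 0)) (e 0) y"])
  using definable_ren[OF assms(1), of "\<lambda>n. 2 - n"] by (simp add: numeral_2_eq_2)

lemma definable_subst4:
  assumes "definable (\<lambda>e. P (e 0) (e 1) (e 2) (e 3))" "definable_term t" "definable_term u" "definable_term v" "definable_term w"
  shows "definable (\<lambda>e. P (t e) (u e) (v e) (w e))"
  apply (rule definable_let[OF assms(2), where P = "\<lambda>x e. P x (u e) (v e) (w e)"])
  apply (rule definable_let[OF definable_term_shift[OF assms(3), of Suc],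
      where P = "\<lambda>y e. P (e 0) y (v (\<lambda>n. e (Suc n))) (w (\<lambda>n. e (Suc n)))"])
  apply (rule definable_let[OF definable_term_shift[OF assms(4), of "\<lambda>n. Suc (Suc n)"],
      where P = "\<lambda>y e. P (e (Suc 0)) (e 0) y (w (\<lambda>n. e (Suc (Suc n))))"])
  apply (rule definable_let[OF definable_term_shift[OF assms(5), of "\<lambda>n. Suc (Suc (Suc n))"],
      where P = "\<lambda>y e. P (e (Suc (Suc 0))) (e (Suc 0)) (e 0) y"])
  using definable_ren[OF assms(1), of "\<lambda>n. 3 - n"] by (simp add: numeral_2_eq_2 numeral_3_eq_3)

lemma definable_mem: "definable_term t \<Longrightarrow> definable_term u \<Longrightarrow> definable (\<lambda>e. t e \<epsilon> u e)"
  by (rule definable_subst2) (auto intro: definableI[where \<phi> = "Mem 0 2"] simp: mix_def)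

lemma definable_eq: "definable_term t \<Longrightarrow> definable_term u \<Longrightarrow> definable (\<lambda>e. t e = u e)"
  by (rule definable_subst2) (auto intro: definableI[where \<phi> = "Equ 0 2"] simp: mix_def)

lemma definable_term_subst1:
  assumes "definable_term (\<lambda>e. F (e 0))" "definable_term t" shows "definable_term (\<lambda>e. F (t e))"
  using definable_subst2[of "\<lambda>x y. x = F y", OF _ definable_term_var[of 0] definable_term_shift[OF assms(2), of Suc]] assms
  by (simp add: definable_term_def)

lemma definable_term_subst2:
  assumes "definable_term (\<lambda>e. F (e 0) (e 1))" "definable_term t" "definable_term u" shows "definable_term (\<lambda>e. F (t e) (u e))"
  using definable_subst3[of "\<lambda>x y z. x = F y z", OF _ definable_term_var[of 0] definable_term_shift[OF assms(2), of Suc]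
      definable_term_shift[OF assms(3), of Suc]] assms
  by (simp add: definable_term_def numeral_2_eq_2)

lemma definable_term_subst3:
  assumes "definable_term (\<lambda>e. F (e 0) (e 1) (e 2))" "definable_term t" "definable_term u" "definable_term v"
  shows "definable_term (\<lambda>e. F (t e) (u e) (v e))"
  using definable_subst4[of "\<lambda>x y z w. x = F y z w", OF _ definable_term_var[of 0] definable_term_shift[OF assms(2), of Suc]
      definable_term_shift[OF assms(3), of Suc] definable_term_shift[OF assms(4), of Suc]] assms
  by (simp add: definable_term_def numeral_2_eq_2 numeral_3_eq_3)

end

section \<open>Sets in a model\<close>

context ZF begin

lemmas [definability] = definable_const definable_not definable_conj definable_disj definable_imp definable_iff definable_all definable_ex definable_mem definable_eq
  definable_term_var definable_term_const

lemma definable_ex1 [definability]: "definable (\<lambda>e. P (e 0) (\<lambda>n. e (Suc n))) \<Longrightarrow> definable (\<lambda>e. \<exists>!x. P x e)"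
  unfolding Ex1_def
  apply (intro definability)
  apply assumption
  subgoal by (drule definable_ren[where s = "case_nat 0 (\<lambda>n. Suc (Suc n))"]) simp
  done

lemma ext: "(\<And>z. z \<epsilon> x \<longleftrightarrow> z \<epsilon> y) \<Longrightarrow> x = y"
  using extensionality by blast

text \<open>If no such set exists, the value is one fixed element and not an unspecified one
  depending on \<open>P\<close>. Hence the graph is first-order, and definability can be checked
  before existence is proved.\<close>

definition Set :: "('a \<Rightarrow> bool) \<Rightarrow> 'a" where
  "Set P = (if \<exists>A. \<forall>x. x \<epsilon> A \<longleftrightarrow> P x then SOME A. \<forall>x. x \<epsilon> A \<longleftrightarrow> P x else undefined)"

definition isset :: "('a \<Rightarrow> bool) \<Rightarrow> bool" where
  "isset P \<longleftrightarrow> (\<exists>A. \<forall>x. x \<epsilon> A \<longleftrightarrow> P x)"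

text \<open>Guarded for the same reason as \<open>Set\<close>: a bare description operator may give
  different values for different non-unique \<open>P\<close>, and its graph need not be
  definable.\<close>

definition uniq :: "('a \<Rightarrow> bool) \<Rightarrow> 'a" where
  "uniq P = (if \<exists>!x. P x then THE x. P x else undefined)"

lemma mem_Set:
  assumes "isset P" shows "x \<epsilon> Set P \<longleftrightarrow> P x"
proof -
  have "\<forall>x. x \<epsilon> (SOME A. \<forall>x. x \<epsilon> A \<longleftrightarrow> P x) \<longleftrightarrow> P x"
    using assms unfolding isset_def by (rule someI_ex)
  then show ?thesis using assms unfolding Set_def isset_def by simp
qed

lemma eq_Set: "y = Set P \<longleftrightarrow> (\<forall>x. x \<epsilon> y \<longleftrightarrow> P x) \<or> (\<not> (\<exists>A. \<forall>x. x \<epsilon> A \<longleftrightarrow> P x)) \<and> y = undefined"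
proof (cases "isset P")
  case True
  then show ?thesis using mem_Set[OF True] ext[of y "Set P"] unfolding isset_def by blast
next
  case False
  then show ?thesis unfolding isset_def Set_def by auto
qed

lemma uniq_eq: "P x \<Longrightarrow> (\<And>y. P y \<Longrightarrow> y = x) \<Longrightarrow> uniq P = x"
  unfolding uniq_def by (subst if_P, blast) (rule the_equality)

lemma definable_term_Set [definability]:
  assumes "definable (\<lambda>e. P (e 0) (\<lambda>n. e (Suc n)))" shows "definable_term (\<lambda>e. Set (\<lambda>x. P x e))"
  unfolding definable_term_def eq_Set
  apply (intro definability)
  subgoal using definable_ren[OF assms, of "case_nat 0 (\<lambda>n. Suc (Suc n))"] by simp
  subgoal using definable_ren[OF assms, of "case_nat 0 (\<lambda>n. Suc (Suc (Suc n)))"] by simp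
  done

lemma definable_term_uniq [definability]:
  assumes "definable (\<lambda>e. P (e 0) (\<lambda>n. e (Suc n)))" shows "definable_term (\<lambda>e. uniq (\<lambda>x. P x e))"
proof -
  have *: "y = uniq P \<longleftrightarrow> (\<exists>!x. P x) \<and> P y \<or> \<not> (\<exists>!x. P x) \<and> y = undefined" for y and P :: "'a \<Rightarrow> bool"
  proof (cases "\<exists>!x. P x")
    case True
    then show ?thesis using theI'[OF True] unfolding uniq_def by auto
  next
    case False
    then show ?thesis unfolding uniq_def by simp
  qed
  show ?thesis
    unfolding definable_term_def *
    apply (intro definability)
    subgoal using definable_ren[OF assms, of "case_nat 0 (\<lambda>n. Suc (Suc n))"] by simp
    subgoal using assms by simp
    subgoal using definable_ren[OF assms, of "case_nat 0 (\<lambda>n. Suc (Suc n))"] by simp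
    done
qed

lemma definable_term_if [definability]:
  assumes "definable P" "definable_term t" "definable_term u" shows "definable_term (\<lambda>e. if P e then t e else u e)"
proof -
  have *: "y = (if P then s else r) \<longleftrightarrow> P \<and> y = s \<or> \<not> P \<and> y = r" for y P and s r :: 'a by auto
  show ?thesis
    unfolding definable_term_def *
    by (intro definability definable_ren[OF assms(1), of Suc] definable_term_shift[OF assms(2), of Suc] definable_term_shift[OF assms(3), of Suc])
qed

section \<open>Basic constructions on sets, as total definable terms\<close>

definition emp :: 'a where "emp = Set (\<lambda>x. False)"
definition upr :: "'a \<Rightarrow> 'a \<Rightarrow> 'a" where "upr a b = Set (\<lambda>z. z = a \<or> z = b)"
definition pair :: "'a \<Rightarrow> 'a \<Rightarrow> 'a" where "pair a b = Set (\<lambda>z. z = upr a a \<or> z = upr a b)"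
definition Sep :: "'a \<Rightarrow> ('a \<Rightarrow> bool) \<Rightarrow> 'a" where "Sep A P = Set (\<lambda>x. x \<epsilon> A \<and> P x)"
definition Repl :: "'a \<Rightarrow> ('a \<Rightarrow> 'a) \<Rightarrow> 'a" where "Repl A F = Set (\<lambda>y. \<exists>x. x \<epsilon> A \<and> y = F x)"
definition Uni :: "'a \<Rightarrow> ('a \<Rightarrow> 'a) \<Rightarrow> 'a" where "Uni A F = Set (\<lambda>z. \<exists>x. x \<epsilon> A \<and> z \<epsilon> F x)"
definition cup :: "'a \<Rightarrow> 'a \<Rightarrow> 'a" where "cup A B = Set (\<lambda>z. z \<epsilon> A \<or> z \<epsilon> B)"
definition suc :: "'a \<Rightarrow> 'a" where "suc a = Set (\<lambda>z. z \<epsilon> a \<or> z = a)"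
definition pow :: "'a \<Rightarrow> 'a" where "pow A = Set (\<lambda>x. \<forall>z. z \<epsilon> x \<longrightarrow> z \<epsilon> A)"
definition prd :: "'a \<Rightarrow> 'a \<Rightarrow> 'a" where "prd A B = Set (\<lambda>p. \<exists>a b. a \<epsilon> A \<and> b \<epsilon> B \<and> p = pair a b)"
definition Lam :: "'a \<Rightarrow> ('a \<Rightarrow> 'a) \<Rightarrow> 'a" where "Lam A F = Repl A (\<lambda>x. pair x (F x))"
text \<open>Every set \<open>h\<close> acts as a function; the value is junk unless exactly one pair with first
  component \<open>x\<close> belongs to \<open>h\<close>.\<close>

definition app :: "'a \<Rightarrow> 'a \<Rightarrow> 'a" where "app h x = uniq (\<lambda>y. pair x y \<epsilon> h)"
definition sub :: "'a \<Rightarrow> 'a \<Rightarrow> bool" where "sub a b \<longleftrightarrow> (\<forall>x. x \<epsilon> a \<longrightarrow> x \<epsilon> b)"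

lemma definable_term_upr [definability]: "definable_term t \<Longrightarrow> definable_term u \<Longrightarrow> definable_term (\<lambda>e. upr (t e) (u e))"
  by (rule definable_term_subst2) (unfold upr_def, intro definability)

lemma definable_term_pair [definability]: "definable_term t \<Longrightarrow> definable_term u \<Longrightarrow> definable_term (\<lambda>e. pair (t e) (u e))"
  by (rule definable_term_subst2) (unfold pair_def, intro definability)

lemma definable_term_cup [definability]: "definable_term t \<Longrightarrow> definable_term u \<Longrightarrow> definable_term (\<lambda>e. cup (t e) (u e))"
  by (rule definable_term_subst2) (unfold cup_def, intro definability)

lemma definable_term_suc [definability]: "definable_term t \<Longrightarrow> definable_term (\<lambda>e. suc (t e))"
  by (rule definable_term_subst1) (unfold suc_def, intro definability)

lemma definable_term_prd [definability]: "definable_term t \<Longrightarrow> definable_term u \<Longrightarrow> definable_term (\<lambda>e. prd (t e) (u e))"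
  by (rule definable_term_subst2) (unfold prd_def, intro definability)

lemma definable_term_app [definability]: "definable_term t \<Longrightarrow> definable_term u \<Longrightarrow> definable_term (\<lambda>e. app (t e) (u e))"
  by (rule definable_term_subst2) (unfold app_def, intro definability)

lemma definable_sub [definability]: "definable_term t \<Longrightarrow> definable_term u \<Longrightarrow> definable (\<lambda>e. sub (t e) (u e))"
  by (rule definable_subst2) (unfold sub_def, intro definability)

lemma definable_term_shift1: "definable_term t \<Longrightarrow> definable_term (\<lambda>e. t (\<lambda>n. e (Suc n)))"
  by (rule definable_term_shift)

lemma definable_term_Sep [definability]:
  "definable_term t \<Longrightarrow> definable (\<lambda>e. P (e 0) (\<lambda>n. e (Suc n))) \<Longrightarrow> definable_term (\<lambda>e. Sep (t e) (\<lambda>x. P x e))"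
  unfolding Sep_def by (intro definability) (rule definable_term_shift1)

lemma definable_term_Repl [definability]:
  "definable_term t \<Longrightarrow> definable_term (\<lambda>e. F (e 0) (\<lambda>n. e (Suc n))) \<Longrightarrow> definable_term (\<lambda>e. Repl (t e) (\<lambda>x. F x e))"
  unfolding Repl_def
  apply (intro definability)
  subgoal using definable_term_shift[of t "\<lambda>n. Suc (Suc n)"] by simp
  subgoal by (drule definable_term_shift[where s = "case_nat 0 (\<lambda>n. Suc (Suc n))"]) simp
  done

lemma definable_term_Uni [definability]:
  "definable_term t \<Longrightarrow> definable_term (\<lambda>e. F (e 0) (\<lambda>n. e (Suc n))) \<Longrightarrow> definable_term (\<lambda>e. Uni (t e) (\<lambda>x. F x e))"
  unfolding Uni_def
  apply (intro definability)
  subgoal using definable_term_shift[of t "\<lambda>n. Suc (Suc n)"] by simp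
  subgoal by (drule definable_term_shift[where s = "case_nat 0 (\<lambda>n. Suc (Suc n))"]) simp
  done

lemma mem_Sep:
  assumes "definable (\<lambda>e. P (e 0))" shows "x \<epsilon> Sep A P \<longleftrightarrow> x \<epsilon> A \<and> P x"
proof -
  obtain \<phi> p where *: "\<And>e. P (e 0) \<longleftrightarrow> sat mem (mix e p) \<phi>"
    using assms unfolding definable_def by blast
  \<comment> \<open>\<open>P\<close> looks at entry \<open>0\<close> only, so the other even entries
    can hold any value; \<open>A\<close> is at hand.\<close>
  have "mix (case_nat x (\<lambda>_. A)) p = (mix (\<lambda>_. A) p)(0 := x)" for x
    by (auto simp: mix_def fun_eq_iff split: nat.split elim!: evenE)
  then have "P x \<longleftrightarrow> sat mem ((mix (\<lambda>_. A) p)(0 := x)) \<phi>" for x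
    using *[of "case_nat x (\<lambda>_. A)"] by simp
  then have "isset (\<lambda>x. x \<epsilon> A \<and> P x)"
    using separation[rule_format, of A "mix (\<lambda>_. A) p" 0 \<phi>] unfolding isset_def by simp
  then show ?thesis unfolding Sep_def by (rule mem_Set)
qed

lemma mem_Repl:
  assumes "definable_term (\<lambda>e. F (e 0))" shows "y \<epsilon> Repl A F \<longleftrightarrow> (\<exists>x. x \<epsilon> A \<and> y = F x)"
proof -
  obtain \<phi> p where *: "\<And>e. e 0 = F (e 1) \<longleftrightarrow> sat mem (mix e p) \<phi>"
    using assms unfolding definable_def definable_term_def by fastforce
  \<comment> \<open>Variable \<open>0\<close> is the value and variable \<open>2\<close>, that is
    entry \<open>1\<close>, the argument.\<close>
  have "mix (case_nat y (case_nat x (\<lambda>_. A))) p = (mix (\<lambda>_. A) p)(2 := x, 0 := y)" for x y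
    by (auto simp: mix_def fun_eq_iff split: nat.split elim!: evenE)
  then have **: "y = F x \<longleftrightarrow> sat mem ((mix (\<lambda>_. A) p)(2 := x, 0 := y)) \<phi>" for x y
    using *[of "case_nat y (case_nat x (\<lambda>_. A))"] by simp
  have "isset (\<lambda>y. \<exists>x. x \<epsilon> A \<and> y = F x)"
    using replacement[rule_format, of 2 0 A "mix (\<lambda>_. A) p" \<phi>] unfolding isset_def
    by (simp flip: **)
  then show ?thesis unfolding Repl_def by (rule mem_Set)
qed

lemma mem_pow: "x \<epsilon> pow A \<longleftrightarrow> sub x A"
proof -
  have "isset (\<lambda>x. \<forall>z. z \<epsilon> x \<longrightarrow> z \<epsilon> A)"
    using powerset unfolding isset_def is_powerset_def by blast
  then show ?thesis unfolding pow_def sub_def by (rule mem_Set)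
qed

lemma mem_upr [simp]: "z \<epsilon> upr a b \<longleftrightarrow> z = a \<or> z = b"
proof -
  have "isset (\<lambda>z. z = a \<or> z = b)"
    using pairing unfolding isset_def is_upair_def by blast
  then show ?thesis unfolding upr_def by (rule mem_Set)
qed

lemma upr_inj: "upr a b = upr c d \<longleftrightarrow> a = c \<and> b = d \<or> a = d \<and> b = c"
proof
  assume *: "upr a b = upr c d"
  have "z = a \<or> z = b \<longleftrightarrow> z = c \<or> z = d" for z
    using arg_cong[OF *, of "\<lambda>u. z \<epsilon> u"] unfolding mem_upr by simp
  from this[of a] this[of b] this[of c] this[of d]
  show "a = c \<and> b = d \<or> a = d \<and> b = c" by auto
next
  assume "a = c \<and> b = d \<or> a = d \<and> b = c"
  then show "upr a b = upr c d" by (intro ext) auto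
qed

lemma mem_pair: "z \<epsilon> pair a b \<longleftrightarrow> z = upr a a \<or> z = upr a b"
proof -
  have "isset (\<lambda>z. z = upr a a \<or> z = upr a b)"
    unfolding isset_def by (rule exI[of _ "upr (upr a a) (upr a b)"]) simp
  then show ?thesis unfolding pair_def by (rule mem_Set)
qed

lemma pair_inj [simp]: "pair a b = pair c d \<longleftrightarrow> a = c \<and> b = d"
proof
  assume *: "pair a b = pair c d"
  have "z = upr a a \<or> z = upr a b \<longleftrightarrow> z = upr c c \<or> z = upr c d" for z
    using arg_cong[OF *, of "\<lambda>u. z \<epsilon> u"] unfolding mem_pair by simp
  from this[of "upr a a"] this[of "upr a b"] this[of "upr c d"]
  show "a = c \<and> b = d" unfolding upr_inj by auto
qed simp

lemma mem_Uni:
  assumes "definable_term (\<lambda>e. F (e 0))" shows "z \<epsilon> Uni A F \<longleftrightarrow> (\<exists>x. x \<epsilon> A \<and> z \<epsilon> F x)"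
proof -
  obtain U where "\<And>z. z \<epsilon> U \<longleftrightarrow> (\<exists>x. x \<epsilon> Repl A F \<and> z \<epsilon> x)"
    using union by blast
  then have "z \<epsilon> U \<longleftrightarrow> (\<exists>x. x \<epsilon> A \<and> z \<epsilon> F x)" for z
    unfolding mem_Repl[OF assms] by blast
  then have "isset (\<lambda>z. \<exists>x. x \<epsilon> A \<and> z \<epsilon> F x)"
    unfolding isset_def by blast
  then show ?thesis unfolding Uni_def by (rule mem_Set)
qed

lemma mem_cup [simp]: "z \<epsilon> cup A B \<longleftrightarrow> z \<epsilon> A \<or> z \<epsilon> B"
proof -
  obtain U where "\<And>z. z \<epsilon> U \<longleftrightarrow> (\<exists>x. x \<epsilon> upr A B \<and> z \<epsilon> x)"
    using union by blast
  then have "z \<epsilon> U \<longleftrightarrow> z \<epsilon> A \<or> z \<epsilon> B" for z by auto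
  then have "isset (\<lambda>z. z \<epsilon> A \<or> z \<epsilon> B)" unfolding isset_def by blast
  then show ?thesis unfolding cup_def by (rule mem_Set)
qed

lemma mem_suc [simp]: "z \<epsilon> suc a \<longleftrightarrow> z \<epsilon> a \<or> z = a"
proof -
  have "isset (\<lambda>z. z \<epsilon> a \<or> z = a)" 
    unfolding isset_def by (rule exI[of _ "cup a (upr a a)"]) simp
  then show ?thesis unfolding suc_def by (rule mem_Set)
qed

lemma mem_emp [simp]: "\<not> z \<epsilon> emp"
proof -
  have "isset (\<lambda>z. False)" 
    unfolding isset_def using mem_Sep[OF definable_const, of _ undefined False] by blast
  then show ?thesis unfolding emp_def by (simp add: mem_Set)
qed

lemma mem_prd: "p \<epsilon> prd A B \<longleftrightarrow> (\<exists>a b. a \<epsilon> A \<and> b \<epsilon> B \<and> p = pair a b)"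
proof -
  have "p \<epsilon> Uni A (\<lambda>a. Repl B (pair a)) \<longleftrightarrow> (\<exists>a b. a \<epsilon> A \<and> b \<epsilon> B \<and> p = pair a b)" for p
    apply (subst mem_Uni, intro definability)
    apply (subst mem_Repl, intro definability)
    by blast
  then have "isset (\<lambda>p. \<exists>a b. a \<epsilon> A \<and> b \<epsilon> B \<and> p = pair a b)" unfolding isset_def by blast
  then show ?thesis unfolding prd_def by (rule mem_Set)
qed

lemma mem_prd_pair [simp]: "pair a b \<epsilon> prd A B \<longleftrightarrow> a \<epsilon> A \<and> b \<epsilon> B"
  by (simp add: mem_prd)

lemma app_Lam:
  assumes "definable_term (\<lambda>e. F (e 0))" "x \<epsilon> A" shows "app (Lam A F) x = F x"
proof -
  have "definable_term (\<lambda>e. pair (e 0) (F (e 0)))" by (intro definability assms)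
  then show ?thesis
    unfolding app_def Lam_def by (intro uniq_eq) (use assms(2) in \<open>auto simp: mem_Repl\<close>)
qed

lemma emp_eq: "A = emp \<longleftrightarrow> (\<forall>x. \<not> x \<epsilon> A)"
proof
  assume "\<forall>x. \<not> x \<epsilon> A" then show "A = emp" by (intro ext) simp
qed simp

lemma subD: "sub a b \<Longrightarrow> x \<epsilon> a \<Longrightarrow> x \<epsilon> b"
  by (simp add: sub_def)

lemma sub_refl [simp]: "sub a a" by (simp add: sub_def)

lemma sub_trans: "sub a b \<Longrightarrow> sub b c \<Longrightarrow> sub a c" by (simp add: sub_def)

lemma sub_antisym: "sub a b \<Longrightarrow> sub b a \<Longrightarrow> a = b"
  unfolding sub_def by (intro ext) blast

end

section \<open>Ordinals\<close>

context ZF begin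

lemma foundation_min:
  assumes "definable (\<lambda>e. P (e 0))" "x \<epsilon> A" "P x"
  shows "\<exists>y. y \<epsilon> A \<and> P y \<and> (\<forall>z. z \<epsilon> y \<longrightarrow> z \<epsilon> A \<longrightarrow> \<not> P z)"
  using foundation[rule_format, of "Sep A P"] assms(2,3) unfolding mem_Sep[OF assms(1)] by blast

lemma mem_irrefl [simp]: "\<not> x \<epsilon> x"
  using foundation_min[of "\<lambda>_. True" x "upr x x", OF definable_const] by auto

lemma mem_asym: "x \<epsilon> y \<Longrightarrow> \<not> y \<epsilon> x"
  using foundation_min[of "\<lambda>_. True" x "upr x y", OF definable_const] by auto

text \<open>Transitive sets of transitive sets; that membership well-orders them comes from
  foundation.\<close>

definition Ord :: "'a \<Rightarrow> bool" where
  "Ord a \<longleftrightarrow> (\<forall>x. x \<epsilon> a \<longrightarrow> sub x a \<and> (\<forall>y. y \<epsilon> x \<longrightarrow> sub y x))"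

lemma definable_Ord [definability]: "definable_term t \<Longrightarrow> definable (\<lambda>e. Ord (t e))"
  by (rule definable_subst1) (unfold Ord_def, intro definability)

lemma Ord_sub: "Ord a \<Longrightarrow> x \<epsilon> a \<Longrightarrow> sub x a"
  by (simp add: Ord_def)

lemma Ord_trans: "Ord a \<Longrightarrow> y \<epsilon> x \<Longrightarrow> x \<epsilon> a \<Longrightarrow> y \<epsilon> a"
  using Ord_sub subD by blast

lemma Ord_mem: "Ord a \<Longrightarrow> x \<epsilon> a \<Longrightarrow> Ord x"
  unfolding Ord_def sub_def by blast

lemma Ord_least:
  assumes "definable (\<lambda>e. P (e 0))" "Ord a" "P a"
  obtains b where "Ord b" "P b" "\<And>c. c \<epsilon> b \<Longrightarrow> \<not> P c" "b = a \<or> b \<epsilon> a"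
proof -
  obtain b where b: "b \<epsilon> suc a" "P b" "\<forall>z. z \<epsilon> b \<longrightarrow> z \<epsilon> suc a \<longrightarrow> \<not> P z"
    using foundation_min[OF assms(1), of a "suc a"] assms by auto
  then have "Ord b" "z \<epsilon> b \<Longrightarrow> z \<epsilon> suc a" for z
    using assms(2) by (auto intro: Ord_mem Ord_trans)
  then show thesis using b by (intro that) auto
qed

lemma Ord_induct:
  assumes "definable (\<lambda>e. P (e 0))" "Ord a" "\<And>a. Ord a \<Longrightarrow> (\<And>b. b \<epsilon> a \<Longrightarrow> P b) \<Longrightarrow> P a"
  shows "P a"
proof (rule ccontr)
  assume n: "\<not> P a"
  have d: "definable (\<lambda>e. \<not> P (e 0))" by (intro definability assms)
  obtain b where b: "Ord b" "\<not> P b" "\<And>c. c \<epsilon> b \<Longrightarrow> \<not> \<not> P c"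
    using Ord_least[OF d assms(2) n] by metis
  have "P b" using b(1) by (rule assms(3)) (use b(3) in blast)
  then show False using b(2) by blast
qed

text \<open>Nested induction: if \<open>a\<close> and \<open>b\<close> are incomparable while the
  members of each are comparable with the other, then both have the same members.\<close>

lemma Ord_linear:
  assumes "Ord a" "Ord b" shows "a \<epsilon> b \<or> a = b \<or> b \<epsilon> a"
proof -
  have "definable (\<lambda>e. \<forall>b. Ord b \<longrightarrow> e 0 \<epsilon> b \<or> e 0 = b \<or> b \<epsilon> e 0)" by (intro definability)
  then have "\<forall>b. Ord b \<longrightarrow> a \<epsilon> b \<or> a = b \<or> b \<epsilon> a"
  proof (rule Ord_induct[OF _ assms(1)])
    fix a assume a: "Ord a" "\<And>c. c \<epsilon> a \<Longrightarrow> \<forall>b. Ord b \<longrightarrow> c \<epsilon> b \<or> c = b \<or> b \<epsilon> c"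
    have "a \<epsilon> b \<or> a = b \<or> b \<epsilon> a" if "Ord b" for b
    proof (rule Ord_induct[OF _ that, of "\<lambda>b. a \<epsilon> b \<or> a = b \<or> b \<epsilon> a"])
      show "definable (\<lambda>e. a \<epsilon> e 0 \<or> a = e 0 \<or> e 0 \<epsilon> a)" by (intro definability)
      fix b assume b: "Ord b" "\<And>c. c \<epsilon> b \<Longrightarrow> a \<epsilon> c \<or> a = c \<or> c \<epsilon> a"
      show "a \<epsilon> b \<or> a = b \<or> b \<epsilon> a"
      proof (rule ccontr)
        assume n: "\<not> (a \<epsilon> b \<or> a = b \<or> b \<epsilon> a)"
        have "a = b"
        proof (rule ext)
          fix z
          show "z \<epsilon> a \<longleftrightarrow> z \<epsilon> b"
            using a b n Ord_trans[of a] Ord_trans[of b] by blast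
        qed
        then show False using n by blast
      qed
    qed
    then show "\<forall>b. Ord b \<longrightarrow> a \<epsilon> b \<or> a = b \<or> b \<epsilon> a" by blast
  qed
  then show ?thesis using assms by blast
qed

lemma sub_iff: "Ord a \<Longrightarrow> Ord b \<Longrightarrow> sub a b \<longleftrightarrow> a \<epsilon> b \<or> a = b"
  using Ord_linear[of a b] Ord_sub[of b a] subD[of a b b] mem_irrefl[of b] sub_refl by blast

lemma not_sub: "Ord a \<Longrightarrow> Ord b \<Longrightarrow> \<not> sub a b \<longleftrightarrow> b \<epsilon> a"
  using Ord_linear[of a b] sub_iff[of a b] mem_asym[of a b] mem_irrefl by blast

lemma sub_linear: "Ord a \<Longrightarrow> Ord b \<Longrightarrow> sub a b \<or> sub b a"
  using not_sub Ord_sub by blast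

lemma mem_sub: "Ord c \<Longrightarrow> Ord a \<Longrightarrow> sub a b \<Longrightarrow> b \<epsilon> c \<Longrightarrow> a \<epsilon> c"
  using sub_iff[of a b] Ord_mem[of c b] Ord_trans[of c a b] by blast

lemma Ord_emp [simp]: "Ord emp" by (simp add: Ord_def)

lemma Ord_of_trans: "(\<And>x. x \<epsilon> A \<Longrightarrow> Ord x \<and> sub x A) \<Longrightarrow> Ord A"
  unfolding Ord_def sub_def by blast

lemma Ord_suc:
  assumes "Ord a" shows "Ord (suc a)"
proof (rule Ord_of_trans)
  fix x assume "x \<epsilon> suc a"
  then have "x \<epsilon> a \<or> x = a" by simp
  then have "Ord x" "sub x a" using assms Ord_mem Ord_sub by auto
  then show "Ord x \<and> sub x (suc a)" by (simp add: sub_def)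
qed

lemma suc_sub: "Ord b \<Longrightarrow> a \<epsilon> b \<Longrightarrow> sub (suc a) b"
  using Ord_sub[of b a] unfolding sub_def by auto

lemma suc_neq_emp [simp]: "suc a \<noteq> emp" "emp \<noteq> suc a"
  using mem_suc mem_emp by metis+

lemma Ord_Uni:
  assumes "definable_term (\<lambda>e. F (e 0))" "\<And>x. x \<epsilon> A \<Longrightarrow> Ord (F x)" shows "Ord (Uni A F)"
proof (rule Ord_of_trans)
  fix x assume "x \<epsilon> Uni A F"
  then obtain y where y: "y \<epsilon> A" "x \<epsilon> F y" unfolding mem_Uni[OF assms(1)] by blast
  have "sub x (F y)" using assms(2) y Ord_sub by blast
  then have "sub x (Uni A F)" using y unfolding sub_def mem_Uni[OF assms(1)] by blast
  then show "Ord x \<and> sub x (Uni A F)" using assms(2) y Ord_mem by blast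
qed

text \<open>Burali-Forti: otherwise the ordinals in \<open>A\<close> would form an ordinal, which
  would be a member of itself.\<close>

lemma no_set_of_ordinals: "\<exists>a. Ord a \<and> \<not> a \<epsilon> A"
proof -
  have "definable (\<lambda>e. Ord (e 0))" by (intro definability)
  note * = mem_Sep[OF this]
  show ?thesis
  proof (rule ccontr)
    assume "\<not> ?thesis"
    then have o: "x \<epsilon> Sep A Ord \<longleftrightarrow> Ord x" for x using * by blast
    then have "Ord (Sep A Ord)"
      by (intro Ord_of_trans) (auto simp: sub_def o dest: Ord_mem)
    then show False using o[of "Sep A Ord"] by simp
  qed
qed

text \<open>Being a definable term, it picks an index for all points by one formula; this takes the
  place of choice throughout.\<close>

definition least_ord :: "('a \<Rightarrow> bool) \<Rightarrow> 'a" where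
  "least_ord P = uniq (\<lambda>a. Ord a \<and> P a \<and> (\<forall>b. b \<epsilon> a \<longrightarrow> \<not> P b))"

lemma definable_term_least_ord [definability]:
  assumes "definable (\<lambda>e. P (e 0) (\<lambda>n. e (Suc n)))" shows "definable_term (\<lambda>e. least_ord (\<lambda>x. P x e))"
  unfolding least_ord_def
  apply (intro definability)
  subgoal by fact
  subgoal using definable_ren[OF assms, of "case_nat 0 (\<lambda>n. Suc (Suc n))"] by simp
  done

lemma least_ord:
  assumes "definable (\<lambda>e. P (e 0))" "Ord a" "P a"
  shows "Ord (least_ord P)" "P (least_ord P)" "b \<epsilon> least_ord P \<Longrightarrow> \<not> P b" "sub (least_ord P) a"
proof -
  obtain c where c: "Ord c" "P c" "\<And>d. d \<epsilon> c \<Longrightarrow> \<not> P d" "c = a \<or> c \<epsilon> a"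
    using Ord_least[OF assms] by metis
  have "least_ord P = c"
    unfolding least_ord_def
  proof (rule uniq_eq)
    show "Ord c \<and> P c \<and> (\<forall>b. b \<epsilon> c \<longrightarrow> \<not> P b)" using c by blast
    show "d = c" if "Ord d \<and> P d \<and> (\<forall>b. b \<epsilon> d \<longrightarrow> \<not> P b)" for d
      using that c Ord_linear[of c d] by blast
  qed
  then show "Ord (least_ord P)" "P (least_ord P)" "b \<epsilon> least_ord P \<Longrightarrow> \<not> P b" "sub (least_ord P) a"
    using c assms(2) sub_iff by auto
qed

section \<open>The natural numbers of the model\<close>

definition omega :: 'a where "omega = Set (\<lambda>n. \<forall>I. is_inductive I \<longrightarrow> n \<epsilon> I)"

lemma is_empty_iff: "is_empty x \<longleftrightarrow> x = emp"
  unfolding is_empty_def emp_eq by simp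

lemma is_successor_iff: "is_successor s x \<longleftrightarrow> s = suc x"
proof
  assume "is_successor s x" then show "s = suc x"
    unfolding is_successor_def by (intro ext) simp
qed (simp add: is_successor_def)

lemma is_inductive_iff: "is_inductive I \<longleftrightarrow> emp \<epsilon> I \<and> (\<forall>x. x \<epsilon> I \<longrightarrow> suc x \<epsilon> I)"
  unfolding is_inductive_def is_empty_iff is_successor_iff by blast

lemma mem_omega: "n \<epsilon> omega \<longleftrightarrow> (\<forall>I. is_inductive I \<longrightarrow> n \<epsilon> I)"
proof -
  obtain I where I: "is_inductive I" using infinity by blast
  have "definable (\<lambda>e. \<forall>I. is_inductive I \<longrightarrow> e 0 \<epsilon> I)"
    unfolding is_inductive_iff by (intro definability)
  note * = mem_Sep[OF this]
  have "isset (\<lambda>n. \<forall>I. is_inductive I \<longrightarrow> n \<epsilon> I)"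
    unfolding isset_def
    by (rule exI[of _ "Sep I (\<lambda>n. \<forall>I. is_inductive I \<longrightarrow> n \<epsilon> I)"]) (use * I in blast)
  then show ?thesis unfolding omega_def by (rule mem_Set)
qed

lemma emp_omega [simp]: "emp \<epsilon> omega"
  and suc_omega [simp]: "n \<epsilon> omega \<Longrightarrow> suc n \<epsilon> omega"
  unfolding mem_omega is_inductive_iff by auto

lemma omega_induct:
  assumes "definable (\<lambda>e. P (e 0))" "n \<epsilon> omega" "P emp" "\<And>n. n \<epsilon> omega \<Longrightarrow> P n \<Longrightarrow> P (suc n)"
  shows "P n"
proof -
  have "is_inductive (Sep omega P)"
    unfolding is_inductive_iff mem_Sep[OF assms(1)] using assms(3,4) by simp
  then have "n \<epsilon> Sep omega P" using assms(2) unfolding mem_omega by blast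
  then show ?thesis unfolding mem_Sep[OF assms(1)] by blast
qed

lemma Ord_omega [simp]: "Ord omega"
proof (rule Ord_of_trans)
  fix n assume n: "n \<epsilon> omega"
  show "Ord n \<and> sub n omega"
    by (rule omega_induct[OF _ n]) (intro definability, auto simp: Ord_suc sub_def)
qed

lemma omega_cases:
  assumes "n \<epsilon> omega" obtains "n = emp" | m where "m \<epsilon> omega" "n = suc m"
proof -
  have "n = emp \<or> (\<exists>m. m \<epsilon> omega \<and> n = suc m)"
    by (rule omega_induct[OF _ assms]) (intro definability, auto)
  then show thesis using that by blast
qed

lemma suc_inj: assumes "suc a = suc b" shows "a = b"
proof -
  have "a \<epsilon> suc b" unfolding assms[symmetric] by simp
  moreover have "b \<epsilon> suc a" unfolding assms by simp
  ultimately show ?thesis using mem_asym[of a b] by auto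
qed

end

section \<open>Maps and collapses of well-orders\<close>

context ZF begin

text \<open>Values outside \<open>B\<close> are allowed. So the relation passes to larger
  \<open>A\<close> and smaller \<open>B\<close>, and no default value is needed when
  \<open>B\<close> is empty.\<close>

definition onto :: "'a \<Rightarrow> 'a \<Rightarrow> bool" where
  "onto A B \<longleftrightarrow> (\<exists>h. \<forall>y. y \<epsilon> B \<longrightarrow> (\<exists>x. x \<epsilon> A \<and> app h x = y))"

definition embeds :: "'a \<Rightarrow> 'a \<Rightarrow> bool" where
  "embeds A B \<longleftrightarrow> (\<exists>h. (\<forall>x. x \<epsilon> A \<longrightarrow> app h x \<epsilon> B) \<and>
     (\<forall>x y. x \<epsilon> A \<longrightarrow> y \<epsilon> A \<longrightarrow> app h x = app h y \<longrightarrow> x = y))"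

lemma definable_onto [definability]: "definable_term t \<Longrightarrow> definable_term u \<Longrightarrow> definable (\<lambda>e. onto (t e) (u e))"
  by (rule definable_subst2) (unfold onto_def, intro definability)

lemma definable_embeds [definability]: "definable_term t \<Longrightarrow> definable_term u \<Longrightarrow> definable (\<lambda>e. embeds (t e) (u e))"
  by (rule definable_subst2) (unfold embeds_def, intro definability)

lemma ontoI:
  assumes "definable_term (\<lambda>e. F (e 0))" "\<And>y. y \<epsilon> B \<Longrightarrow> \<exists>x. x \<epsilon> A \<and> F x = y" shows "onto A B"
  unfolding onto_def
proof (rule exI[of _ "Lam A F"], intro allI impI)
  fix y assume "y \<epsilon> B"
  then obtain x where "x \<epsilon> A" "F x = y" using assms(2) by blast
  then show "\<exists>x. x \<epsilon> A \<and> app (Lam A F) x = y" using app_Lam[OF assms(1)] by auto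
qed

lemma embI:
  assumes "definable_term (\<lambda>e. F (e 0))" "\<And>x. x \<epsilon> A \<Longrightarrow> F x \<epsilon> B"
    "\<And>x y. x \<epsilon> A \<Longrightarrow> y \<epsilon> A \<Longrightarrow> F x = F y \<Longrightarrow> x = y"
  shows "embeds A B"
  unfolding embeds_def
  using assms(2,3) app_Lam[OF assms(1), of _ A]
  by (intro exI[of _ "Lam A F"]) auto

lemma onto_trans:
  assumes "onto A B" "onto B C" shows "onto A C"
proof -
  obtain h k where h: "\<And>y. y \<epsilon> B \<Longrightarrow> \<exists>x. x \<epsilon> A \<and> app h x = y"
    and k: "\<And>y. y \<epsilon> C \<Longrightarrow> \<exists>x. x \<epsilon> B \<and> app k x = y"
    using assms unfolding onto_def by blast
  show ?thesis
  proof (rule ontoI)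
    show "definable_term (\<lambda>e. app k (app h (e 0)))" by (intro definability)
    show "\<exists>x. x \<epsilon> A \<and> app k (app h x) = y" if "y \<epsilon> C" for y
      using h k[OF that] by metis
  qed
qed

lemma emb_trans:
  assumes "embeds A B" "embeds B C" shows "embeds A C"
proof -
  obtain h where h: "\<And>x. x \<epsilon> A \<Longrightarrow> app h x \<epsilon> B"
      "\<And>x y. x \<epsilon> A \<Longrightarrow> y \<epsilon> A \<Longrightarrow> app h x = app h y \<Longrightarrow> x = y"
    using assms(1) unfolding embeds_def by blast
  obtain k where k: "\<And>x. x \<epsilon> B \<Longrightarrow> app k x \<epsilon> C"
      "\<And>x y. x \<epsilon> B \<Longrightarrow> y \<epsilon> B \<Longrightarrow> app k x = app k y \<Longrightarrow> x = y"
    using assms(2) unfolding embeds_def by blast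
  show ?thesis
  proof (rule embI)
    show "definable_term (\<lambda>e. app k (app h (e 0)))" by (intro definability)
    show "app k (app h x) \<epsilon> C" if "x \<epsilon> A" for x using h k that by blast
    show "x = y" if "x \<epsilon> A" "y \<epsilon> A" "app k (app h x) = app k (app h y)" for x y
      using that(1,2) by (rule h(2)) (rule k(2)[OF h(1)[OF that(1)] h(1)[OF that(2)] that(3)])
  qed
qed

lemma sub_emb: "sub A B \<Longrightarrow> embeds A B"
  by (rule embI[of "\<lambda>x. x"]) (intro definability, auto dest: subD)

lemma emb_onto:
  assumes "embeds A B" shows "onto B A"
proof -
  obtain h where h: "\<And>x. x \<epsilon> A \<Longrightarrow> app h x \<epsilon> B"
      "\<And>x y. x \<epsilon> A \<Longrightarrow> y \<epsilon> A \<Longrightarrow> app h x = app h y \<Longrightarrow> x = y"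
    using assms(1) unfolding embeds_def by blast
  show ?thesis
  proof (rule ontoI)
    show "definable_term (\<lambda>e. uniq (\<lambda>a. a \<epsilon> A \<and> app h a = e 0))" by (intro definability)
    show "\<exists>x. x \<epsilon> B \<and> uniq (\<lambda>a. a \<epsilon> A \<and> app h a = x) = y" if "y \<epsilon> A" for y
      by (intro exI[of _ "app h y"] conjI uniq_eq) (use h that in auto)
  qed
qed

lemma onto_mono: "onto A B \<Longrightarrow> sub A A' \<Longrightarrow> sub B' B \<Longrightarrow> onto A' B'"
  unfolding onto_def sub_def by meson

text \<open>The Mostowski collapse. \<open>p\<close> is a partial solution of the recursion, correct
  on the predecessors of \<open>y\<close>; taking it from inside the model keeps the recursion
  first-order.\<close>

definition collapse :: "'a \<Rightarrow> ('a \<Rightarrow> 'a \<Rightarrow> bool) \<Rightarrow> 'a \<Rightarrow> 'a" where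
  "collapse D R y = uniq (\<lambda>v. \<exists>p.
     (\<forall>z. z \<epsilon> Sep D (\<lambda>z. R z y) \<longrightarrow> app p z = Repl (Sep D (\<lambda>w. R w z)) (app p)) \<and>
     v = Repl (Sep D (\<lambda>z. R z y)) (app p))"

lemma Repl_cong:
  "(\<And>x. x \<epsilon> A \<Longrightarrow> F x = G x) \<Longrightarrow> Repl A F = Repl A G"
  unfolding Repl_def by (metis (no_types, lifting))

end

text \<open>\<open>R\<close> is a definable predicate rather than a set, so membership and
  \<open>goedel\<close> are instances without being cut down to \<open>D\<close>. Minimal elements
  are demanded only for subsets that belong to the model.\<close>

locale well_ordered = ZF +
  fixes D :: 'a and R :: "'a \<Rightarrow> 'a \<Rightarrow> bool"
  assumes def: "definable (\<lambda>e. R (e 0) (e 1))"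
    and transitive: "x \<epsilon> D \<Longrightarrow> y \<epsilon> D \<Longrightarrow> z \<epsilon> D \<Longrightarrow> R x y \<Longrightarrow> R y z \<Longrightarrow> R x z"
    and total: "x \<epsilon> D \<Longrightarrow> y \<epsilon> D \<Longrightarrow> R x y \<or> x = y \<or> R y x"
    and wf: "sub S D \<Longrightarrow> z \<epsilon> S \<Longrightarrow> \<exists>x. x \<epsilon> S \<and> (\<forall>y. y \<epsilon> S \<longrightarrow> \<not> R y x)"
begin

lemma definable_R [definability]: "definable_term t \<Longrightarrow> definable_term u \<Longrightarrow> definable (\<lambda>e. R (t e) (u e))"
  by (rule definable_subst2[OF def])

definition seg :: "'a \<Rightarrow> 'a" where "seg x = Sep D (\<lambda>z. R z x)"

lemma definable_term_seg [definability]: "definable_term t \<Longrightarrow> definable_term (\<lambda>e. seg (t e))"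
  by (rule definable_term_subst1) (unfold seg_def, intro definability)

lemma mem_seg: "z \<epsilon> seg x \<longleftrightarrow> z \<epsilon> D \<and> R z x"
  unfolding seg_def by (rule mem_Sep) (intro definability)

lemma wo_induct:
  assumes "definable (\<lambda>e. P (e 0))" "x \<epsilon> D" "\<And>x. x \<epsilon> D \<Longrightarrow> (\<And>y. y \<epsilon> D \<Longrightarrow> R y x \<Longrightarrow> P y) \<Longrightarrow> P x"
  shows "P x"
proof (rule ccontr)
  assume n: "\<not> P x"
  have "definable (\<lambda>e. \<not> P (e 0))" by (intro definability assms)
  note * = mem_Sep[OF this]
  have "sub (Sep D (\<lambda>x. \<not> P x)) D" "x \<epsilon> Sep D (\<lambda>x. \<not> P x)"
    using n assms(2) by (auto simp: sub_def *)
  from wf[OF this] obtain y where "y \<epsilon> D" "\<not> P y" "\<And>z. z \<epsilon> D \<Longrightarrow> R z y \<Longrightarrow> P z"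
    unfolding * by blast
  then show False using assms(3) by blast
qed

definition recur :: "'a \<Rightarrow> 'a \<Rightarrow> bool" where
  "recur p S \<longleftrightarrow> (\<forall>y. y \<epsilon> S \<longrightarrow> app p y = Repl (seg y) (app p))"

lemma definable_recur [definability]: "definable_term t \<Longrightarrow> definable_term u \<Longrightarrow> definable (\<lambda>e. recur (t e) (u e))"
  by (rule definable_subst2) (unfold recur_def, intro definability)

lemma recur_unique:
  assumes "recur p S" "recur q S" "sub S D" "\<And>x y. x \<epsilon> D \<Longrightarrow> R x y \<Longrightarrow> y \<epsilon> S \<Longrightarrow> x \<epsilon> S" "x \<epsilon> S"
  shows "app p x = app q x"
proof -
  have "x \<epsilon> D" using assms(3,5) subD by blast
  then have "x \<epsilon> S \<longrightarrow> app p x = app q x"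
  proof (rule wo_induct[where P = "\<lambda>x. x \<epsilon> S \<longrightarrow> app p x = app q x", rotated])
    show "definable (\<lambda>e. e 0 \<epsilon> S \<longrightarrow> app p (e 0) = app q (e 0))" by (intro definability)
    fix x assume x: "x \<epsilon> D" and IH: "\<And>y. y \<epsilon> D \<Longrightarrow> R y x \<Longrightarrow> y \<epsilon> S \<longrightarrow> app p y = app q y"
    have "Repl (seg x) (app p) = Repl (seg x) (app q)" if "x \<epsilon> S"
      by (rule Repl_cong) (use IH assms(4) that in \<open>auto simp: mem_seg\<close>)
    then show "x \<epsilon> S \<longrightarrow> app p x = app q x" using assms(1,2) unfolding recur_def by simp
  qed
  then show ?thesis using assms(5) by blast
qed

lemma seg_down: "y \<epsilon> D \<Longrightarrow> x \<epsilon> D \<Longrightarrow> R x z \<Longrightarrow> z \<epsilon> seg y \<Longrightarrow> x \<epsilon> seg y"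
  unfolding mem_seg using transitive by blast

lemma col_alt: "collapse D R y = uniq (\<lambda>v. \<exists>p. recur p (seg y) \<and> v = Repl (seg y) (app p))"
  unfolding collapse_def recur_def seg_def ..

lemma definable_term_collapse [definability]: "definable_term t \<Longrightarrow> definable_term (\<lambda>e. collapse D R (t e))"
  by (rule definable_term_subst1) (unfold col_alt, intro definability)

lemma col_eq:
  assumes "y \<epsilon> D" "recur p (seg y)" shows "collapse D R y = Repl (seg y) (app p)"
  unfolding col_alt
proof (rule uniq_eq)
  fix v assume "\<exists>q. recur q (seg y) \<and> v = Repl (seg y) (app q)"
  then obtain q where q: "recur q (seg y)" "v = Repl (seg y) (app q)" by blast
  have s: "sub (seg y) D" by (simp add: sub_def mem_seg)
  show "v = Repl (seg y) (app p)"
    unfolding q(2)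
  proof (rule Repl_cong)
    fix x assume x: "x \<epsilon> seg y"
    show "app q x = app p x"
      by (rule recur_unique[OF q(1) assms(2) s _ x]) (rule seg_down[OF assms(1)])
  qed
next
  show "\<exists>q. recur q (seg y) \<and> Repl (seg y) (app p) = Repl (seg y) (app q)"
    by (intro exI[of _ p] conjI assms(2) refl)
qed

text \<open>Gluing: a partial solution on \<open>seg y\<close> restricts to every earlier segment,
  so by uniqueness it already computes \<open>collapse D R\<close> there.\<close>

lemma recur_col:
  assumes "sub S D" "\<And>x y. x \<epsilon> D \<Longrightarrow> R x y \<Longrightarrow> y \<epsilon> S \<Longrightarrow> x \<epsilon> S"
    "\<And>y. y \<epsilon> S \<Longrightarrow> \<exists>p. recur p (seg y)"
  shows "recur (Lam S (collapse D R)) S"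
  unfolding recur_def
proof (intro allI impI)
  have l: "app (Lam S (collapse D R)) z = collapse D R z" if "z \<epsilon> S" for z
    by (rule app_Lam[OF _ that]) (intro definability)
  fix y assume y: "y \<epsilon> S"
  then obtain p where p: "recur p (seg y)" using assms by blast
  have yD: "y \<epsilon> D" using assms(1) y subD by blast
  have "app p z = app (Lam S (collapse D R)) z" if "z \<epsilon> seg y" for z
  proof -
    have zD: "z \<epsilon> D" "z \<epsilon> S" using that assms(2)[OF _ _ y] by (auto simp: mem_seg)
    have "recur p (seg z)"
      using p seg_down[OF yD _ _ that] unfolding recur_def mem_seg by blast
    then have "collapse D R z = Repl (seg z) (app p)" by (rule col_eq[OF zD(1)])
    also have "\<dots> = app p z" using p that unfolding recur_def by simp
    finally show ?thesis using l[OF zD(2)] by simp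
  qed
  then show "app (Lam S (collapse D R)) y = Repl (seg y) (app (Lam S (collapse D R)))"
    unfolding l[OF y] col_eq[OF yD p] by (rule Repl_cong)
qed

lemma ex_recur: "y \<epsilon> D \<Longrightarrow> \<exists>p. recur p (seg y)"
proof (erule wo_induct[rotated])
  show "definable (\<lambda>e. \<exists>p. recur p (seg (e 0)))" by (intro definability)
  fix x assume x: "x \<epsilon> D" "\<And>y. y \<epsilon> D \<Longrightarrow> R y x \<Longrightarrow> \<exists>p. recur p (seg y)"
  have "recur (Lam (seg x) (collapse D R)) (seg x)"
    by (rule recur_col) (use x seg_down[OF x(1)] in \<open>auto simp: mem_seg sub_def\<close>)
  then show "\<exists>p. recur p (seg x)" by blast
qed

lemma mem_col:
  assumes "y \<epsilon> D" shows "v \<epsilon> collapse D R y \<longleftrightarrow> (\<exists>z. z \<epsilon> D \<and> R z y \<and> v = collapse D R z)"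
proof -
  have r: "recur (Lam D (collapse D R)) D"
    by (rule recur_col) (use ex_recur in auto)
  then have "recur (Lam D (collapse D R)) (seg y)" unfolding recur_def mem_seg by blast
  then have "collapse D R y = Repl (seg y) (app (Lam D (collapse D R)))" by (rule col_eq[OF assms])
  also have "\<dots> = Repl (seg y) (collapse D R)"
    by (rule Repl_cong, rule app_Lam) (intro definability, simp add: mem_seg)
  finally have *: "collapse D R y = Repl (seg y) (collapse D R)" .
  show ?thesis unfolding * by (subst mem_Repl, intro definability) (auto simp: mem_seg)
qed

lemma col_mono: "x \<epsilon> D \<Longrightarrow> y \<epsilon> D \<Longrightarrow> R x y \<Longrightarrow> collapse D R x \<epsilon> collapse D R y"
  using mem_col by blast

lemma col_inj: "x \<epsilon> D \<Longrightarrow> y \<epsilon> D \<Longrightarrow> collapse D R x = collapse D R y \<Longrightarrow> x = y"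
  using col_mono[of x y] col_mono[of y x] total[of x y] mem_irrefl by metis

lemma col_less: "x \<epsilon> D \<Longrightarrow> y \<epsilon> D \<Longrightarrow> collapse D R x \<epsilon> collapse D R y \<longleftrightarrow> R x y"
  using col_mono[of x y] col_mono[of y x] total[of x y] mem_irrefl mem_asym by metis

lemma Ord_col: "y \<epsilon> D \<Longrightarrow> Ord (collapse D R y)"
proof (erule wo_induct[rotated])
  show "definable (\<lambda>e. Ord (collapse D R (e 0)))" by (intro definability)
  fix x assume x: "x \<epsilon> D" and IH: "\<And>y. y \<epsilon> D \<Longrightarrow> R y x \<Longrightarrow> Ord (collapse D R y)"
  show "Ord (collapse D R x)"
  proof (rule Ord_of_trans)
    fix v assume "v \<epsilon> collapse D R x"
    then obtain z where z: "z \<epsilon> D" "R z x" "v = collapse D R z" using mem_col x by blast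
    have "w \<epsilon> collapse D R x" if "w \<epsilon> v" for w
      using that transitive z x unfolding z(3) mem_col[OF z(1)] mem_col[OF x] by blast
    then show "Ord v \<and> sub v (collapse D R x)" using IH z by (simp add: sub_def)
  qed
qed

lemma mem_Repl_col: "v \<epsilon> Repl D (collapse D R) \<longleftrightarrow> (\<exists>z. z \<epsilon> D \<and> v = collapse D R z)"
  by (rule mem_Repl) (intro definability)

lemma Ord_Repl_col: "Ord (Repl D (collapse D R))"
proof (rule Ord_of_trans)
  fix v assume "v \<epsilon> Repl D (collapse D R)"
  then obtain z where z: "z \<epsilon> D" "v = collapse D R z" unfolding mem_Repl_col by blast
  have "w \<epsilon> Repl D (collapse D R)" if "w \<epsilon> v" for w
    using that z unfolding z(2) mem_col[OF z(1)] mem_Repl_col by blast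
  then show "Ord v \<and> sub v (Repl D (collapse D R))" using z Ord_col by (simp add: sub_def)
qed

end

section \<open>Order types and finite sets\<close>

context ZF begin

definition ordinals :: "'a \<Rightarrow> bool" where "ordinals B \<longleftrightarrow> (\<forall>x. x \<epsilon> B \<longrightarrow> Ord x)"
definition rank_in :: "'a \<Rightarrow> 'a \<Rightarrow> 'a" where "rank_in B = collapse B (\<lambda>x y. x \<epsilon> y)"
definition order_type :: "'a \<Rightarrow> 'a" where "order_type B = Repl B (rank_in B)"

lemma definable_term_rank_in [definability]: "definable_term t \<Longrightarrow> definable_term u \<Longrightarrow> definable_term (\<lambda>e. rank_in (t e) (u e))"
  by (rule definable_term_subst2) (unfold rank_in_def collapse_def, intro definability)

lemma definable_term_order_type [definability]: "definable_term t \<Longrightarrow> definable_term (\<lambda>e. order_type (t e))"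
  by (rule definable_term_subst1) (unfold order_type_def, intro definability)

lemma ords_sub: "Ord a \<Longrightarrow> sub B a \<Longrightarrow> ordinals B"
  unfolding ordinals_def using subD Ord_mem by blast

lemma well_ordered_ords:
  assumes "ordinals B" shows "well_ordered mem B (\<lambda>x y. x \<epsilon> y)"
proof
  show "definable (\<lambda>e. e 0 \<epsilon> e 1)" by (intro definability)
  show "x \<epsilon> z" if "x \<epsilon> B" "y \<epsilon> B" "z \<epsilon> B" "x \<epsilon> y" "y \<epsilon> z" for x y z
    using assms that Ord_trans unfolding ordinals_def by blast
  show "x \<epsilon> y \<or> x = y \<or> y \<epsilon> x" if "x \<epsilon> B" "y \<epsilon> B" for x y
    using assms that Ord_linear unfolding ordinals_def by blast
  show "\<exists>x. x \<epsilon> S \<and> (\<forall>y. y \<epsilon> S \<longrightarrow> \<not> y \<epsilon> x)" if "sub S B" "z \<epsilon> S" for S z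
    using foundation_min[of "\<lambda>_. True" z S, OF definable_const that(2)] by blast
qed

lemma mem_otp: "v \<epsilon> order_type B \<longleftrightarrow> (\<exists>z. z \<epsilon> B \<and> v = rank_in B z)"
  unfolding order_type_def by (rule mem_Repl) (intro definability)

context
  fixes B assumes B: "ordinals B"
begin

interpretation w: well_ordered mem B "\<lambda>x y. x \<epsilon> y" by (rule well_ordered_ords[OF B])

lemma mem_rk: "y \<epsilon> B \<Longrightarrow> v \<epsilon> rank_in B y \<longleftrightarrow> (\<exists>z. z \<epsilon> B \<and> z \<epsilon> y \<and> v = rank_in B z)"
  unfolding rank_in_def by (rule w.mem_col)

lemma rk_inj: "x \<epsilon> B \<Longrightarrow> y \<epsilon> B \<Longrightarrow> rank_in B x = rank_in B y \<Longrightarrow> x = y"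
  unfolding rank_in_def by (rule w.col_inj)

lemma rk_less: "x \<epsilon> B \<Longrightarrow> y \<epsilon> B \<Longrightarrow> rank_in B x \<epsilon> rank_in B y \<longleftrightarrow> x \<epsilon> y"
  unfolding rank_in_def by (rule w.col_less)

lemma Ord_rk: "y \<epsilon> B \<Longrightarrow> Ord (rank_in B y)"
  unfolding rank_in_def by (rule w.Ord_col)

lemma Ord_otp: "Ord (order_type B)"
  unfolding order_type_def rank_in_def by (rule w.Ord_Repl_col)

lemma rk_sub: "y \<epsilon> B \<Longrightarrow> sub (rank_in B y) y"
proof (erule w.wo_induct[rotated])
  show "definable (\<lambda>e. sub (rank_in B (e 0)) (e 0))" by (intro definability)
  fix x assume x: "x \<epsilon> B" and IH: "\<And>y. y \<epsilon> B \<Longrightarrow> y \<epsilon> x \<Longrightarrow> sub (rank_in B y) y"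
  have Ox: "Ord x" using B x unfolding ordinals_def by blast
  show "sub (rank_in B x) x"
    unfolding sub_def
  proof (intro allI impI)
    fix v assume "v \<epsilon> rank_in B x"
    then obtain z where z: "z \<epsilon> B" "z \<epsilon> x" "v = rank_in B z" using mem_rk[OF x] by blast
    show "v \<epsilon> x" using mem_sub[OF Ox Ord_rk[OF z(1)] IH[OF z(1,2)] z(2)] z(3) by simp
  qed
qed

lemma otp_sub:
  assumes "sub B a" "Ord a" shows "sub (order_type B) a"
  unfolding sub_def
proof (intro allI impI)
  fix v assume "v \<epsilon> order_type B"
  then obtain z where z: "z \<epsilon> B" "v = rank_in B z" unfolding mem_otp by blast
  then have "z \<epsilon> a" using assms subD by blast
  then show "v \<epsilon> a" using mem_sub[OF assms(2) Ord_rk[OF z(1)] rk_sub[OF z(1)]] z(2) by simp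
qed

lemma onto_otp: "onto B (order_type B)"
  by (rule ontoI[of "rank_in B"]) (intro definability, auto simp: mem_otp)

lemma rk_inv: "y \<epsilon> B \<Longrightarrow> uniq (\<lambda>x. x \<epsilon> B \<and> rank_in B x = rank_in B y) = y"
  by (rule uniq_eq) (use rk_inj in auto)

end

lemma rk_mono:
  assumes "ordinals C" "sub B C" "x \<epsilon> B" shows "sub (rank_in B x) (rank_in C x)"
proof -
  have B: "ordinals B" using assms(1,2) unfolding ordinals_def sub_def by blast
  interpret w: well_ordered mem B "\<lambda>x y. x \<epsilon> y" by (rule well_ordered_ords[OF B])
  show ?thesis
  proof (rule w.wo_induct[OF _ assms(3), of "\<lambda>x. sub (rank_in B x) (rank_in C x)"])
    show "definable (\<lambda>e. sub (rank_in B (e 0)) (rank_in C (e 0)))" by (intro definability)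
    fix x assume x: "x \<epsilon> B" and IH: "\<And>y. y \<epsilon> B \<Longrightarrow> y \<epsilon> x \<Longrightarrow> sub (rank_in B y) (rank_in C y)"
    have C: "y \<epsilon> C" if "y \<epsilon> B" for y using assms(2) that subD by blast
    show "sub (rank_in B x) (rank_in C x)"
      unfolding sub_def
    proof (intro allI impI)
      fix v assume "v \<epsilon> rank_in B x"
      then obtain z where z: "z \<epsilon> B" "z \<epsilon> x" "v = rank_in B z" using mem_rk[OF B x] by blast
      have "rank_in C z \<epsilon> rank_in C x" using rk_less[OF assms(1) C[OF z(1)] C[OF x]] z(2) by blast
      then show "v \<epsilon> rank_in C x"
        using mem_sub[OF Ord_rk[OF assms(1) C[OF x]] Ord_rk[OF B z(1)] IH[OF z(1,2)]] z(3) by simp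
    qed
  qed
qed

lemma otp_mono:
  assumes "ordinals C" "sub B C" shows "sub (order_type B) (order_type C)"
  unfolding sub_def
proof (intro allI impI)
  have B: "ordinals B" using assms unfolding ordinals_def sub_def by blast
  fix v assume "v \<epsilon> order_type B"
  then obtain z where z: "z \<epsilon> B" "v = rank_in B z" unfolding mem_otp by blast
  have zC: "z \<epsilon> C" using assms(2) z subD by blast
  then have "rank_in C z \<epsilon> order_type C" unfolding mem_otp by blast
  then show "v \<epsilon> order_type C"
    using mem_sub[OF Ord_otp[OF assms(1)] Ord_rk[OF B z(1)] rk_mono[OF assms z(1)]] z(2) by simp
qed

text \<open>Ordinals are coded by prewellorders, that is, by surjections up to the induced \<open>\<le>\<close>, since
  without choice a surjection from \<open>D\<close> need not have a section.\<close>

definition otyp :: "'a \<Rightarrow> 'a \<Rightarrow> 'a \<Rightarrow> bool" where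
  "otyp D r a \<longleftrightarrow> Ord a \<and> (\<exists>u. (\<forall>x. x \<epsilon> D \<longrightarrow> app u x \<epsilon> a) \<and> (\<forall>b. b \<epsilon> a \<longrightarrow> (\<exists>x. x \<epsilon> D \<and> app u x = b)) \<and>
     (\<forall>x y. x \<epsilon> D \<longrightarrow> y \<epsilon> D \<longrightarrow> (sub (app u x) (app u y) \<longleftrightarrow> pair x y \<epsilon> r)))"

lemma definable_otyp [definability]: "definable_term t \<Longrightarrow> definable_term u \<Longrightarrow> definable_term v \<Longrightarrow> definable (\<lambda>e. otyp (t e) (u e) (v e))"
  by (rule definable_subst3) (unfold otyp_def, intro definability)

lemma otypI:
  assumes "Ord a" "definable_term (\<lambda>e. F (e 0))" "\<And>x. x \<epsilon> D \<Longrightarrow> F x \<epsilon> a" "\<And>b. b \<epsilon> a \<Longrightarrow> \<exists>x. x \<epsilon> D \<and> F x = b"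
    "\<And>x y. x \<epsilon> D \<Longrightarrow> y \<epsilon> D \<Longrightarrow> sub (F x) (F y) \<longleftrightarrow> pair x y \<epsilon> r"
  shows "otyp D r a"
proof -
  have l: "app (Lam D F) x = F x" if "x \<epsilon> D" for x by (rule app_Lam[OF assms(2) that])
  show ?thesis
    unfolding otyp_def
  proof (rule conjI[OF assms(1)], rule exI[of _ "Lam D F"], intro conjI allI impI)
    show "app (Lam D F) x \<epsilon> a" if "x \<epsilon> D" for x using that l assms(3) by simp
    show "\<exists>x. x \<epsilon> D \<and> app (Lam D F) x = b" if "b \<epsilon> a" for b using assms(4)[OF that] l by auto
    show "sub (app (Lam D F) x) (app (Lam D F) y) \<longleftrightarrow> pair x y \<epsilon> r" if "x \<epsilon> D" "y \<epsilon> D" for x y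
      using assms(5) that l by simp
  qed
qed

text \<open>Both surjections induce the same strict order. At the least value where they disagree
  they have the same smaller values, hence they agree there after all.\<close>

lemma otyp_unique:
  assumes "otyp D r a" "otyp D r a'" shows "a = a'"
proof -
  obtain u where u: "Ord a" "\<And>x. x \<epsilon> D \<Longrightarrow> app u x \<epsilon> a" "\<And>b. b \<epsilon> a \<Longrightarrow> \<exists>x. x \<epsilon> D \<and> app u x = b"
    "\<And>x y. x \<epsilon> D \<Longrightarrow> y \<epsilon> D \<Longrightarrow> sub (app u x) (app u y) \<longleftrightarrow> pair x y \<epsilon> r"
    using assms(1) unfolding otyp_def by blast
  obtain v where v: "Ord a'" "\<And>x. x \<epsilon> D \<Longrightarrow> app v x \<epsilon> a'" "\<And>b. b \<epsilon> a' \<Longrightarrow> \<exists>x. x \<epsilon> D \<and> app v x = b"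
    "\<And>x y. x \<epsilon> D \<Longrightarrow> y \<epsilon> D \<Longrightarrow> sub (app v x) (app v y) \<longleftrightarrow> pair x y \<epsilon> r"
    using assms(2) unfolding otyp_def by blast
  have less: "app u x \<epsilon> app u y \<longleftrightarrow> app v x \<epsilon> app v y" if "x \<epsilon> D" "y \<epsilon> D" for x y
    using not_sub[of "app u y" "app u x"] not_sub[of "app v y" "app v x"] u(4)[OF that(2,1)] v(4)[OF that(2,1)]
      Ord_mem[OF u(1) u(2)] Ord_mem[OF v(1) v(2)] that by simp
  have eq: "app u x = app v x" if x: "x \<epsilon> D" for x
  proof (rule ccontr)
    assume n: "app u x \<noteq> app v x"
    have d: "definable (\<lambda>e. \<exists>x. x \<epsilon> D \<and> app u x = e 0 \<and> app u x \<noteq> app v x)" by (intro definability)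
    obtain c where c: "\<exists>x. x \<epsilon> D \<and> app u x = c \<and> app u x \<noteq> app v x"
      "\<And>b. b \<epsilon> c \<Longrightarrow> \<not> (\<exists>x. x \<epsilon> D \<and> app u x = b \<and> app u x \<noteq> app v x)"
      using Ord_least[OF d, of "app u x"] Ord_mem[OF u(1) u(2)[OF x]] n x by metis
    then obtain y where y: "y \<epsilon> D" "app u y = c" "app u y \<noteq> app v y" by blast
    have "app u y = app v y"
    proof (rule ext)
      fix b
      show "b \<epsilon> app u y \<longleftrightarrow> b \<epsilon> app v y"
      proof
        assume b: "b \<epsilon> app u y"
        then have "b \<epsilon> a" using Ord_trans[OF u(1) _ u(2)[OF y(1)]] by blast
        then obtain z where z: "z \<epsilon> D" "app u z = b" using u(3) by blast
        then have "app v z = b" using c(2)[of b] b y by auto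
        then show "b \<epsilon> app v y" using less[OF z(1) y(1)] b z by simp
      next
        assume b: "b \<epsilon> app v y"
        then have "b \<epsilon> a'" using Ord_trans[OF v(1) _ v(2)[OF y(1)]] by blast
        then obtain z where z: "z \<epsilon> D" "app v z = b" using v(3) by blast
        then have uz: "app u z \<epsilon> app u y" using less[OF z(1) y(1)] b by simp
        then have "app u z = app v z" using c(2)[of "app u z"] y z by auto
        then show "b \<epsilon> app u y" using uz z by simp
      qed
    qed
    then show False using y by blast
  qed
  show ?thesis
    by (rule ext) (use u(2,3) v(2,3) eq in metis)
qed

lemma uniq_otyp: "otyp D r a \<Longrightarrow> uniq (otyp D r) = a"
  by (rule uniq_eq) (use otyp_unique in blast)+

text \<open>Every ordinal onto which \<open>M\<close> maps is decoded by \<open>c\<close> from a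
  relation on \<open>M\<close>, that is, from a member of one power set. Replacement collects these
  ordinals, and Burali-Forti provides another one.\<close>

lemma hartogs: "\<exists>a. Ord a \<and> \<not> onto M a"
proof (rule ccontr)
  assume n: "\<not> ?thesis"
  \<comment> \<open>The domain is read off the diagonal of \<open>r\<close>, since a surjection may
    take values outside the ordinal on part of \<open>M\<close>.\<close>
  define c where "c r = uniq (otyp (Sep M (\<lambda>x. pair x x \<epsilon> r)) r)" for r
  have dc: "definable_term (\<lambda>e. c (e 0))" unfolding c_def by (intro definability)
  obtain a where a: "Ord a" "\<not> a \<epsilon> Repl (pow (prd M M)) c" using no_set_of_ordinals by blast
  then obtain h where h: "\<And>b. b \<epsilon> a \<Longrightarrow> \<exists>x. x \<epsilon> M \<and> app h x = b" using n unfolding onto_def by blast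
  define P where "P p \<longleftrightarrow> (\<exists>x y. p = pair x y \<and> app h x \<epsilon> a \<and> app h y \<epsilon> a \<and> sub (app h x) (app h y))" for p
  have dP: "definable (\<lambda>e. P (e 0))" unfolding P_def by (intro definability)
  define r where "r = Sep (prd M M) P"
  have r: "pair x y \<epsilon> r \<longleftrightarrow> x \<epsilon> M \<and> y \<epsilon> M \<and> app h x \<epsilon> a \<and> app h y \<epsilon> a \<and> sub (app h x) (app h y)" for x y
    unfolding r_def mem_Sep[OF dP] by (auto simp: P_def)
  have dD: "definable (\<lambda>e. pair (e 0) (e 0) \<epsilon> r)" by (intro definability)
  define D where "D = Sep M (\<lambda>x. pair x x \<epsilon> r)"
  have D: "x \<epsilon> D \<longleftrightarrow> x \<epsilon> M \<and> app h x \<epsilon> a" for x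
    unfolding D_def using mem_Sep[OF dD, of x M] r[of x x] sub_refl by blast
  have "otyp D r a"
  proof (rule otypI[OF a(1)])
    show "definable_term (\<lambda>e. app h (e 0))" by (intro definability)
    show "\<exists>x. x \<epsilon> D \<and> app h x = b" if "b \<epsilon> a" for b using h[OF that] that D by auto
  qed (simp_all add: D r)
  then have "c r = a" unfolding c_def D_def by (rule uniq_otyp)
  moreover have "r \<epsilon> pow (prd M M)" unfolding mem_pow sub_def r_def mem_Sep[OF dP] by blast
  ultimately show False using a(2) unfolding mem_Repl[OF dc] by blast
qed

text \<open>Injections into a natural number pass to subsets at once; the bijection of the primitive
  notion is recovered in \<open>finite_set_of_fin\<close>.\<close>

definition fin :: "'a \<Rightarrow> bool" where "fin A \<longleftrightarrow> (\<exists>n. n \<epsilon> omega \<and> embeds A n)"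

lemma definable_fin [definability]: "definable_term t \<Longrightarrow> definable (\<lambda>e. fin (t e))"
  by (rule definable_subst1) (unfold fin_def, intro definability)

lemma fin_emb: "embeds A B \<Longrightarrow> fin B \<Longrightarrow> fin A"
  unfolding fin_def using emb_trans by blast

lemma fin_sub: "sub A B \<Longrightarrow> fin B \<Longrightarrow> fin A"
  using fin_emb sub_emb by blast

lemma fin_nat: "n \<epsilon> omega \<Longrightarrow> fin n"
  unfolding fin_def using sub_emb sub_refl by blast

lemma fin_insert:
  assumes "fin A" shows "fin (cup A (upr b b))"
proof -
  obtain n h where n: "n \<epsilon> omega" and h: "\<And>x. x \<epsilon> A \<Longrightarrow> app h x \<epsilon> n"
      "\<And>x y. x \<epsilon> A \<Longrightarrow> y \<epsilon> A \<Longrightarrow> app h x = app h y \<Longrightarrow> x = y"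
    using assms unfolding fin_def embeds_def by blast
  have "embeds (cup A (upr b b)) (suc n)"
  proof (rule embI)
    show "definable_term (\<lambda>e. if e 0 \<epsilon> A then app h (e 0) else n)" by (intro definability)
    show "(if x \<epsilon> A then app h x else n) \<epsilon> suc n" if "x \<epsilon> cup A (upr b b)" for x
      using h by simp
    show "x = y" if "x \<epsilon> cup A (upr b b)" "y \<epsilon> cup A (upr b b)"
      "(if x \<epsilon> A then app h x else n) = (if y \<epsilon> A then app h y else n)" for x y
      using that h(1)[of x] h(1)[of y] h(2)[of x y] by (auto split: if_splits)
  qed
  then show ?thesis using suc_omega[OF n] unfolding fin_def by blast
qed

lemma fin_cup:
  assumes "fin A" "fin B" shows "fin (cup A B)"
proof -
  obtain n where n: "n \<epsilon> omega" "embeds B n" using assms unfolding fin_def by blast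
  have "\<forall>B. embeds B n \<longrightarrow> fin (cup A B)"
  proof (rule omega_induct[OF _ n(1), of "\<lambda>n. \<forall>B. embeds B n \<longrightarrow> fin (cup A B)"])
    show "definable (\<lambda>e. \<forall>B. embeds B (e 0) \<longrightarrow> fin (cup A B))" by (intro definability)
    have "sub (cup A B) A" if "embeds B emp" for B using that unfolding embeds_def sub_def by auto
    then show "\<forall>B. embeds B emp \<longrightarrow> fin (cup A B)" using fin_sub assms(1) by blast
    fix n assume IH: "\<forall>B. embeds B n \<longrightarrow> fin (cup A B)"
    show "\<forall>B. embeds B (suc n) \<longrightarrow> fin (cup A B)"
    proof (intro allI impI)
      fix B assume "embeds B (suc n)"
      then obtain h where h: "\<And>x. x \<epsilon> B \<Longrightarrow> app h x \<epsilon> suc n"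
        "\<And>x y. x \<epsilon> B \<Longrightarrow> y \<epsilon> B \<Longrightarrow> app h x = app h y \<Longrightarrow> x = y" unfolding embeds_def by blast
      have d: "definable (\<lambda>e. app h (e 0) \<noteq> n)" by (intro definability)
      define B' where "B' = Sep B (\<lambda>x. app h x \<noteq> n)"
      have B': "x \<epsilon> B' \<longleftrightarrow> x \<epsilon> B \<and> app h x \<noteq> n" for x unfolding B'_def by (rule mem_Sep[OF d])
      have "embeds B' n"
        by (rule embI[of "app h"]) (intro definability, use h in \<open>auto simp: B'\<close>)
      then have f: "fin (cup A B')" using IH by blast
      show "fin (cup A B)"
      proof (cases "\<exists>b. b \<epsilon> B \<and> app h b = n")
        case True
        then obtain b where b: "b \<epsilon> B" "app h b = n" by blast
        have "sub (cup A B) (cup (cup A B') (upr b b))"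
          unfolding sub_def using h(2) b by (auto simp: B')
        then show ?thesis using fin_sub fin_insert[OF f] by blast
      next
        case False
        then have "sub (cup A B) (cup A B')" by (auto simp: sub_def B')
        then show ?thesis using fin_sub f by blast
      qed
    qed
  qed
  then show ?thesis using n by blast
qed

lemma fin_Uni:
  assumes "definable_term (\<lambda>e. F (e 0))" "n \<epsilon> omega" "\<And>i. i \<epsilon> n \<Longrightarrow> fin (F i)" shows "fin (Uni n F)"
proof -
  note [definability] = definable_term_subst1[of F, OF assms(1)]
  note m = mem_Uni[OF assms(1)]
  have "(\<forall>i. i \<epsilon> n \<longrightarrow> fin (F i)) \<longrightarrow> fin (Uni n F)"
  proof (rule omega_induct[OF _ assms(2), of "\<lambda>n. (\<forall>i. i \<epsilon> n \<longrightarrow> fin (F i)) \<longrightarrow> fin (Uni n F)"])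
    show "definable (\<lambda>e. (\<forall>i. i \<epsilon> e 0 \<longrightarrow> fin (F i)) \<longrightarrow> fin (Uni (e 0) F))" by (intro definability)
    have "sub (Uni emp F) emp" by (simp add: sub_def m)
    then show "(\<forall>i. i \<epsilon> emp \<longrightarrow> fin (F i)) \<longrightarrow> fin (Uni emp F)"
      using fin_sub fin_nat emp_omega by blast
    fix n assume IH: "(\<forall>i. i \<epsilon> n \<longrightarrow> fin (F i)) \<longrightarrow> fin (Uni n F)"
    show "(\<forall>i. i \<epsilon> suc n \<longrightarrow> fin (F i)) \<longrightarrow> fin (Uni (suc n) F)"
    proof
      assume f: "\<forall>i. i \<epsilon> suc n \<longrightarrow> fin (F i)"
      then have f': "fin (cup (Uni n F) (F n))" using IH by (intro fin_cup) auto
      have "sub (Uni (suc n) F) (cup (Uni n F) (F n))" by (auto simp: sub_def m)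
      then show "fin (Uni (suc n) F)" using f' fin_sub by blast
    qed
  qed
  then show ?thesis using assms(3) by blast
qed

lemma not_fin_omega: "\<not> fin omega"
proof
  assume "fin omega"
  then obtain n where n: "n \<epsilon> omega" "embeds omega n" unfolding fin_def by blast
  have "\<not> embeds omega n"
  proof (rule omega_induct[OF _ n(1), of "\<lambda>n. \<not> embeds omega n"])
    show "definable (\<lambda>e. \<not> embeds omega (e 0))" by (intro definability)
    show "\<not> embeds omega emp"
    proof
      assume "embeds omega emp"
      then obtain h where "\<And>x. x \<epsilon> omega \<Longrightarrow> app h x \<epsilon> emp" unfolding embeds_def by blast
      then show False using emp_omega mem_emp by blast
    qed
    fix n assume IH: "\<not> embeds omega n"
    show "\<not> embeds omega (suc n)"
    proof
      assume "embeds omega (suc n)"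
      then obtain h where h: "\<And>x. x \<epsilon> omega \<Longrightarrow> app h x \<epsilon> suc n"
        "\<And>x y. x \<epsilon> omega \<Longrightarrow> y \<epsilon> omega \<Longrightarrow> app h x = app h y \<Longrightarrow> x = y" unfolding embeds_def by blast
      have "embeds omega n"
      proof (rule embI)
        \<comment> \<open>Dropping the argument \<open>emp\<close> frees its value, which then
          replaces the forbidden value \<open>n\<close>.\<close>
        show "definable_term (\<lambda>e. if app h (suc (e 0)) = n then app h emp else app h (suc (e 0)))" by (intro definability)
        show "(if app h (suc x) = n then app h emp else app h (suc x)) \<epsilon> n" if "x \<epsilon> omega" for x
          using h(1)[of emp] h(1)[of "suc x"] h(2)[of "suc x" emp] that by auto
        show "x = y" if "x \<epsilon> omega" "y \<epsilon> omega"
          "(if app h (suc x) = n then app h emp else app h (suc x)) =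
           (if app h (suc y) = n then app h emp else app h (suc y))" for x y
        proof -
          have "app h (suc x) = app h (suc y) \<Longrightarrow> x = y"
            using h(2)[of "suc x" "suc y"] that(1,2) suc_inj by simp
          moreover have "app h (suc x) \<noteq> app h emp" "app h (suc y) \<noteq> app h emp"
            using h(2)[of "suc x" emp] h(2)[of "suc y" emp] that(1,2) by auto
          ultimately show ?thesis using that(3) by (metis (full_types))
        qed
      qed
      then show False using IH by blast
    qed
  qed
  then show False using n by blast
qed

end

section \<open>Products of ordinals and maps onto \<open>\<omega>\<close>\<close>

context ZF begin

definition pfst :: "'a \<Rightarrow> 'a" where "pfst p = uniq (\<lambda>a. \<exists>b. p = pair a b)"
definition psnd :: "'a \<Rightarrow> 'a" where "psnd p = uniq (\<lambda>b. \<exists>a. p = pair a b)"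

lemma definable_term_pfst [definability]: "definable_term t \<Longrightarrow> definable_term (\<lambda>e. pfst (t e))"
  by (rule definable_term_subst1) (unfold pfst_def, intro definability)

lemma definable_term_psnd [definability]: "definable_term t \<Longrightarrow> definable_term (\<lambda>e. psnd (t e))"
  by (rule definable_term_subst1) (unfold psnd_def, intro definability)

lemma pfst_pair [simp]: "pfst (pair a b) = a"
  unfolding pfst_def by (rule uniq_eq) auto

lemma psnd_pair [simp]: "psnd (pair a b) = b"
  unfolding psnd_def by (rule uniq_eq) auto

lemma emb_prd:
  assumes "embeds A B" "embeds C D" shows "embeds (prd A C) (prd B D)"
proof -
  obtain h where h: "\<And>x. x \<epsilon> A \<Longrightarrow> app h x \<epsilon> B"
      "\<And>x y. x \<epsilon> A \<Longrightarrow> y \<epsilon> A \<Longrightarrow> app h x = app h y \<Longrightarrow> x = y"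
    using assms(1) unfolding embeds_def by blast
  obtain k where k: "\<And>x. x \<epsilon> C \<Longrightarrow> app k x \<epsilon> D"
      "\<And>x y. x \<epsilon> C \<Longrightarrow> y \<epsilon> C \<Longrightarrow> app k x = app k y \<Longrightarrow> x = y"
    using assms(2) unfolding embeds_def by blast
  show ?thesis
  proof (rule embI)
    show "definable_term (\<lambda>e. pair (app h (pfst (e 0))) (app k (psnd (e 0))))" by (intro definability)
    show "pair (app h (pfst x)) (app k (psnd x)) \<epsilon> prd B D" if "x \<epsilon> prd A C" for x
      using that h(1) k(1) by (auto simp: mem_prd)
    show "x = y" if "x \<epsilon> prd A C" "y \<epsilon> prd A C"
      "pair (app h (pfst x)) (app k (psnd x)) = pair (app h (pfst y)) (app k (psnd y))" for x y
      using that h(2) k(2) by (auto simp: mem_prd)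
  qed
qed

section \<open>Goedel's pairing order and squares of infinite ordinals\<close>

lemma Ord_cup: "Ord a \<Longrightarrow> Ord b \<Longrightarrow> Ord (cup a b)"
  by (rule Ord_of_trans) (auto dest: Ord_mem Ord_sub simp: sub_def intro: Ord_trans)

lemma cup_mem: "Ord c \<Longrightarrow> a \<epsilon> c \<Longrightarrow> b \<epsilon> c \<Longrightarrow> cup a b \<epsilon> c"
proof -
  assume c: "Ord c" "a \<epsilon> c" "b \<epsilon> c"
  have *: "sub x y \<Longrightarrow> cup x y = y" "sub x y \<Longrightarrow> cup y x = y" for x y
    by (rule ext, auto simp: sub_def)+
  show "cup a b \<epsilon> c" using sub_linear[OF Ord_mem[OF c(1,2)] Ord_mem[OF c(1,3)]] * c by auto
qed

lemma sub_cup: "sub a (cup a b)" "sub b (cup a b)"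
  by (simp_all add: sub_def)

text \<open>Serves \<open>hessenberg\<close> at \<open>m = omega\<close>, where all smaller ordinals
  are finite and the induction hypothesis is void.\<close>

lemma fin_prd:
  assumes "n \<epsilon> omega" shows "fin (prd n n)"
proof -
  have d: "definable_term (\<lambda>e. Repl n (pair (e 0)))" by (intro definability)
  have m: "y \<epsilon> Repl n (pair a) \<longleftrightarrow> (\<exists>x. x \<epsilon> n \<and> y = pair a x)" for a y
    by (rule mem_Repl) (intro definability)
  have "embeds (Repl n (pair a)) n" for a
    by (rule embI[of psnd]) (intro definability, auto simp: m)
  then have "fin (Uni n (\<lambda>a. Repl n (pair a)))"
    using assms by (intro fin_Uni[OF d]) (auto simp: fin_def)
  moreover have "sub (prd n n) (Uni n (\<lambda>a. Repl n (pair a)))"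
    unfolding sub_def mem_Uni[OF d] m mem_prd by blast
  ultimately show ?thesis using fin_sub by blast
qed

text \<open>Pairs of ordinals are compared by maximum, then lexicographically; the maximum of two
  ordinals is their union.\<close>

definition goedel :: "'a \<Rightarrow> 'a \<Rightarrow> bool" where
  "goedel p q \<longleftrightarrow> cup (pfst p) (psnd p) \<epsilon> cup (pfst q) (psnd q) \<or>
     cup (pfst p) (psnd p) = cup (pfst q) (psnd q) \<and>
       (pfst p \<epsilon> pfst q \<or> pfst p = pfst q \<and> psnd p \<epsilon> psnd q)"

lemma well_ordered_goedel:
  assumes m: "Ord m" shows "well_ordered mem (prd m m) goedel"
proof
  show d: "definable (\<lambda>e. goedel (e 0) (e 1))" unfolding goedel_def by (intro definability)
  have O: "Ord (pfst p)" "Ord (psnd p)" "Ord (cup (pfst p) (psnd p))" if "p \<epsilon> prd m m" for p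
    using that m Ord_mem Ord_cup by (auto simp: mem_prd)
  show "goedel x z" if "x \<epsilon> prd m m" "y \<epsilon> prd m m" "z \<epsilon> prd m m" "goedel x y" "goedel y z" for x y z
    using that(4,5) Ord_trans[OF O(1)[OF that(3)], of "pfst x" "pfst y"]
      Ord_trans[OF O(2)[OF that(3)], of "psnd x" "psnd y"]
      Ord_trans[OF O(3)[OF that(3)], of "cup (pfst x) (psnd x)" "cup (pfst y) (psnd y)"]
    unfolding goedel_def by metis
  show "goedel x y \<or> x = y \<or> goedel y x" if "x \<epsilon> prd m m" "y \<epsilon> prd m m" for x y
  proof -
    have "pfst x = pfst y \<Longrightarrow> psnd x = psnd y \<Longrightarrow> x = y" using that by (auto simp: mem_prd)
    then show ?thesis
      using Ord_linear[OF O(1)[OF that(1)] O(1)[OF that(2)]]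
        Ord_linear[OF O(2)[OF that(1)] O(2)[OF that(2)]]
        Ord_linear[OF O(3)[OF that(1)] O(3)[OF that(2)]]
      unfolding goedel_def by metis
  qed
  show "\<exists>x. x \<epsilon> S \<and> (\<forall>y. y \<epsilon> S \<longrightarrow> \<not> goedel y x)" if S: "sub S (prd m m)" and z: "z \<epsilon> S" for S z
  proof -
    \<comment> \<open>A minimal pair is reached by minimising the maximum, then the first, then the
      second coordinate, each over the pairs that survive.\<close>
    have d1: "definable (\<lambda>e. \<exists>p. p \<epsilon> S \<and> cup (pfst p) (psnd p) = e 0)" by (intro definability)
    obtain p a where p: "p \<epsilon> S" "cup (pfst p) (psnd p) = a"
      and a: "\<And>q. q \<epsilon> S \<Longrightarrow> \<not> cup (pfst q) (psnd q) \<epsilon> a"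
      using Ord_least[OF d1, of "cup (pfst z) (psnd z)"] O(3)[OF subD[OF S z]] z by metis
    have d2: "definable (\<lambda>e. \<exists>p. p \<epsilon> S \<and> cup (pfst p) (psnd p) = a \<and> pfst p = e 0)" by (intro definability)
    obtain q b where q: "q \<epsilon> S" "cup (pfst q) (psnd q) = a" "pfst q = b"
      and b: "\<And>q. q \<epsilon> S \<Longrightarrow> cup (pfst q) (psnd q) = a \<Longrightarrow> \<not> pfst q \<epsilon> b"
      using Ord_least[OF d2, of "pfst p"] O(1)[OF subD[OF S p(1)]] p by metis
    have d3: "definable (\<lambda>e. \<exists>p. p \<epsilon> S \<and> cup (pfst p) (psnd p) = a \<and> pfst p = b \<and> psnd p = e 0)" by (intro definability)
    obtain r c where r: "r \<epsilon> S" "cup (pfst r) (psnd r) = a" "pfst r = b" "psnd r = c"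
      and c: "\<And>q. q \<epsilon> S \<Longrightarrow> cup (pfst q) (psnd q) = a \<Longrightarrow> pfst q = b \<Longrightarrow> \<not> psnd q \<epsilon> c"
      using Ord_least[OF d3, of "psnd q"] O(2)[OF subD[OF S q(1)]] q by metis
    have "\<not> goedel y r" if "y \<epsilon> S" for y
      unfolding goedel_def using a b c r that by metis
    then show ?thesis using r(1) by blast
  qed
qed

text \<open>Induction on \<open>m\<close>. If \<open>m\<close> embeds into the square of a smaller
  infinite \<open>b\<close>, the square of \<open>m\<close> passes through \<open>b\<close> by the
  induction hypothesis. Otherwise the collapse of \<open>goedel\<close> embeds it: a value not below
  \<open>m\<close> would give an embedding of \<open>m\<close> into such a square or, for
  \<open>m = omega\<close>, into a finite one.\<close>

lemma hessenberg:
  assumes "Ord m" "sub omega m" shows "embeds (prd m m) m"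
proof -
  have "sub omega m \<longrightarrow> embeds (prd m m) m"
  proof (rule Ord_induct[OF _ assms(1), of "\<lambda>m. sub omega m \<longrightarrow> embeds (prd m m) m"], intro definability)
    fix m assume m: "Ord m" and IH: "\<And>b. b \<epsilon> m \<Longrightarrow> sub omega b \<longrightarrow> embeds (prd b b) b"
    show "sub omega m \<longrightarrow> embeds (prd m m) m"
    proof
      assume om: "sub omega m"
      interpret g: well_ordered mem "prd m m" goedel by (rule well_ordered_goedel[OF m])
      show "embeds (prd m m) m"
      proof (cases "\<exists>b. b \<epsilon> m \<and> sub omega b \<and> embeds m (prd b b)")
        case True
        then obtain b where b: "b \<epsilon> m" "sub omega b" "embeds m (prd b b)" by blast
        then have bb: "embeds (prd b b) b" using IH by blast
        show ?thesis
          using emb_prd[OF b(3) b(3)] emb_prd[OF bb bb] bb sub_emb[OF Ord_sub[OF m b(1)]] emb_trans by blast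
      next
        case False
        have "collapse (prd m m) goedel p \<epsilon> m" if p: "p \<epsilon> prd m m" for p
        proof (rule ccontr)
          assume "\<not> collapse (prd m m) goedel p \<epsilon> m"
          then have s: "sub m (collapse (prd m m) goedel p)"
            using not_sub[OF m g.Ord_col[OF p]] by blast
          \<comment> \<open>Every predecessor of \<open>p\<close> has both coordinates at most the
            maximum of \<open>p\<close>, so all of them lie in \<open>prd c c\<close>.\<close>
          define c where "c = suc (cup (pfst p) (psnd p))"
          have cm: "cup (pfst p) (psnd p) \<epsilon> m" using p m cup_mem by (auto simp: mem_prd)
          have Oc: "Ord c" unfolding c_def using Ord_suc[OF Ord_mem[OF m cm]] .
          have seg: "z \<epsilon> prd c c" if z: "z \<epsilon> prd m m" "goedel z p" for z
          proof -
            obtain a b where ab: "z = pair a b" "a \<epsilon> m" "b \<epsilon> m" using z(1) by (auto simp: mem_prd)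
            have O: "Ord a" "Ord b" using Ord_mem[OF m] ab by blast+
            have "cup a b \<epsilon> c" using z(2) unfolding goedel_def ab c_def by auto
            then have "a \<epsilon> c" "b \<epsilon> c"
              using mem_sub[OF Oc O(1) sub_cup(1)] mem_sub[OF Oc O(2) sub_cup(2)] by blast+
            then show ?thesis unfolding ab by simp
          qed
          have "embeds m (prd c c)"
          proof (rule embI)
            let ?F = "\<lambda>x. uniq (\<lambda>z. z \<epsilon> prd m m \<and> collapse (prd m m) goedel z = x)"
            show "definable_term (\<lambda>e. ?F (e 0))" by (intro definability g.definable_term_collapse)
            have F: "?F x \<epsilon> prd c c \<and> collapse (prd m m) goedel (?F x) = x" if x: "x \<epsilon> m" for x
            proof -
              obtain z where z: "z \<epsilon> prd m m" "goedel z p" "x = collapse (prd m m) goedel z"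
                using subD[OF s x] unfolding g.mem_col[OF p] by blast
              have "?F x = z"
                unfolding z(3) by (rule uniq_eq) (use z(1) g.col_inj in blast)+
              then show ?thesis using z seg by simp
            qed
            show "?F x \<epsilon> prd c c" if "x \<epsilon> m" for x using F[OF that] by blast
            show "x = y" if "x \<epsilon> m" "y \<epsilon> m" "?F x = ?F y" for x y
              using F[OF that(1)] F[OF that(2)] that(3) by metis
          qed
          \<comment> \<open>\<open>c\<close> may be finite, while the case assumption speaks of
            infinite ordinals only.\<close>
          have emc: "embeds m (prd (cup c omega) (cup c omega))"
            using \<open>embeds m (prd c c)\<close> emb_prd[OF sub_emb sub_emb] sub_cup emb_trans by blast
          show False
          proof (cases "c \<epsilon> m")
            case cm': True
            show ?thesis
            proof (cases "omega \<epsilon> m")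
              case True
              then have "cup c omega \<epsilon> m" using cm' m cup_mem by blast
              then show ?thesis using False emc sub_cup by blast
            next
              assume "\<not> omega \<epsilon> m"
              then have "m = omega" using om sub_iff[OF Ord_omega m] by blast
              then have "fin (prd c c)" "embeds omega (prd c c)"
                using cm' \<open>embeds m (prd c c)\<close> fin_prd by simp_all
              then show ?thesis using fin_emb not_fin_omega by blast
            qed
          next
            assume "\<not> c \<epsilon> m"
            \<comment> \<open>The remaining case is \<open>m = suc n\<close> with \<open>n\<close>
              infinite. The row of \<open>emp\<close> in \<open>prd n n\<close> takes
              \<open>n\<close>, and one point of the next row takes the extra element.\<close>
            define n where "n = cup (pfst p) (psnd p)"
            note cm = cm[folded n_def]
            have c: "c = suc n" unfolding c_def n_def ..
            have "sub c m" unfolding c using suc_sub[OF m cm] .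
            then have mc: "m = suc n" using sub_iff[OF Oc m] \<open>\<not> c \<epsilon> m\<close> c by blast
            have "omega \<noteq> suc n"
            proof
              assume o: "omega = suc n"
              then have "n \<epsilon> omega" by simp
              then have "suc n \<epsilon> omega" by (rule suc_omega)
              then have "suc n \<epsilon> suc n" unfolding o .
              then show False using mem_irrefl by blast
            qed
            then have on: "sub omega n"
              using om sub_iff[OF Ord_omega m] sub_iff[OF Ord_omega Ord_mem[OF m cm]] mc mem_suc[of omega n] by blast
            have e: "emp \<epsilon> n" "suc emp \<epsilon> n" by (rule subD[OF on], simp)+
            have "embeds m (prd n n)"
            proof (rule embI)
              show "definable_term (\<lambda>e. if e 0 = n then pair (suc emp) emp else pair emp (e 0))" by (intro definability)
              show "(if x = n then pair (suc emp) emp else pair emp x) \<epsilon> prd n n" if "x \<epsilon> m" for x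
              proof (cases "x = n")
                case False
                then have "x \<epsilon> n" using that unfolding mc mem_suc by blast
                then show ?thesis using False e by simp
              qed (use e in simp)
              show "x = y" if "(if x = n then pair (suc emp) emp else pair emp x)
                = (if y = n then pair (suc emp) emp else pair emp y)" for x y
                using that by (auto split: if_splits)
            qed
            then show False using False cm on by blast
          qed
        qed
        then show ?thesis
          by - (rule embI[OF g.definable_term_collapse[OF definable_term_var]], blast, rule g.col_inj)
      qed
    qed
  qed
  then show ?thesis using assms by blast
qed

text \<open>The induction builds a finite subset of \<open>M\<close> that holds a copy of
  \<open>n\<close>. The next point is only asserted to exist inside the induction, so no choice
  enters.\<close>

lemma infinite_onto_nat:
  assumes M: "\<not> fin M" and n: "n \<epsilon> omega" shows "onto M n"
proof -
  have "\<exists>Y. sub Y M \<and> fin Y \<and> embeds n Y"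
  proof (rule omega_induct[OF _ n, of "\<lambda>n. \<exists>Y. sub Y M \<and> fin Y \<and> embeds n Y"], intro definability)
    show "\<exists>Y. sub Y M \<and> fin Y \<and> embeds emp Y"
      using fin_nat[OF emp_omega] sub_emb[of emp emp] by (intro exI[of _ emp]) (simp add: sub_def)
    fix n assume "\<exists>Y. sub Y M \<and> fin Y \<and> embeds n Y"
    then obtain Y h where Y: "sub Y M" "fin Y" and h: "\<And>x. x \<epsilon> n \<Longrightarrow> app h x \<epsilon> Y"
      "\<And>x y. x \<epsilon> n \<Longrightarrow> y \<epsilon> n \<Longrightarrow> app h x = app h y \<Longrightarrow> x = y" unfolding embeds_def by blast
    obtain y where y: "y \<epsilon> M" "\<not> y \<epsilon> Y" using M Y(2) fin_sub unfolding sub_def by blast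
    have "embeds (suc n) (cup Y (upr y y))"
    proof (rule embI)
      show "definable_term (\<lambda>e. if e 0 \<epsilon> n then app h (e 0) else y)" by (intro definability)
      show "(if x \<epsilon> n then app h x else y) \<epsilon> cup Y (upr y y)" for x using h by simp
      show "x = z" if "x \<epsilon> suc n" "z \<epsilon> suc n"
        "(if x \<epsilon> n then app h x else y) = (if z \<epsilon> n then app h z else y)" for x z
        using that h(1)[of x] h(1)[of z] h(2)[of x z] y(2) by (auto split: if_splits)
    qed
    moreover have "sub (cup Y (upr y y)) M" using Y y by (auto simp: sub_def)
    ultimately show "\<exists>Y. sub Y M \<and> fin Y \<and> embeds (suc n) Y" using fin_insert[OF Y(2)] by blast
  qed
  then show ?thesis using emb_onto onto_mono sub_refl by blast
qed

text \<open>Without a bound the image would have order type \<open>omega\<close>, and composing with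
  ranks would map \<open>M\<close> onto \<open>omega\<close>. So the type is zero, or a successor
  whose last rank belongs to a greatest value.\<close>

lemma bounded_omega:
  assumes M: "\<not> onto M omega" and F: "definable_term (\<lambda>e. F (e 0))" and Q: "definable (\<lambda>e. Q (e 0))"
    and Fo: "\<And>x. x \<epsilon> M \<Longrightarrow> Q x \<Longrightarrow> F x \<epsilon> omega"
  shows "\<exists>N. N \<epsilon> omega \<and> (\<forall>x. x \<epsilon> M \<longrightarrow> Q x \<longrightarrow> F x \<epsilon> N)"
proof -
  define B where "B = Repl (Sep M Q) F"
  have B: "y \<epsilon> B \<longleftrightarrow> (\<exists>x. x \<epsilon> M \<and> Q x \<and> y = F x)" for y
    unfolding B_def mem_Repl[OF F] mem_Sep[OF Q] by blast
  have sB: "sub B omega" using Fo unfolding sub_def B by blast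
  have oB: "ordinals B" by (rule ords_sub[OF Ord_omega sB])
  have "onto M B" by (rule ontoI[OF F]) (auto simp: B)
  then have "order_type B \<noteq> omega" using M onto_trans onto_otp[OF oB] by metis
  then have "order_type B \<epsilon> omega"
    using otp_sub[OF oB sB Ord_omega] sub_iff[OF Ord_otp[OF oB] Ord_omega] by blast
  then show ?thesis
  proof (cases rule: omega_cases)
    case 1
    then have "\<not> y \<epsilon> B" for y using mem_otp[of "rank_in B y" B] by auto
    then show ?thesis unfolding B using emp_omega by blast
  next
    case (2 m)
    then obtain b where b: "b \<epsilon> B" "m = rank_in B b" using mem_otp[of m B] by auto
    have "y \<epsilon> suc b" if "y \<epsilon> B" for y
    proof -
      have "rank_in B y \<epsilon> suc m" using that 2(2) mem_otp[of "rank_in B y" B] by auto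
      then show ?thesis using rk_less[OF oB that b(1)] rk_inj[OF oB that b(1)] b(2) by auto
    qed
    then show ?thesis using suc_omega[OF subD[OF sB b(1)]] unfolding B by blast
  qed
qed

text \<open>If \<open>M\<close> did not map onto \<open>\<omega>\<close>, then for each \<open>x\<close> the finite values of \<open>n \<mapsto> f (n, x)\<close>
  would have a finite union, and the sizes of these unions would be bounded, hence so would the
  sizes of all finite subsets of \<open>M\<close>.\<close>

lemma onto_omega:
  assumes M: "\<not> fin M"
    and f: "\<And>n x. n \<epsilon> omega \<Longrightarrow> x \<epsilon> M \<Longrightarrow> sub (app f (pair n x)) M"
    and onto: "\<And>Y. sub Y M \<Longrightarrow> \<exists>n x. n \<epsilon> omega \<and> x \<epsilon> M \<and> app f (pair n x) = Y"
  shows "onto M omega"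
proof (rule ccontr)
  assume no: "\<not> onto M omega"
  define G where "G x n = (if fin (app f (pair n x)) then app f (pair n x) else emp)" for x n
  define U where "U x = Uni omega (G x)" for x
  have dG [definability]: "definable_term t \<Longrightarrow> definable_term u \<Longrightarrow> definable_term (\<lambda>e. G (t e) (u e))" for t u
    by (rule definable_term_subst2) (unfold G_def, intro definability)
  have dU [definability]: "definable_term t \<Longrightarrow> definable_term (\<lambda>e. U (t e))" for t
    by (rule definable_term_subst1) (unfold U_def, intro definability)
  have mU: "y \<epsilon> U x \<longleftrightarrow> (\<exists>n. n \<epsilon> omega \<and> y \<epsilon> G x n)" for x y
    unfolding U_def by (rule mem_Uni) (intro definability)
  have finG: "fin (G x n)" for x n unfolding G_def using fin_nat[OF emp_omega] by simp
  have UM: "sub (U x) M" if "x \<epsilon> M" for x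
    using f[OF _ that] unfolding sub_def mU G_def by auto
  have finU: "fin (U x)" if x: "x \<epsilon> M" for x
  proof -
    \<comment> \<open>The first index at which \<open>y\<close> occurs. It is bounded over
      \<open>U x\<close>, so finitely many finite sets exhaust \<open>U x\<close>.\<close>
    define F where "F y = least_ord (\<lambda>n. n \<epsilon> omega \<and> y \<epsilon> G x n)" for y
    have dl: "definable (\<lambda>e. e 0 \<epsilon> omega \<and> y \<epsilon> G x (e 0))" for y by (intro definability)
    have F: "F y \<epsilon> omega \<and> y \<epsilon> G x (F y)" if y: "y \<epsilon> U x" for y
    proof -
      obtain n where n: "n \<epsilon> omega \<and> y \<epsilon> G x n" using y unfolding mU by blast
      then have "Ord n" using Ord_mem[OF Ord_omega] by blast
      then show ?thesis unfolding F_def using least_ord(2)[OF dl _ n] by blast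
    qed
    have dF: "definable_term (\<lambda>e. F (e 0))" unfolding F_def by (intro definability)
    have dQ: "definable (\<lambda>e. e 0 \<epsilon> U x)" by (intro definability)
    obtain N where N: "N \<epsilon> omega" "\<forall>y. y \<epsilon> M \<longrightarrow> y \<epsilon> U x \<longrightarrow> F y \<epsilon> N"
      using bounded_omega[OF no dF dQ] F by blast
    have dGx: "definable_term (\<lambda>e. G x (e 0))" by (intro definability)
    have "sub (U x) (Uni N (G x))"
      unfolding sub_def mem_Uni[OF dGx] using N F subD[OF UM[OF x]] by blast
    then show ?thesis using fin_Uni[OF dGx N(1)] finG fin_sub by blast
  qed
  define v where "v x = least_ord (\<lambda>n. n \<epsilon> omega \<and> embeds (U x) n)" for x
  have dl: "definable (\<lambda>e. e 0 \<epsilon> omega \<and> embeds (U x) (e 0))" for x by (intro definability)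
  have v: "v x \<epsilon> omega \<and> embeds (U x) (v x)" if x: "x \<epsilon> M" for x
  proof -
    obtain n where n: "n \<epsilon> omega \<and> embeds (U x) n" using finU[OF x] unfolding fin_def by blast
    then have "Ord n" using Ord_mem[OF Ord_omega] by blast
    then show ?thesis unfolding v_def using least_ord(2)[OF dl _ n] by blast
  qed
  have dv: "definable_term (\<lambda>e. v (e 0))" unfolding v_def by (intro definability)
  obtain K where K: "K \<epsilon> omega" "\<forall>x. x \<epsilon> M \<longrightarrow> True \<longrightarrow> v x \<epsilon> K"
    using bounded_omega[OF no dv definable_const] v by blast
  have all: "embeds Y K" if Y: "sub Y M" "fin Y" for Y
  proof -
    obtain n x where nx: "n \<epsilon> omega" "x \<epsilon> M" "app f (pair n x) = Y" using onto[OF Y(1)] by blast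
    have "sub Y (U x)" unfolding sub_def mU G_def using nx Y by auto
    moreover have "sub (v x) K" using K nx Ord_sub[OF Ord_mem[OF Ord_omega K(1)]] by blast
    ultimately show ?thesis using v[OF nx(2)] sub_emb emb_trans by blast
  qed
  \<comment> \<open>Yet adding points one at a time gives finite subsets of \<open>M\<close> too
    large for any given natural number.\<close>
  have "\<not> (\<forall>Y. sub Y M \<longrightarrow> fin Y \<longrightarrow> embeds Y K)"
  proof (rule omega_induct[OF _ K(1), of "\<lambda>K. \<not> (\<forall>Y. sub Y M \<longrightarrow> fin Y \<longrightarrow> embeds Y K)"], intro definability)
    have ins: "\<exists>y. y \<epsilon> M \<and> \<not> y \<epsilon> Y \<and> sub (cup Y (upr y y)) M \<and> fin (cup Y (upr y y))"
      if Y: "sub Y M" "fin Y" for Y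
    proof -
      obtain y where y: "y \<epsilon> M" "\<not> y \<epsilon> Y" using M Y(2) fin_sub unfolding sub_def by blast
      moreover have "sub (cup Y (upr y y)) M" using Y y by (auto simp: sub_def)
      ultimately show ?thesis using fin_insert[OF Y(2)] by blast
    qed
    have "sub emp M" by (simp add: sub_def)
    then obtain y where y: "sub (cup emp (upr y y)) M" "fin (cup emp (upr y y))"
      using ins fin_nat[OF emp_omega] by blast
    have "y \<epsilon> cup emp (upr y y)" by simp
    then have "\<not> embeds (cup emp (upr y y)) emp" unfolding embeds_def using mem_emp by blast
    then show "\<not> (\<forall>Y. sub Y M \<longrightarrow> fin Y \<longrightarrow> embeds Y emp)" using y by blast
    fix n assume "\<not> (\<forall>Y. sub Y M \<longrightarrow> fin Y \<longrightarrow> embeds Y n)"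
    then obtain Y where Y: "sub Y M" "fin Y" "\<not> embeds Y n" by blast
    obtain y where y: "\<not> y \<epsilon> Y" "sub (cup Y (upr y y)) M" "fin (cup Y (upr y y))"
      using ins[OF Y(1,2)] by blast
    have "\<not> embeds (cup Y (upr y y)) (suc n)"
    proof
      assume "embeds (cup Y (upr y y)) (suc n)"
      then obtain h where h: "\<And>x. x \<epsilon> cup Y (upr y y) \<Longrightarrow> app h x \<epsilon> suc n"
        "\<And>x z. x \<epsilon> cup Y (upr y y) \<Longrightarrow> z \<epsilon> cup Y (upr y y) \<Longrightarrow> app h x = app h z \<Longrightarrow> x = z"
        unfolding embeds_def by blast
      have "embeds Y n"
      proof (rule embI)
        \<comment> \<open>The value of the added point \<open>y\<close> is to spare on
          \<open>Y\<close>, so it can stand in for \<open>n\<close>.\<close>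
        show "definable_term (\<lambda>e. if app h (e 0) = n then app h y else app h (e 0))" by (intro definability)
        have hy: "app h x \<noteq> app h y" if "x \<epsilon> Y" for x using h(2)[of x y] that y(1) by auto
        show "(if app h x = n then app h y else app h x) \<epsilon> n" if "x \<epsilon> Y" for x
          using h(1)[of x] h(1)[of y] hy[OF that] that by auto
        show "x = z" if "x \<epsilon> Y" "z \<epsilon> Y" "(if app h x = n then app h y else app h x) =
          (if app h z = n then app h y else app h z)" for x z
          using that hy[OF that(1)] hy[OF that(2)] h(2)[of x z] by (auto split: if_splits)
      qed
      then show False using Y by blast
    qed
    then show "\<not> (\<forall>Y. sub Y M \<longrightarrow> fin Y \<longrightarrow> embeds Y (suc n))" using y by blast
  qed
  then show False using all by blast
qed

end

section \<open>Coverings of an ordinal that is not an image\<close>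

text \<open>Each \<open>b\<close> below \<open>\<theta>\<close> comes with some surjection, but not
  with a family of them; only \<open>G\<close> is given uniformly.\<close>

locale unreachable_covering = ZF +
  fixes M \<theta> G :: 'a
  assumes Ord_theta: "Ord \<theta>"
    and not_onto: "\<not> onto M \<theta>"
    and below: "b \<epsilon> \<theta> \<Longrightarrow> onto M b"
    and omega_theta: "omega \<epsilon> \<theta>"
    and range: "n \<epsilon> omega \<Longrightarrow> x \<epsilon> M \<Longrightarrow> app G (pair n x) \<epsilon> \<theta>"
    and covering: "b \<epsilon> \<theta> \<Longrightarrow> \<exists>n x. n \<epsilon> omega \<and> x \<epsilon> M \<and> app G (pair n x) = b"
begin

definition val :: "'a \<Rightarrow> 'a \<Rightarrow> 'a" where "val n x = app G (pair n x)"
definition vals :: "'a \<Rightarrow> 'a \<Rightarrow> 'a" where "vals n A = Repl A (val n)"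
definition width :: "'a \<Rightarrow> 'a \<Rightarrow> 'a" where "width n A = order_type (vals n A)"
definition span :: "'a \<Rightarrow> 'a" where "span A = Uni omega (\<lambda>n. width n A)"
definition tame :: "'a \<Rightarrow> bool" where "tame A \<longleftrightarrow> span A \<epsilon> \<theta>"

lemma definable_term_val [definability]: "definable_term t \<Longrightarrow> definable_term u \<Longrightarrow> definable_term (\<lambda>e. val (t e) (u e))"
  by (rule definable_term_subst2) (unfold val_def, intro definability)

lemma definable_term_vals [definability]: "definable_term t \<Longrightarrow> definable_term u \<Longrightarrow> definable_term (\<lambda>e. vals (t e) (u e))"
  by (rule definable_term_subst2) (unfold vals_def, intro definability)

lemma definable_term_width [definability]: "definable_term t \<Longrightarrow> definable_term u \<Longrightarrow> definable_term (\<lambda>e. width (t e) (u e))"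
  by (rule definable_term_subst2) (unfold width_def, intro definability)

lemma definable_term_span [definability]: "definable_term t \<Longrightarrow> definable_term (\<lambda>e. span (t e))"
  by (rule definable_term_subst1) (unfold span_def, intro definability)

lemma definable_tame [definability]: "definable_term t \<Longrightarrow> definable (\<lambda>e. tame (t e))"
  by (rule definable_subst1) (unfold tame_def, intro definability)

lemma mem_vals: "y \<epsilon> vals n A \<longleftrightarrow> (\<exists>x. x \<epsilon> A \<and> y = val n x)"
  unfolding vals_def by (rule mem_Repl) (intro definability)

lemma val_vals: "x \<epsilon> A \<Longrightarrow> val n x \<epsilon> vals n A"
  using mem_vals by blast

lemma mem_width: "v \<epsilon> width n A \<longleftrightarrow> (\<exists>x. x \<epsilon> A \<and> v = rank_in (vals n A) (val n x))"
  unfolding width_def mem_otp mem_vals by blast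

lemma mem_span: "v \<epsilon> span A \<longleftrightarrow> (\<exists>n. n \<epsilon> omega \<and> v \<epsilon> width n A)"
  unfolding span_def by (rule mem_Uni) (intro definability)

lemma val_theta: "n \<epsilon> omega \<Longrightarrow> x \<epsilon> M \<Longrightarrow> val n x \<epsilon> \<theta>"
  unfolding val_def by (rule range)

lemma nat_theta: "n \<epsilon> omega \<Longrightarrow> n \<epsilon> \<theta>"
  by (rule Ord_trans[OF Ord_theta _ omega_theta])

context
  fixes A assumes A: "sub A M"
begin

lemma vals_sub: "n \<epsilon> omega \<Longrightarrow> sub (vals n A) \<theta>"
  using A val_theta unfolding sub_def mem_vals by blast

lemma ords_vals: "n \<epsilon> omega \<Longrightarrow> ordinals (vals n A)"
  by (rule ords_sub[OF Ord_theta vals_sub])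

lemma Ord_width: "n \<epsilon> omega \<Longrightarrow> Ord (width n A)"
  unfolding width_def by (rule Ord_otp[OF ords_vals])

text \<open>Ranking turns \<open>val n\<close> into a map of \<open>A\<close> onto this order type,
  so the type cannot be all of \<open>\<theta>\<close>.\<close>

lemma width_theta: assumes n: "n \<epsilon> omega" shows "width n A \<epsilon> \<theta>"
proof -
  have "onto A (vals n A)"
    by (rule ontoI[of "val n"]) (intro definability, auto simp: mem_vals)
  then have "onto A (width n A)"
    unfolding width_def by (rule onto_trans) (rule onto_otp[OF ords_vals[OF n]])
  then have "onto M (width n A)" using onto_mono[OF _ A sub_refl] by blast
  then have "width n A \<noteq> \<theta>" using not_onto by blast
  moreover have "sub (width n A) \<theta>"
    unfolding width_def by (rule otp_sub[OF ords_vals[OF n] vals_sub[OF n] Ord_theta])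
  ultimately show ?thesis using sub_iff[OF Ord_width[OF n] Ord_theta] by blast
qed

lemma Ord_span: "Ord (span A)"
  unfolding span_def by (rule Ord_Uni) (intro definability, rule Ord_width)

lemma span_sub: "sub (span A) \<theta>"
  unfolding sub_def mem_span using width_theta Ord_trans[OF Ord_theta] by blast

text \<open>Used in the form that a set which is not tame has widths beyond any given ordinal below
  \<open>\<theta>\<close>.\<close>

lemma not_tame: "\<not> tame A \<longleftrightarrow> span A = \<theta>"
  unfolding tame_def using sub_iff[OF Ord_span Ord_theta] span_sub mem_irrefl by metis

lemma tame_mono: assumes B: "sub B A" "tame A" shows "tame B"
proof -
  have "sub (width n B) (width n A)" if n: "n \<epsilon> omega" for n
    unfolding width_def using B(1) by (intro otp_mono[OF ords_vals[OF n]]) (auto simp: sub_def mem_vals)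
  then have s: "sub (span B) (span A)" unfolding sub_def mem_span by blast
  have BM: "sub B M" using B(1) A sub_trans by blast
  have "Ord (span B)"
    unfolding span_def
  proof (rule Ord_Uni)
    fix n assume n: "n \<epsilon> omega"
    have "sub (vals n B) \<theta>" using BM val_theta[OF n] unfolding sub_def mem_vals by blast
    then show "Ord (width n B)" unfolding width_def by (intro Ord_otp ords_sub[OF Ord_theta])
  qed (intro definability)
  then show ?thesis using mem_sub[OF Ord_theta _ s] B(2) unfolding tame_def by blast
qed

end

lemma tame_empty: "(\<And>x. \<not> x \<epsilon> A) \<Longrightarrow> tame A"
proof -
  assume "\<And>x. \<not> x \<epsilon> A"
  then have "span A = emp" unfolding emp_eq mem_span mem_width by blast
  then show "tame A" unfolding tame_def using nat_theta by simp
qed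

text \<open>The infinite ordinal \<open>cup b omega\<close> absorbs triples by
  \<open>hessenberg\<close> and is an image of \<open>M\<close>, so a covering by triples would map
  \<open>M\<close> onto \<open>\<theta>\<close>. Three slots are what \<open>partition\<close>
  needs: section, piece and rank.\<close>

lemma no_covering:
  assumes b: "b \<epsilon> \<theta>" and K: "definable_term (\<lambda>e. K (e 0) (e 1) (e 2))"
    and cov: "\<And>y. y \<epsilon> \<theta> \<Longrightarrow> \<exists>i j k. i \<epsilon> cup b omega \<and> j \<epsilon> cup b omega \<and> k \<epsilon> cup b omega \<and> K i j k = y"
  shows False
proof -
  note [definability] = definable_term_subst3[of K, OF K]
  define c where "c = cup b omega"
  have c: "c \<epsilon> \<theta>" unfolding c_def by (rule cup_mem[OF Ord_theta b omega_theta])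
  obtain h where h: "\<And>y. y \<epsilon> c \<Longrightarrow> \<exists>x. x \<epsilon> M \<and> app h x = y" using below[OF c] unfolding onto_def by blast
  have "embeds (prd c c) c"
    by (rule hessenberg[OF Ord_mem[OF Ord_theta c]]) (simp add: c_def sub_cup)
  then obtain p where p: "\<And>x. x \<epsilon> prd c c \<Longrightarrow> app p x \<epsilon> c"
    "\<And>x y. x \<epsilon> prd c c \<Longrightarrow> y \<epsilon> prd c c \<Longrightarrow> app p x = app p y \<Longrightarrow> x = y"
    unfolding embeds_def by blast
  define code where "code i j k = app p (pair i (app p (pair j k)))" for i j k
  have code: "code i j k \<epsilon> c" if "i \<epsilon> c" "j \<epsilon> c" "k \<epsilon> c" for i j k
    using p(1) that unfolding code_def by simp
  have code_inj: "i = i' \<and> j = j' \<and> k = k'"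
    if "code i j k = code i' j' k'" "i \<epsilon> c" "j \<epsilon> c" "k \<epsilon> c" "i' \<epsilon> c" "j' \<epsilon> c" "k' \<epsilon> c"
    for i j k i' j' k'
  proof -
    have "app p (pair j k) \<epsilon> c" "app p (pair j' k') \<epsilon> c" by (rule p(1), simp add: that)+
    then have "pair i (app p (pair j k)) = pair i' (app p (pair j' k'))"
      by - (rule p(2), use that in \<open>simp_all add: code_def\<close>)
    then have "i = i'" "app p (pair j k) = app p (pair j' k')" by simp_all
    moreover from this(2) have "pair j k = pair j' k'" by (rule p(2)[rotated 2]) (use that in simp_all)
    ultimately show ?thesis by simp
  qed
  define F where "F x = uniq (\<lambda>v. \<exists>i j k. i \<epsilon> c \<and> j \<epsilon> c \<and> k \<epsilon> c \<and> code i j k = app h x \<and> v = K i j k)" for x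
  have "onto M \<theta>"
  proof (rule ontoI[of F])
    show "definable_term (\<lambda>e. F (e 0))" unfolding F_def code_def by (intro definability)
    fix y assume "y \<epsilon> \<theta>"
    then obtain i j k where ijk: "i \<epsilon> c" "j \<epsilon> c" "k \<epsilon> c" "K i j k = y" using cov unfolding c_def by blast
    then obtain x where x: "x \<epsilon> M" "app h x = code i j k" using h[OF code] by blast
    have "F x = y"
      unfolding F_def x(2)
    proof (rule uniq_eq)
      show "\<exists>i' j' k'. i' \<epsilon> c \<and> j' \<epsilon> c \<and> k' \<epsilon> c \<and> code i' j' k' = code i j k \<and> y = K i' j' k'"
        using ijk by blast
      show "v = y" if v: "\<exists>i' j' k'. i' \<epsilon> c \<and> j' \<epsilon> c \<and> k' \<epsilon> c \<and> code i' j' k' = code i j k \<and> v = K i' j' k'" for v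
      proof -
        obtain i' j' k' where *: "i' \<epsilon> c" "j' \<epsilon> c" "k' \<epsilon> c" "code i' j' k' = code i j k" "v = K i' j' k'"
          using v by blast
        show ?thesis using code_inj[OF *(4,1-3) ijk(1-3)] *(5) ijk(4) by simp
      qed
    qed
    then show "\<exists>x. x \<epsilon> M \<and> F x = y" using x(1) by blast
  qed
  then show False using not_onto by blast
qed

lemma not_tame_M: "\<not> tame M"
proof
  assume t: "tame M"
  \<comment> \<open>A value is recovered from its section and its rank among the values of that
    section; these ranks are bounded by \<open>span M\<close>.\<close>
  define K where "K m c (d :: 'a) = uniq (\<lambda>y. y \<epsilon> vals m M \<and> rank_in (vals m M) y = c)" for m c d
  have dK: "definable_term (\<lambda>e. K (e 0) (e 1) (e 2))" unfolding K_def by (intro definability)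
  show False
  proof (rule no_covering[OF t[unfolded tame_def] dK])
    fix y assume "y \<epsilon> \<theta>"
    then obtain m x where x: "m \<epsilon> omega" "x \<epsilon> M" "val m x = y" using covering unfolding val_def by blast
    have y: "y \<epsilon> vals m M" using x mem_vals by blast
    have "K m (rank_in (vals m M) y) emp = y"
      unfolding K_def by (rule rk_inv[OF ords_vals[OF sub_refl x(1)] y])
    moreover have "rank_in (vals m M) y \<epsilon> span M" using x unfolding mem_span mem_width by blast
    ultimately show "\<exists>i j k. i \<epsilon> cup (span M) omega \<and> j \<epsilon> cup (span M) omega \<and> k \<epsilon> cup (span M) omega \<and> K i j k = y"
      using x(1) emp_omega unfolding mem_cup by blast
  qed
qed

section \<open>Partitions into tame pieces\<close>

definition fibre :: "'a \<Rightarrow> ('a \<Rightarrow> 'a) \<Rightarrow> 'a \<Rightarrow> 'a" where "fibre A p i = Sep A (\<lambda>y. p y = i)"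

context
  fixes A p assumes A: "sub A M" and p: "definable_term (\<lambda>e. p (e 0))"
begin

lemma definable_term_p: "definable_term t \<Longrightarrow> definable_term (\<lambda>e. p (t e))"
  by (rule definable_term_subst1[OF p])

lemma definable_term_fibre: "definable_term t \<Longrightarrow> definable_term (\<lambda>e. fibre A p (t e))"
  by (rule definable_term_subst1) (unfold fibre_def, intro definability definable_term_p)

lemma mem_fibre: "x \<epsilon> fibre A p i \<longleftrightarrow> x \<epsilon> A \<and> p x = i"
  unfolding fibre_def by (rule mem_Sep) (intro definability definable_term_p)

lemma fibre_sub: "sub (fibre A p i) M"
  using A unfolding sub_def mem_fibre by blast

text \<open>A point is sent to its rank within its own piece, in the section that \<open>m\<close>
  gives to that piece. This one map covers the widths of all pieces at once, and it cannot be onto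
  \<open>\<theta>\<close>.\<close>

lemma uncovered:
  assumes m: "definable_term (\<lambda>e. m (e 0))" "\<And>x. x \<epsilon> A \<Longrightarrow> m (p x) \<epsilon> omega"
  shows "\<exists>y. y \<epsilon> \<theta> \<and> (\<forall>x. x \<epsilon> A \<longrightarrow> \<not> y \<epsilon> width (m (p x)) (fibre A p (p x)))"
proof (rule ccontr)
  assume no: "\<not> ?thesis"
  note [definability] = definable_term_subst1[of m, OF m(1)]
  have "onto A \<theta>"
  proof (rule ontoI)
    show "definable_term (\<lambda>e. rank_in (vals (m (p (e 0))) (fibre A p (p (e 0)))) (val (m (p (e 0))) (e 0)))"
      by (intro definability definable_term_p definable_term_fibre)
    fix y assume "y \<epsilon> \<theta>"
    then obtain x where x: "x \<epsilon> A" "y \<epsilon> width (m (p x)) (fibre A p (p x))" using no by blast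
    then obtain z where z: "z \<epsilon> fibre A p (p x)" "y = rank_in (vals (m (p x)) (fibre A p (p x))) (val (m (p x)) z)"
      unfolding mem_width by blast
    have "z \<epsilon> A" "p z = p x" using z(1) unfolding mem_fibre by blast+
    then show "\<exists>x. x \<epsilon> A \<and> rank_in (vals (m (p x)) (fibre A p (p x))) (val (m (p x)) x) = y"
      using z(2) by (intro exI[of _ z]) simp
  qed
  then show False using not_onto onto_mono[OF _ A sub_refl] by blast
qed

end

text \<open>Only finite suprema are sure to stay below \<open>\<theta>\<close>, so the bounds of the
  sections are later joined in initial parts.\<close>

lemma partial_unions:
  assumes v: "definable_term (\<lambda>e. v (e 0))" "\<And>j. j \<epsilon> omega \<Longrightarrow> v j \<epsilon> \<theta>" and k: "k \<epsilon> omega"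
  shows "Uni k v \<epsilon> \<theta>"
proof (rule omega_induct[OF _ k, of "\<lambda>k. Uni k v \<epsilon> \<theta>"])
  note [definability] = definable_term_subst1[of v, OF v(1)]
  note m = mem_Uni[OF v(1)]
  show "definable (\<lambda>e. Uni (e 0) v \<epsilon> \<theta>)" by (intro definability)
  have "Uni emp v = emp" unfolding emp_eq m by simp
  then show "Uni emp v \<epsilon> \<theta>" using nat_theta by simp
  fix n assume n: "n \<epsilon> omega" "Uni n v \<epsilon> \<theta>"
  have "Uni (suc n) v = cup (Uni n v) (v n)" by (rule ext) (auto simp: m)
  then show "Uni (suc n) v \<epsilon> \<theta>" using cup_mem[OF Ord_theta n(2) v(2)[OF n(1)]] by simp
qed

text \<open>Without choice the values \<open>m i\<close> have to be picked uniformly; here one value of \<open>m\<close> serves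
  every \<open>k\<close> at once.\<close>

lemma attained:
  assumes A: "sub A M" and s: "definable_term (\<lambda>e. s (e 0))" "\<And>k. k \<epsilon> omega \<Longrightarrow> Ord (s k)"
    "\<And>j k. k \<epsilon> omega \<Longrightarrow> j \<epsilon> k \<Longrightarrow> sub (s j) (s k)"
    and k: "k \<epsilon> omega" "\<not> s k \<epsilon> span A"
  shows "\<exists>m. m \<epsilon> omega \<and> (\<forall>k. k \<epsilon> omega \<longrightarrow> s k \<epsilon> span A \<longrightarrow> s k \<epsilon> width m A)"
proof -
  note [definability] = definable_term_subst1[of s, OF s(1)]
  have d: "definable (\<lambda>e. e 0 \<epsilon> omega \<and> \<not> s (e 0) \<epsilon> span A)" by (intro definability)
  \<comment> \<open>\<open>l\<close> is the first index at which \<open>s\<close> leaves the span.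
    If it is a successor, a section that reaches the last value before it reaches all earlier ones
    too.\<close>
  obtain l where l: "l \<epsilon> omega" "\<not> s l \<epsilon> span A" "\<And>j. j \<epsilon> l \<Longrightarrow> \<not> (j \<epsilon> omega \<and> \<not> s j \<epsilon> span A)"
    using Ord_least[OF d Ord_mem[OF Ord_omega k(1)]] k by metis
  have jl: "j \<epsilon> l" if "j \<epsilon> omega" "s j \<epsilon> span A" for j
  proof (rule ccontr)
    assume "\<not> j \<epsilon> l"
    then have "j = l \<or> l \<epsilon> j" using Ord_linear that(1) l(1) Ord_mem[OF Ord_omega] by blast
    then have "sub (s l) (s j)" using s(3)[OF that(1)] by auto
    then show False using mem_sub[OF Ord_span[OF A] s(2)[OF l(1)] _ that(2)] l(2) by blast
  qed
  show ?thesis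
    using l(1)
  proof (cases rule: omega_cases)
    case 1
    then show ?thesis using jl mem_emp emp_omega by blast
  next
    case (2 n)
    then have "s n \<epsilon> span A" using l(3)[of n] by auto
    then obtain m where m: "m \<epsilon> omega" "s n \<epsilon> width m A" unfolding mem_span by blast
    have "s j \<epsilon> width m A" if j: "j \<epsilon> omega" "s j \<epsilon> span A" for j
    proof -
      have "j \<epsilon> n \<or> j = n" using jl[OF j] 2 by auto
      then have "sub (s j) (s n)" using s(3)[OF 2(1)] by auto
      then show ?thesis using mem_sub[OF Ord_width[OF A m(1)] s(2)[OF j(1)] _ m(2)] by blast
    qed
    then show ?thesis using m(1) by blast
  qed
qed

text \<open>If the spans of the pieces are bounded below \<open>\<theta>\<close>, a rank in
  \<open>A\<close> is coded by section, piece and rank within the piece, against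
  \<open>no_covering\<close>. If they are cofinal, one section per piece is picked so that the
  resulting widths still cover \<open>\<theta>\<close>, against \<open>uncovered\<close>.\<close>

lemma partition:
  assumes A: "sub A M" and p: "definable_term (\<lambda>e. p (e 0))" and c: "c \<epsilon> \<theta>"
    and pc: "\<And>x. x \<epsilon> A \<Longrightarrow> p x \<epsilon> c" and t: "\<And>i. i \<epsilon> c \<Longrightarrow> tame (fibre A p i)"
  shows "tame A"
proof (rule ccontr)
  assume nt: "\<not> tame A"
  then have S: "span A = \<theta>" using not_tame[OF A] by blast
  note [definability] = definable_term_p[OF A p] definable_term_fibre[OF A p]
  note mem_fibre = mem_fibre[OF A p] and fibre_sub = fibre_sub[OF A p]
  define s where "s = Uni c (\<lambda>i. span (fibre A p i))"
  have ds: "definable_term (\<lambda>e. span (fibre A p (e 0)))" by (intro definability)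
  note ms = mem_Uni[OF ds, of _ c, folded s_def]
  have Os: "Ord s" unfolding s_def by (rule Ord_Uni[OF ds Ord_span[OF fibre_sub]])
  have ss: "sub s \<theta>" unfolding sub_def ms using subD[OF span_sub[OF fibre_sub]] by blast
  show False
  proof (cases "s \<epsilon> \<theta>")
    case True
    \<comment> \<open>The value of rank \<open>d\<close> in piece \<open>i\<close> is recovered and
      then ranked within \<open>A\<close>. Since \<open>A\<close> is not tame, the ranks so obtained
      fill \<open>\<theta>\<close>.\<close>
    define K where "K m i d = rank_in (vals m A) (uniq (\<lambda>y. y \<epsilon> vals m (fibre A p i) \<and> rank_in (vals m (fibre A p i)) y = d))" for m i d
    have dK: "definable_term (\<lambda>e. K (e 0) (e 1) (e 2))" unfolding K_def by (intro definability)
    show ?thesis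
    proof (rule no_covering[OF cup_mem[OF Ord_theta c True] dK])
      fix y assume "y \<epsilon> \<theta>"
      then obtain m x where x: "m \<epsilon> omega" "x \<epsilon> A" "y = rank_in (vals m A) (val m x)"
        using S mem_span[of y A] mem_width by auto
      let ?B = "fibre A p (p x)"
      have xB: "x \<epsilon> ?B" using x(2) mem_fibre by blast
      have "K m (p x) (rank_in (vals m ?B) (val m x)) = y"
        unfolding K_def x(3) rk_inv[OF ords_vals[OF fibre_sub x(1)] val_vals[OF xB]] ..
      moreover have "rank_in (vals m ?B) (val m x) \<epsilon> s"
        unfolding ms mem_span mem_width using xB x(1) pc[OF x(2)] by blast
      ultimately show "\<exists>i j k. i \<epsilon> cup (cup c s) omega \<and> j \<epsilon> cup (cup c s) omega \<and>
          k \<epsilon> cup (cup c s) omega \<and> K i j k = y"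
        using x(1) pc[OF x(2)] unfolding mem_cup by blast
    qed
  next
    case False
    then have s: "s = \<theta>" using sub_iff[OF Os Ord_theta] ss by blast
    \<comment> \<open>Within one section the widths of all pieces are bounded below
      \<open>\<theta>\<close>, by \<open>uncovered\<close> with the constant section
      \<open>j\<close>.\<close>
    define v where "v j = Uni c (\<lambda>i. width j (fibre A p i))" for j
    have dv: "definable_term (\<lambda>e. v (e 0))" unfolding v_def by (intro definability)
    have dw: "definable_term (\<lambda>e. width j (fibre A p (e 0)))" for j by (intro definability)
    have mv: "y \<epsilon> v j \<longleftrightarrow> (\<exists>i. i \<epsilon> c \<and> y \<epsilon> width j (fibre A p i))" for y j
      unfolding v_def by (rule mem_Uni[OF dw])
    have v: "v j \<epsilon> \<theta>" if j: "j \<epsilon> omega" for j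
    proof -
      have O: "Ord (v j)" unfolding v_def by (rule Ord_Uni[OF dw Ord_width[OF fibre_sub j]])
      have sv: "sub (v j) \<theta>"
        unfolding sub_def mv using width_theta[OF fibre_sub j] Ord_trans[OF Ord_theta] by blast
      obtain y where y: "y \<epsilon> \<theta>" "\<And>x. x \<epsilon> A \<Longrightarrow> \<not> y \<epsilon> width j (fibre A p (p x))"
        using uncovered[OF A p, of "\<lambda>_. j", OF definable_term_const] j by blast
      have "\<not> y \<epsilon> v j"
      proof
        assume "y \<epsilon> v j"
        then obtain i where i: "y \<epsilon> width j (fibre A p i)" unfolding mv by blast
        then obtain x where "x \<epsilon> fibre A p i" unfolding mem_width by blast
        then show False using y(2) i unfolding mem_fibre by blast
      qed
      then show ?thesis using sub_iff[OF O Ord_theta] sv y(1) by blast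
    qed
    \<comment> \<open>Finite joins make the bounds monotone in \<open>k\<close>; together they
      exhaust \<open>\<theta>\<close>.\<close>
    define u where "u k = Uni k v" for k
    have du [definability]: "definable_term t \<Longrightarrow> definable_term (\<lambda>e. u (t e))" for t
      by (rule definable_term_subst1) (unfold u_def, intro definability definable_term_subst1[OF dv])
    have mu: "y \<epsilon> u k \<longleftrightarrow> (\<exists>j. j \<epsilon> k \<and> y \<epsilon> v j)" for y k unfolding u_def by (rule mem_Uni[OF dv])
    have u: "u k \<epsilon> \<theta>" if "k \<epsilon> omega" for k
      unfolding u_def by (rule partial_unions[OF dv v that])
    have Ou: "Ord (u k)" if "k \<epsilon> omega" for k using u[OF that] Ord_mem[OF Ord_theta] by blast
    have u_mono: "sub (u j) (u k)" if "k \<epsilon> omega" "j \<epsilon> k" for j k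
      unfolding sub_def mu using Ord_trans[OF Ord_mem[OF Ord_omega that(1)] _ that(2)] by blast
    have u_cover: "\<exists>k. k \<epsilon> omega \<and> y \<epsilon> u k" if y: "y \<epsilon> \<theta>" for y
    proof -
      obtain i m where "i \<epsilon> c" "m \<epsilon> omega" "y \<epsilon> width m (fibre A p i)"
        using y unfolding s[symmetric] ms mem_span by blast
      then have "y \<epsilon> u (suc m)" "suc m \<epsilon> omega" unfolding mu mv by auto
      then show ?thesis by blast
    qed
    \<comment> \<open>The section has to reach past every \<open>u k\<close> inside the span of the
      piece. As the piece is tame, some \<open>u k\<close> lies outside its span, and
      \<open>attained\<close> provides such a section.\<close>
    define Q where "Q i m \<longleftrightarrow> m \<epsilon> omega \<and> (\<forall>k. k \<epsilon> omega \<longrightarrow> u k \<epsilon> span (fibre A p i) \<longrightarrow> u k \<epsilon> width m (fibre A p i))" for i m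
    have dQ: "definable (\<lambda>e. Q i (e 0))" for i unfolding Q_def by (intro definability)
    define m where "m i = least_ord (Q i)" for i
    have dm: "definable_term (\<lambda>e. m (e 0))" unfolding m_def Q_def by (intro definability)
    have m: "Q i (m i)" if i: "i \<epsilon> c" for i
    proof -
      obtain k where k: "k \<epsilon> omega" "span (fibre A p i) \<epsilon> u k"
        using u_cover t[OF i] unfolding tame_def by blast
      have "\<exists>m. Q i m"
        unfolding Q_def
        by (rule attained[OF fibre_sub du[OF definable_term_var] Ou u_mono k(1)]) (use k(2) mem_asym in auto)
      then obtain n where "Q i n" by blast
      moreover from this have "Ord n" unfolding Q_def using Ord_mem[OF Ord_omega] by blast
      ultimately show ?thesis unfolding m_def using least_ord(2)[OF dQ] by blast
    qed
    have mo: "m (p x) \<epsilon> omega" if "x \<epsilon> A" for x using m[OF pc[OF that]] unfolding Q_def by blast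
    obtain y where y: "y \<epsilon> \<theta>" "\<And>x. x \<epsilon> A \<Longrightarrow> \<not> y \<epsilon> width (m (p x)) (fibre A p (p x))"
      using uncovered[OF A p dm mo] by blast
    obtain k where k: "k \<epsilon> omega" "y \<epsilon> u k" using u_cover[OF y(1)] by blast
    \<comment> \<open>Some piece has a span beyond \<open>u k\<close>, so the width picked for it
      contains the missed \<open>y\<close>.\<close>
    obtain i where i: "i \<epsilon> c" "u k \<epsilon> span (fibre A p i)" using u[OF k(1)] unfolding s[symmetric] ms by blast
    have uw: "u k \<epsilon> width (m i) (fibre A p i)" and mi: "m i \<epsilon> omega" using m[OF i(1)] k(1) i(2) unfolding Q_def by blast+
    have "y \<epsilon> width (m i) (fibre A p i)" by (rule Ord_trans[OF Ord_width[OF fibre_sub mi] k(2) uw])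
    moreover obtain x where "x \<epsilon> fibre A p i" using uw unfolding mem_width by blast
    ultimately show False using y(2) unfolding mem_fibre by blast
  qed
qed

text \<open>The widths of \<open>M\<close> in the first \<open>k\<close> sections are bounded by
  \<open>u k\<close>, while a fibre that is not tame has some width beyond \<open>u k\<close>. If
  such fibres occurred for arbitrarily large \<open>k\<close>, these widths would cover
  \<open>\<theta>\<close>, against \<open>uncovered\<close>.\<close>

lemma no_splitting:
  assumes A: "sub A M" and p: "definable_term (\<lambda>e. p (e 0))" and po: "\<And>x. x \<epsilon> A \<Longrightarrow> p x \<epsilon> omega"
  shows "\<exists>N. N \<epsilon> omega \<and> (\<forall>k. k \<epsilon> omega \<longrightarrow> \<not> k \<epsilon> N \<longrightarrow> tame (fibre A p k))"
proof (rule ccontr)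
  assume no: "\<not> ?thesis"
  note [definability] = definable_term_p[OF A p] definable_term_fibre[OF A p]
  note mem_fibre = mem_fibre[OF A p] and fibre_sub = fibre_sub[OF A p]
  define v where "v j = width j M" for j
  have dv: "definable_term (\<lambda>e. v (e 0))" unfolding v_def by (intro definability)
  have v: "v j \<epsilon> \<theta>" if "j \<epsilon> omega" for j unfolding v_def by (rule width_theta[OF sub_refl that])
  define u where "u k = Uni k v" for k
  have du [definability]: "definable_term t \<Longrightarrow> definable_term (\<lambda>e. u (t e))" for t
    by (rule definable_term_subst1) (unfold u_def, intro definability definable_term_subst1[OF dv])
  have mu: "y \<epsilon> u k \<longleftrightarrow> (\<exists>j. j \<epsilon> k \<and> y \<epsilon> v j)" for y k unfolding u_def by (rule mem_Uni[OF dv])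
  have u: "u k \<epsilon> \<theta>" if "k \<epsilon> omega" for k
    unfolding u_def by (rule partial_unions[OF dv v that])
  define Q where "Q k m \<longleftrightarrow> m \<epsilon> omega \<and> u k \<epsilon> width m (fibre A p k)" for k m
  have dQ: "definable (\<lambda>e. Q k (e 0))" for k unfolding Q_def by (intro definability)
  \<comment> \<open>Tame fibres get the index \<open>emp\<close>, so that every point has a section
    in \<open>omega\<close>.\<close>
  define m where "m k = (if tame (fibre A p k) then emp else least_ord (Q k))" for k
  have dm: "definable_term (\<lambda>e. m (e 0))" unfolding m_def Q_def by (intro definability)
  have m: "Q k (m k)" if k: "k \<epsilon> omega" "\<not> tame (fibre A p k)" for k
  proof -
    obtain n where n: "Q k n"
      using u[OF k(1)] not_tame[OF fibre_sub] k(2) unfolding Q_def by (metis mem_span)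
    then have "Ord n" unfolding Q_def using Ord_mem[OF Ord_omega] by blast
    then show ?thesis unfolding m_def using least_ord(2)[OF dQ _ n] k(2) by simp
  qed
  have mo: "m (p x) \<epsilon> omega" if "x \<epsilon> A" for x
    using m[OF po[OF that]] unfolding Q_def m_def by (cases "tame (fibre A p (p x))") auto
  obtain y where y: "y \<epsilon> \<theta>" "\<And>x. x \<epsilon> A \<Longrightarrow> \<not> y \<epsilon> width (m (p x)) (fibre A p (p x))"
    using uncovered[OF A p dm mo] by blast
  obtain j where j: "j \<epsilon> omega" "y \<epsilon> v j"
    using y(1) not_tame_M not_tame[OF sub_refl] unfolding v_def by (metis mem_span)
  obtain k where k: "k \<epsilon> omega" "\<not> k \<epsilon> suc j" "\<not> tame (fibre A p k)" using no suc_omega[OF j(1)] by blast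
  then have "j \<epsilon> k" using Ord_linear[OF Ord_mem[OF Ord_omega k(1)] Ord_mem[OF Ord_omega j(1)]] by auto
  then have yu: "y \<epsilon> u k" unfolding mu using j(2) by blast
  have uw: "u k \<epsilon> width (m k) (fibre A p k)" and mk: "m k \<epsilon> omega" using m[OF k(1,3)] unfolding Q_def by blast+
  have "y \<epsilon> width (m k) (fibre A p k)" by (rule Ord_trans[OF Ord_width[OF fibre_sub mk] yu uw])
  moreover obtain x where "x \<epsilon> fibre A p k" using uw unfolding mem_width by blast
  ultimately show False using y(2) unfolding mem_fibre by blast
qed

section \<open>Cells of points that agree in the first sections\<close>

definition cell :: "'a \<Rightarrow> 'a \<Rightarrow> 'a \<Rightarrow> 'a" where
  "cell A n x = Sep A (\<lambda>y. \<forall>i. i \<epsilon> n \<longrightarrow> val i y = val i x)"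

lemma definable_term_cell [definability]: "definable_term t \<Longrightarrow> definable_term u \<Longrightarrow> definable_term v \<Longrightarrow> definable_term (\<lambda>e. cell (t e) (u e) (v e))"
  by (rule definable_term_subst3) (unfold cell_def, intro definability)

lemma mem_cell: "y \<epsilon> cell A n x \<longleftrightarrow> y \<epsilon> A \<and> (\<forall>i. i \<epsilon> n \<longrightarrow> val i y = val i x)"
  unfolding cell_def by (rule mem_Sep) (intro definability)

text \<open>The step to the next stage splits a cell by the values of section \<open>n\<close>. The
  pieces are indexed by ranks in \<open>vals n M\<close>, because the values themselves may be
  cofinal in \<open>\<theta>\<close> while \<open>partition\<close> wants an index bound below
  it.\<close>

lemma tame_of_cells:
  assumes n: "n \<epsilon> omega" and A: "sub A M" "\<And>x. x \<epsilon> A \<Longrightarrow> tame (cell A n x)" shows "tame A"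
proof -
  have "\<forall>A. sub A M \<longrightarrow> (\<forall>x. x \<epsilon> A \<longrightarrow> tame (cell A n x)) \<longrightarrow> tame A"
  proof (rule omega_induct[OF _ n, of "\<lambda>n. \<forall>A. sub A M \<longrightarrow> (\<forall>x. x \<epsilon> A \<longrightarrow> tame (cell A n x)) \<longrightarrow> tame A"], intro definability)
    have "cell A emp x = A" for A x by (rule ext) (simp add: mem_cell)
    then show "\<forall>A. sub A M \<longrightarrow> (\<forall>x. x \<epsilon> A \<longrightarrow> tame (cell A emp x)) \<longrightarrow> tame A"
      using tame_empty by metis
    fix n assume n: "n \<epsilon> omega"
      and IH: "\<forall>A. sub A M \<longrightarrow> (\<forall>x. x \<epsilon> A \<longrightarrow> tame (cell A n x)) \<longrightarrow> tame A"
    show "\<forall>A. sub A M \<longrightarrow> (\<forall>x. x \<epsilon> A \<longrightarrow> tame (cell A (suc n) x)) \<longrightarrow> tame A"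
    proof (intro allI impI)
      fix A assume A: "sub A M" "\<forall>x. x \<epsilon> A \<longrightarrow> tame (cell A (suc n) x)"
      have "tame (cell A n x)" if x: "x \<epsilon> A" for x
      proof (rule partition)
        let ?p = "\<lambda>y. rank_in (vals n M) (val n y)"
        show C: "sub (cell A n x) M" using A(1) unfolding sub_def mem_cell by blast
        show d: "definable_term (\<lambda>e. ?p (e 0))" by (intro definability)
        show "width n M \<epsilon> \<theta>" by (rule width_theta[OF sub_refl n])
        show "?p y \<epsilon> width n M" if "y \<epsilon> cell A n x" for y using subD[OF C that] unfolding mem_width by blast
        fix i
        note mf = mem_fibre[OF C d]
        show "tame (fibre (cell A n x) ?p i)"
        proof (cases "\<exists>y. y \<epsilon> fibre (cell A n x) ?p i")
          case True
          then obtain y where y: "y \<epsilon> cell A n x" "?p y = i" unfolding mf by blast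
          have yA: "y \<epsilon> A" using y unfolding mem_cell by blast
          have "sub (fibre (cell A n x) ?p i) (cell A (suc n) y)"
            unfolding sub_def
          proof (intro allI impI)
            fix z assume "z \<epsilon> fibre (cell A n x) ?p i"
            then have z: "z \<epsilon> cell A n x" "?p z = ?p y" using y unfolding mf by auto
            have "val n z = val n y"
              by (rule rk_inj[OF ords_vals[OF sub_refl n] val_vals val_vals z(2)]) (use subD[OF C] z y in blast)+
            then show "z \<epsilon> cell A (suc n) y" using z(1) y(1) unfolding mem_cell by auto
          qed
          moreover have "sub (cell A (suc n) y) M" using A(1) unfolding sub_def mem_cell by blast
          ultimately show ?thesis using tame_mono A(2) yA by blast
        next
          case False
          then show ?thesis using tame_empty by blast
        qed
      qed
      then show "tame A" using IH A(1) by blast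
    qed
  qed
  then show ?thesis using A by blast
qed

text \<open>No cell of a suitable point \<open>z\<close> is tame. But the sets of points that leave the cells of \<open>z\<close> at step
  \<open>n\<close> are tame for all large \<open>n\<close>, which makes a late cell of \<open>z\<close> tame.\<close>

theorem contradiction: False
proof -
  have d: "definable (\<lambda>e. e 0 \<epsilon> omega \<and> tame (cell M (e 0) x))" for x by (intro definability)
  have cM: "sub (cell M n x) M" for n x unfolding sub_def mem_cell by blast
  have "\<exists>z. z \<epsilon> M \<and> (\<forall>n. n \<epsilon> omega \<longrightarrow> \<not> tame (cell M n z))"
  proof (rule ccontr)
    assume no: "\<not> ?thesis"
    \<comment> \<open>If every point has a tame cell, the first such stage splits \<open>M\<close>
      into countably many pieces, and the piece of stage \<open>n\<close> is tame by
      \<open>tame_of_cells\<close>.\<close>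
    define p where "p x = least_ord (\<lambda>n. n \<epsilon> omega \<and> tame (cell M n x))" for x
    have dp: "definable_term (\<lambda>e. p (e 0))" unfolding p_def by (intro definability)
    have p: "p x \<epsilon> omega \<and> tame (cell M (p x) x)" if x: "x \<epsilon> M" for x
    proof -
      obtain n where n: "n \<epsilon> omega \<and> tame (cell M n x)" using no x by blast
      then have "Ord n" using Ord_mem[OF Ord_omega] by blast
      then show ?thesis unfolding p_def using least_ord(2)[OF d _ n] by blast
    qed
    note mf = mem_fibre[OF sub_refl dp] and fM = fibre_sub[OF sub_refl dp]
    have "tame M"
    proof (rule partition[OF sub_refl dp omega_theta])
      show "p x \<epsilon> omega" if "x \<epsilon> M" for x using p[OF that] by blast
      fix n assume n: "n \<epsilon> omega"
      show "tame (fibre M p n)"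
      proof (rule tame_of_cells[OF n fM])
        fix x assume x: "x \<epsilon> fibre M p n"
        then have "tame (cell M n x)" using p unfolding mf by blast
        moreover have "sub (cell (fibre M p n) n x) (cell M n x)" unfolding sub_def mem_cell mf by blast
        ultimately show "tame (cell (fibre M p n) n x)" using tame_mono[OF cM] by blast
      qed
    qed
    then show False using not_tame_M by blast
  qed
  then obtain z where z: "z \<epsilon> M" "\<And>n. n \<epsilon> omega \<Longrightarrow> \<not> tame (cell M n z)" by blast
  \<comment> \<open>The first section that separates \<open>x\<close> from \<open>z\<close>, that
    is, the stage at which \<open>x\<close> leaves the cells of \<open>z\<close>.\<close>
  define q where "q x = least_ord (\<lambda>n. n \<epsilon> omega \<and> val n x \<noteq> val n z)" for x
  have dq [definability]: "definable_term t \<Longrightarrow> definable_term (\<lambda>e. q (t e))" for t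
    by (rule definable_term_subst1) (unfold q_def, intro definability)
  have dl: "definable (\<lambda>e. e 0 \<epsilon> omega \<and> val (e 0) x \<noteq> val (e 0) z)" for x by (intro definability)
  have q: "q x \<epsilon> omega" "val (q x) x \<noteq> val (q x) z" if x: "\<exists>n. n \<epsilon> omega \<and> val n x \<noteq> val n z" for x
  proof -
    obtain n where n: "n \<epsilon> omega \<and> val n x \<noteq> val n z" using x by blast
    then have "Ord n" using Ord_mem[OF Ord_omega] by blast
    then show "q x \<epsilon> omega" "val (q x) x \<noteq> val (q x) z" unfolding q_def using least_ord(2)[OF dl _ n] by blast+
  qed
  have dD: "definable (\<lambda>e. \<exists>n. n \<epsilon> omega \<and> val n (e 0) \<noteq> val n z)" by (intro definability)
  define D where "D = Sep M (\<lambda>x. \<exists>n. n \<epsilon> omega \<and> val n x \<noteq> val n z)"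
  have D: "x \<epsilon> D \<longleftrightarrow> x \<epsilon> M \<and> (\<exists>n. n \<epsilon> omega \<and> val n x \<noteq> val n z)" for x
    unfolding D_def by (rule mem_Sep[OF dD])
  have DM: "sub D M" unfolding sub_def D by blast
  have dq': "definable_term (\<lambda>e. q (e 0))" by (intro definability)
  obtain N where N: "N \<epsilon> omega" "\<And>k. k \<epsilon> omega \<Longrightarrow> \<not> k \<epsilon> N \<Longrightarrow> tame (fibre D q k)"
    using no_splitting[OF DM dq'] q D by blast
  \<comment> \<open>Shifted by one: \<open>emp\<close> is reserved for the points that no section
    separates from \<open>z\<close>.\<close>
  define r where "r x = (if x \<epsilon> D then suc (q x) else emp)" for x
  have dr: "definable_term (\<lambda>e. r (e 0))" unfolding r_def by (intro definability)
  note mf = mem_fibre[OF cM dr] and fM = fibre_sub[OF cM dr] and mD = mem_fibre[OF DM dq']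
  have "tame (cell M N z)"
  proof (rule partition[OF cM dr omega_theta])
    show "r x \<epsilon> omega" if "x \<epsilon> cell M N z" for x using q D unfolding r_def by auto
    fix k assume "k \<epsilon> omega"
    then show "tame (fibre (cell M N z) r k)"
    proof (cases rule: omega_cases)
      case 1
      \<comment> \<open>On these points every section is constant, so all widths, and hence the
        span, are at most one.\<close>
      define E where "E = fibre (cell M N z) r emp"
      have E: "val n x = val n z" if "x \<epsilon> E" "n \<epsilon> omega" for x n
        using that unfolding E_def mf r_def mem_cell D by (auto split: if_splits)
      have EM: "sub E M" unfolding E_def by (rule fM)
      have "v \<epsilon> suc emp" if v: "v \<epsilon> span E" for v
      proof -
        obtain n x where x: "n \<epsilon> omega" "x \<epsilon> E" "v = rank_in (vals n E) (val n x)"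
          using v unfolding mem_span mem_width by blast
        have "\<not> y \<epsilon> v" for y
          unfolding x(3) mem_rk[OF ords_vals[OF EM x(1)] val_vals[OF x(2)]] mem_vals
          using E[OF _ x(1)] x(2) mem_irrefl by metis
        then have "v = emp" unfolding emp_eq by blast
        then show ?thesis by simp
      qed
      then have "sub (span E) (suc emp)" unfolding sub_def by blast
      moreover have "suc emp \<epsilon> \<theta>" using nat_theta by simp
      ultimately have "tame E" unfolding tame_def using mem_sub[OF Ord_theta Ord_span[OF EM]] by blast
      then show ?thesis unfolding E_def 1 .
    next
      case (2 j)
      have e: "x \<epsilon> D \<and> q x = j" if "x \<epsilon> fibre (cell M N z) r k" for x
        using that suc_inj[of "q x" j] unfolding mf r_def 2 by (auto split: if_splits)
      show ?thesis
      proof (cases "j \<epsilon> N")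
        case True
        \<comment> \<open>Points of \<open>cell M N z\<close> agree with \<open>z\<close> in all
          sections before \<open>N\<close>, so none of them leaves that early.\<close>
        have "\<not> x \<epsilon> fibre (cell M N z) r k" for x
        proof
          assume x: "x \<epsilon> fibre (cell M N z) r k"
          then have "val j x = val j z" using True unfolding mf mem_cell by blast
          moreover have "val j x \<noteq> val j z" using e[OF x] q(2) D by metis
          ultimately show False by blast
        qed
        then show ?thesis using tame_empty by blast
      next
        case False
        then have "tame (fibre D q j)" using N(2) 2(1) by blast
        moreover have "sub (fibre (cell M N z) r k) (fibre D q j)" unfolding sub_def mD using e by blast
        ultimately show ?thesis using tame_mono[OF fibre_sub[OF DM dq']] by blast
      qed
    qed
  qed
  then show False using z N(1) by blast
qed

end

section \<open>The power set\<close>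

context ZF begin

lemma no_omega_covering:
  assumes "Ord t" "\<not> onto M t" "\<And>b. b \<epsilon> t \<Longrightarrow> onto M b" "omega \<epsilon> t"
    and T: "definable_term (\<lambda>e. T (e 0) (e 1))"
    and cov: "\<And>b. b \<epsilon> t \<Longrightarrow> \<exists>n x. n \<epsilon> omega \<and> x \<epsilon> M \<and> T n x = b"
  shows False
proof -
  note [definability] = definable_term_subst2[of T, OF T]
  \<comment> \<open>Values of \<open>T\<close> outside \<open>t\<close> are sent to
    \<open>emp\<close>, which lies in \<open>t\<close>, since the locale asks for values below the
    ordinal.\<close>
  define F where "F p = (if T (pfst p) (psnd p) \<epsilon> t then T (pfst p) (psnd p) else emp)" for p
  have dF: "definable_term (\<lambda>e. F (e 0))" unfolding F_def by (intro definability)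
  define G where "G = Lam (prd omega M) F"
  have G: "app G (pair n x) = (if T n x \<epsilon> t then T n x else emp)" if "n \<epsilon> omega" "x \<epsilon> M" for n x
  proof -
    have "F (pair n x) = (if T n x \<epsilon> t then T n x else emp)" by (simp add: F_def)
    then show ?thesis unfolding G_def using app_Lam[OF dF, of "pair n x" "prd omega M"] that by simp
  qed
  have "emp \<epsilon> t" using Ord_trans[OF assms(1) emp_omega assms(4)] .
  then interpret unreachable_covering mem M t G
  proof unfold_locales
    show "\<exists>n x. n \<epsilon> omega \<and> x \<epsilon> M \<and> app G (pair n x) = b" if b: "b \<epsilon> t" for b
    proof -
      obtain n x where "n \<epsilon> omega" "x \<epsilon> M" "T n x = b" using cov[OF b] by blast
      then show ?thesis using G b by (intro exI[of _ n] exI[of _ x]) simp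
    qed
  qed (use assms G in simp_all)
  show False by (rule contradiction)
qed

lemma no_surjection_onto_pow:
  assumes M: "\<not> fin M"
    and f: "\<And>n x. n \<epsilon> omega \<Longrightarrow> x \<epsilon> M \<Longrightarrow> sub (app f (pair n x)) M"
    and onto: "\<And>Y. sub Y M \<Longrightarrow> \<exists>n x. n \<epsilon> omega \<and> x \<epsilon> M \<and> app f (pair n x) = Y"
  shows False
proof -
  have oM: "onto M omega" by (rule onto_omega[OF assms])
  have d: "definable (\<lambda>e. \<not> onto M (e 0))" by (intro definability)
  obtain t where t: "Ord t" "\<not> onto M t" "\<And>b. b \<epsilon> t \<Longrightarrow> onto M b"
    using hartogs[of M] Ord_least[OF d] by metis
  have "omega \<epsilon> t"
    using Ord_linear[OF t(1) Ord_omega] infinite_onto_nat[OF M] t(2) oM by blast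
  note no_covering = no_omega_covering[OF t this]
  define F where "F n x = app f (pair n x)" for n x
  have dF [definability]: "definable_term a \<Longrightarrow> definable_term b \<Longrightarrow> definable_term (\<lambda>e. F (a e) (b e))" for a b
    by (rule definable_term_subst2) (unfold F_def, intro definability)
  have onto: "\<exists>n x. n \<epsilon> omega \<and> x \<epsilon> M \<and> F n x = Y" if "sub Y M" for Y
    unfolding F_def by (rule onto[OF that])
  show False
  proof (cases "\<exists>l. l \<epsilon> t \<and> sub omega l \<and> (\<forall>m. m \<epsilon> t \<longrightarrow> onto l m)")
    case True
    then obtain l where l: "l \<epsilon> t" "sub omega l" "\<And>m. m \<epsilon> t \<Longrightarrow> onto l m" by blast
    obtain h where h: "\<And>y. y \<epsilon> l \<Longrightarrow> \<exists>x. x \<epsilon> M \<and> app h x = y" using t(3)[OF l(1)] unfolding onto_def by blast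
    obtain p where p: "\<And>x. x \<epsilon> prd l l \<Longrightarrow> app p x \<epsilon> l"
      "\<And>x y. x \<epsilon> prd l l \<Longrightarrow> y \<epsilon> prd l l \<Longrightarrow> app p x = app p y \<Longrightarrow> x = y"
      using hessenberg[OF Ord_mem[OF t(1) l(1)] l(2)] unfolding embeds_def by blast
    \<comment> \<open>\<open>Y\<close> codes the relation of all pairs whose code under
      \<open>p\<close> is hit by \<open>h\<close> on \<open>Y\<close>; its field is again the
      diagonal.\<close>
    define r where "r Y = Sep (prd l l) (\<lambda>q. \<exists>y. y \<epsilon> Y \<and> app h y = app p q)" for Y
    define D where "D Y = Sep l (\<lambda>a. pair a a \<epsilon> r Y)" for Y
    have dr [definability]: "definable_term a \<Longrightarrow> definable_term (\<lambda>e. r (a e))" for a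
      by (rule definable_term_subst1) (unfold r_def, intro definability)
    have dD [definability]: "definable_term a \<Longrightarrow> definable_term (\<lambda>e. D (a e))" for a
      by (rule definable_term_subst1) (unfold D_def, intro definability)
    have dr': "definable (\<lambda>e. \<exists>y. y \<epsilon> Y \<and> app h y = app p (e 0))" for Y by (intro definability)
    have dD': "definable (\<lambda>e. pair (e 0) (e 0) \<epsilon> r Y)" for Y by (intro definability)
    show False
    proof (rule no_covering[where T = "\<lambda>n x. uniq (otyp (D (F n x)) (r (F n x)))"])
      show "definable_term (\<lambda>e. uniq (otyp (D (F (e 0) (e 1))) (r (F (e 0) (e 1)))))" by (intro definability)
      fix m assume m: "m \<epsilon> t"
      obtain u where u: "\<And>y. y \<epsilon> m \<Longrightarrow> \<exists>x. x \<epsilon> l \<and> app u x = y" using l(3)[OF m] unfolding onto_def by blast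
      define P where "P a b \<longleftrightarrow> a \<epsilon> l \<and> b \<epsilon> l \<and> app u a \<epsilon> m \<and> app u b \<epsilon> m \<and> sub (app u a) (app u b)" for a b
      have dY: "definable (\<lambda>e. \<exists>a b. P a b \<and> app h (e 0) = app p (pair a b))" unfolding P_def by (intro definability)
      \<comment> \<open>The code of the prewellorder that \<open>u\<close> pulls back from
        \<open>m\<close>; as \<open>h\<close> is onto \<open>l\<close>, every pair can be
        coded.\<close>
      define Y where "Y = Sep M (\<lambda>y. \<exists>a b. P a b \<and> app h y = app p (pair a b))"
      have Y: "y \<epsilon> Y \<longleftrightarrow> y \<epsilon> M \<and> (\<exists>a b. P a b \<and> app h y = app p (pair a b))" for y
        unfolding Y_def by (rule mem_Sep[OF dY])
      have r: "pair a b \<epsilon> r Y \<longleftrightarrow> P a b" for a b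
      proof
        assume "pair a b \<epsilon> r Y"
        then obtain y where ab: "a \<epsilon> l" "b \<epsilon> l" and y: "y \<epsilon> Y" "app h y = app p (pair a b)"
          unfolding r_def mem_Sep[OF dr'] by auto
        then obtain a' b' where ab': "P a' b'" "app p (pair a' b') = app p (pair a b)" unfolding Y by auto
        have "pair a' b' = pair a b"
          by (rule p(2)) (use ab ab' in \<open>simp_all add: P_def\<close>)
        then show "P a b" using ab' by simp
      next
        assume P: "P a b"
        then have ab: "pair a b \<epsilon> prd l l" by (simp add: P_def)
        obtain y where "y \<epsilon> M" "app h y = app p (pair a b)" using h[OF p(1)[OF ab]] by blast
        then have "y \<epsilon> Y \<and> app h y = app p (pair a b)" unfolding Y using P by blast
        then show "pair a b \<epsilon> r Y" unfolding r_def mem_Sep[OF dr'] using ab by blast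
      qed
      have D: "a \<epsilon> D Y \<longleftrightarrow> a \<epsilon> l \<and> app u a \<epsilon> m" for a
        using mem_Sep[OF dD', of a l Y] r[of a a] sub_refl unfolding D_def P_def by blast
      have o: "otyp (D Y) (r Y) m"
      proof (rule otypI[OF Ord_mem[OF t(1) m]])
        show "definable_term (\<lambda>e. app u (e 0))" by (intro definability)
        show "\<exists>x. x \<epsilon> D Y \<and> app u x = b" if "b \<epsilon> m" for b using u[OF that] that unfolding D by auto
      qed (simp_all add: D r P_def)
      have "sub Y M" unfolding sub_def Y by blast
      then obtain n x where nx: "n \<epsilon> omega" "x \<epsilon> M" "F n x = Y" using onto by blast
      then show "\<exists>n x. n \<epsilon> omega \<and> x \<epsilon> M \<and> uniq (otyp (D (F n x)) (r (F n x))) = m"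
        using uniq_otyp[OF o] by blast
    qed
  next
    case False
    obtain p where p: "\<And>x y. x \<epsilon> prd omega omega \<Longrightarrow> y \<epsilon> prd omega omega \<Longrightarrow> app p x = app p y \<Longrightarrow> x = y"
      and po: "\<And>x. x \<epsilon> prd omega omega \<Longrightarrow> app p x \<epsilon> omega"
      using hessenberg[OF Ord_omega sub_refl] unfolding embeds_def by blast
    define r where "r n = Sep (prd M M) (\<lambda>q. sub (F n (pfst q)) (F n (psnd q)))" for n
    have dr [definability]: "definable_term a \<Longrightarrow> definable_term (\<lambda>e. r (a e))" for a
      by (rule definable_term_subst1) (unfold r_def, intro definability)
    have dr': "definable (\<lambda>e. sub (F n (pfst (e 0))) (F n (psnd (e 0))))" for n by (intro definability)
    have r: "pair x y \<epsilon> r n \<longleftrightarrow> x \<epsilon> M \<and> y \<epsilon> M \<and> sub (F n x) (F n y)" for x y n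
      unfolding r_def mem_Sep[OF dr'] by simp
    \<comment> \<open>Two sections are involved, \<open>n\<close> for the chain and \<open>k\<close>
      for the set of names of its members; \<open>p\<close> packs them into the single index
      \<open>j\<close>.\<close>
    define T where "T j x = uniq (\<lambda>b. \<exists>n k. n \<epsilon> omega \<and> k \<epsilon> omega \<and> app p (pair n k) = j \<and>
      b = uniq (otyp (F k x) (r n)))" for j x
    show False
    proof (rule no_covering[of T])
      show "definable_term (\<lambda>e. T (e 0) (e 1))" unfolding T_def by (intro definability)
      fix b assume b: "b \<epsilon> t"
      have Ob: "Ord b" by (rule Ord_mem[OF t(1) b])
      \<comment> \<open>Joined with \<open>omega\<close> so that the case assumption and
        \<open>hessenberg\<close> apply; a part of the chain longer than \<open>l\<close> is also
        longer than \<open>b\<close>.\<close>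
      define l where "l = cup b omega"
      have l: "l \<epsilon> t" unfolding l_def by (rule cup_mem[OF t(1) b \<open>omega \<epsilon> t\<close>])
      have ol: "sub omega l" unfolding l_def by (rule sub_cup)
      have Ol: "Ord l" by (rule Ord_mem[OF t(1) l])
      obtain m where m: "m \<epsilon> t" "\<not> onto l m" using False l ol by blast
      have Om: "Ord m" by (rule Ord_mem[OF t(1) m(1)])
      obtain h where h: "\<And>y. y \<epsilon> m \<Longrightarrow> \<exists>x. x \<epsilon> M \<and> app h x = y" using t(3)[OF m(1)] unfolding onto_def by blast
      \<comment> \<open>The initial parts of \<open>M\<close> along \<open>h\<close>; as
        \<open>h\<close> is onto \<open>m\<close>, inclusion between them mirrors the order of
        \<open>m\<close>.\<close>
      define C where "C c = Sep M (\<lambda>x. app h x \<epsilon> c)" for c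
      have dC [definability]: "definable_term a \<Longrightarrow> definable_term (\<lambda>e. C (a e))" for a
        by (rule definable_term_subst1) (unfold C_def, intro definability)
      have dC': "definable (\<lambda>e. app h (e 0) \<epsilon> c)" for c by (intro definability)
      have mC: "x \<epsilon> C c \<longleftrightarrow> x \<epsilon> M \<and> app h x \<epsilon> c" for x c unfolding C_def by (rule mem_Sep[OF dC'])
      have CM: "sub (C c) M" for c unfolding sub_def mC by blast
      have C_sub: "sub (C c) (C d) \<longleftrightarrow> sub c d" if cd: "c \<epsilon> m" "d \<epsilon> m" for c d
      proof
        assume s: "sub (C c) (C d)"
        show "sub c d"
        proof (rule ccontr)
          assume "\<not> sub c d"
          then have dc: "d \<epsilon> c" using not_sub Ord_mem[OF Om] cd by blast
          obtain x where x: "x \<epsilon> M" "app h x = d" using h[OF cd(2)] by blast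
          then have "x \<epsilon> C d" using subD[OF s, of x] dc unfolding mC by simp
          then show False using x unfolding mC by simp
        qed
      next
        assume "sub c d" then show "sub (C c) (C d)" unfolding sub_def mC by blast
      qed
      have C_inj: "c = d" if "c \<epsilon> m" "d \<epsilon> m" "C c = C d" for c d
        using C_sub[OF that(1,2)] C_sub[OF that(2,1)] that(3) sub_antisym by simp
      define H where "H n = Sep m (\<lambda>c. \<exists>y. y \<epsilon> M \<and> F n y = C c)" for n
      have dH [definability]: "definable_term a \<Longrightarrow> definable_term (\<lambda>e. H (a e))" for a
        by (rule definable_term_subst1) (unfold H_def, intro definability)
      have dH': "definable (\<lambda>e. \<exists>y. y \<epsilon> M \<and> F n y = C (e 0))" for n by (intro definability)
      have mH: "c \<epsilon> H n \<longleftrightarrow> c \<epsilon> m \<and> (\<exists>y. y \<epsilon> M \<and> F n y = C c)" for c n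
        unfolding H_def by (rule mem_Sep[OF dH'])
      have oH: "ordinals (H n)" for n by (rule ords_sub[OF Om]) (simp add: sub_def mH)
      \<comment> \<open>The sections split the chain into countably many parts \<open>H n\<close>.
        Were all their order types at most \<open>l\<close>, pairs of section and rank would map
        \<open>l\<close> onto \<open>m\<close>.\<close>
      have "\<exists>n. n \<epsilon> omega \<and> \<not> sub (order_type (H n)) l"
      proof (rule ccontr)
        assume no: "\<not> ?thesis"
        obtain q where q: "\<And>x y. x \<epsilon> prd l l \<Longrightarrow> y \<epsilon> prd l l \<Longrightarrow> app q x = app q y \<Longrightarrow> x = y"
          and ql: "\<And>x. x \<epsilon> prd l l \<Longrightarrow> app q x \<epsilon> l"
          using hessenberg[OF Ol ol] unfolding embeds_def by blast
        define U where "U c = uniq (\<lambda>v. \<exists>n d. n \<epsilon> l \<and> d \<epsilon> l \<and> app q (pair n d) = c \<and>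
          v = uniq (\<lambda>y. y \<epsilon> H n \<and> rank_in (H n) y = d))" for c
        have "onto l m"
        proof (rule ontoI[of U])
          show "definable_term (\<lambda>e. U (e 0))" unfolding U_def by (intro definability)
          fix c assume c: "c \<epsilon> m"
          obtain n x where nx: "n \<epsilon> omega" "x \<epsilon> M" "F n x = C c" using onto[OF CM] by blast
          then have cH: "c \<epsilon> H n" using c mH by blast
          define d where "d = rank_in (H n) c"
          have "d \<epsilon> order_type (H n)" unfolding d_def mem_otp using cH by blast
          then have d: "d \<epsilon> l" using no nx(1) subD by blast
          have n: "n \<epsilon> l" using subD[OF ol nx(1)] .
          have "U (app q (pair n d)) = c"
            unfolding U_def
          proof (rule uniq_eq)
            have c: "c = uniq (\<lambda>y. y \<epsilon> H n \<and> rank_in (H n) y = d)"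
              unfolding d_def by (rule rk_inv[OF oH cH, symmetric])
            then show "\<exists>n' d'. n' \<epsilon> l \<and> d' \<epsilon> l \<and> app q (pair n' d') = app q (pair n d) \<and>
                c = uniq (\<lambda>y. y \<epsilon> H n' \<and> rank_in (H n') y = d')"
              using n d by blast
            fix v assume "\<exists>n' d'. n' \<epsilon> l \<and> d' \<epsilon> l \<and> app q (pair n' d') = app q (pair n d) \<and>
                v = uniq (\<lambda>y. y \<epsilon> H n' \<and> rank_in (H n') y = d')"
            then obtain n' d' where *: "n' \<epsilon> l" "d' \<epsilon> l" "app q (pair n' d') = app q (pair n d)"
              "v = uniq (\<lambda>y. y \<epsilon> H n' \<and> rank_in (H n') y = d')" by blast
            have "pair n' d' = pair n d" by (rule q) (use * n d in simp_all)
            then show "v = c" using *(4) c by simp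
          qed
          moreover have "app q (pair n d) \<epsilon> l" using ql n d by simp
          ultimately show "\<exists>x. x \<epsilon> l \<and> U x = c" by blast
        qed
        then show False using m(2) by blast
      qed
      then obtain n where n: "n \<epsilon> omega" "\<not> sub (order_type (H n)) l" by blast
      have "l \<epsilon> order_type (H n)" using not_sub[OF Ord_otp[OF oH] Ol] n(2) by blast
      then have "sub l (order_type (H n))" by (rule Ord_sub[OF Ord_otp[OF oH]])
      then have bH: "sub b (order_type (H n))" using sub_trans[OF sub_cup(1)] unfolding l_def by blast
      define V where "V y = uniq (\<lambda>c. c \<epsilon> H n \<and> F n y = C c)" for y
      have dV [definability]: "definable_term a \<Longrightarrow> definable_term (\<lambda>e. V (a e))" for a
        by (rule definable_term_subst1) (unfold V_def, intro definability)
      have V: "V y = c" if c: "c \<epsilon> H n" "F n y = C c" for y c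
        unfolding V_def
        by (rule uniq_eq) (use c C_inj in \<open>auto simp: mH\<close>)
      have dY: "definable (\<lambda>e. \<exists>c. c \<epsilon> H n \<and> F n (e 0) = C c \<and> rank_in (H n) c \<epsilon> b)" by (intro definability)
      \<comment> \<open>All names, in section \<open>n\<close>, of the first \<open>b\<close>
        members of \<open>H n\<close>. A member may have many names, hence the use of
        prewellorders.\<close>
      define Y where "Y = Sep M (\<lambda>y. \<exists>c. c \<epsilon> H n \<and> F n y = C c \<and> rank_in (H n) c \<epsilon> b)"
      have Y: "y \<epsilon> Y \<longleftrightarrow> y \<epsilon> M \<and> (\<exists>c. c \<epsilon> H n \<and> F n y = C c \<and> rank_in (H n) c \<epsilon> b)" for y
        unfolding Y_def by (rule mem_Sep[OF dY])
      have YV: "y \<epsilon> M" "V y \<epsilon> H n" "F n y = C (V y)" "rank_in (H n) (V y) \<epsilon> b" if y: "y \<epsilon> Y" for y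
      proof -
        obtain c where "y \<epsilon> M" "c \<epsilon> H n" "F n y = C c" "rank_in (H n) c \<epsilon> b" using y unfolding Y by blast
        then show "y \<epsilon> M" "V y \<epsilon> H n" "F n y = C (V y)" "rank_in (H n) (V y) \<epsilon> b" using V by simp_all
      qed
      have o: "otyp Y (r n) b"
      proof (rule otypI[OF Ob])
        show "definable_term (\<lambda>e. rank_in (H n) (V (e 0)))" by (intro definability)
        show "rank_in (H n) (V y) \<epsilon> b" if "y \<epsilon> Y" for y using YV[OF that] by blast
        show "\<exists>y. y \<epsilon> Y \<and> rank_in (H n) (V y) = c" if c: "c \<epsilon> b" for c
        proof -
          obtain d where d: "d \<epsilon> H n" "c = rank_in (H n) d" using subD[OF bH c] unfolding mem_otp by blast
          then obtain y where y: "y \<epsilon> M" "F n y = C d" unfolding mH by blast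
          have "y \<epsilon> Y" unfolding Y using y d c by blast
          then show ?thesis using V[OF d(1) y(2)] d(2) by blast
        qed
        fix x y assume xy: "x \<epsilon> Y" "y \<epsilon> Y"
        have O: "Ord (V x)" "Ord (V y)" using YV(2) xy oH unfolding ordinals_def by blast+
        have "sub (rank_in (H n) (V x)) (rank_in (H n) (V y)) \<longleftrightarrow> sub (V x) (V y)"
          using not_sub[OF O] not_sub[OF Ord_rk[OF oH YV(2)[OF xy(1)]] Ord_rk[OF oH YV(2)[OF xy(2)]]]
            rk_less[OF oH YV(2)[OF xy(2)] YV(2)[OF xy(1)]] by blast
        also have "\<dots> \<longleftrightarrow> sub (F n x) (F n y)"
          unfolding YV(3)[OF xy(1)] YV(3)[OF xy(2)]
          by (rule C_sub[symmetric]) (use YV(2) xy in \<open>simp_all add: mH\<close>)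
        finally show "sub (rank_in (H n) (V x)) (rank_in (H n) (V y)) \<longleftrightarrow> pair x y \<epsilon> r n"
          unfolding r using YV(1) xy by blast
      qed
      have "sub Y M" unfolding sub_def Y by blast
      then obtain k x where kx: "k \<epsilon> omega" "x \<epsilon> M" "F k x = Y" using onto by blast
      have "T (app p (pair n k)) x = b"
        unfolding T_def
      proof (rule uniq_eq)
        have ob: "b = uniq (otyp (F k x) (r n))" unfolding kx(3) by (rule uniq_otyp[OF o, symmetric])
        then show "\<exists>n' k'. n' \<epsilon> omega \<and> k' \<epsilon> omega \<and> app p (pair n' k') = app p (pair n k) \<and>
            b = uniq (otyp (F k' x) (r n'))"
          using n(1) kx(1) by blast
        fix v assume "\<exists>n' k'. n' \<epsilon> omega \<and> k' \<epsilon> omega \<and> app p (pair n' k') = app p (pair n k) \<and>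
            v = uniq (otyp (F k' x) (r n'))"
        then obtain n' k' where *: "n' \<epsilon> omega" "k' \<epsilon> omega" "app p (pair n' k') = app p (pair n k)"
          "v = uniq (otyp (F k' x) (r n'))" by blast
        have "pair n' k' = pair n k" by (rule p) (use * n(1) kx(1) in simp_all)
        then show "v = b" using *(4) ob by simp
      qed
      moreover have "app p (pair n k) \<epsilon> omega" using po n(1) kx(1) by simp
      ultimately show "\<exists>j x. j \<epsilon> omega \<and> x \<epsilon> M \<and> T j x = b" using kx(2) by blast
    qed
  qed
qed

section \<open>Translation of the primitive notions of the model\<close>

lemma is_pair_iff: "is_pair p a b \<longleftrightarrow> p = pair a b"
proof -
  have u: "is_upair z a b \<longleftrightarrow> z = upr a b" for z a b
  proof
    assume "is_upair z a b" then show "z = upr a b" unfolding is_upair_def by (intro ext) simp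
  qed (simp add: is_upair_def)
  show ?thesis
  proof
    assume "is_pair p a b" then show "p = pair a b" unfolding is_pair_def u by (intro ext) (simp add: mem_pair)
  qed (simp add: is_pair_def u mem_pair)
qed

lemma maps_to_iff: "maps_to f a b \<longleftrightarrow> pair a b \<epsilon> f"
  unfolding maps_to_def is_pair_iff by blast

text \<open>The image in \<open>n\<close> may have gaps. Ranking closes them, and the order type is
  a natural number because it is at most \<open>n\<close>; the inverse graph is the required
  bijection.\<close>

lemma finite_set_of_fin:
  assumes "fin M" shows "finite_set M"
proof -
  obtain n h where n: "n \<epsilon> omega" and h: "\<And>x. x \<epsilon> M \<Longrightarrow> app h x \<epsilon> n"
    "\<And>x y. x \<epsilon> M \<Longrightarrow> y \<epsilon> M \<Longrightarrow> app h x = app h y \<Longrightarrow> x = y"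
    using assms unfolding fin_def embeds_def by blast
  define B where "B = Repl M (app h)"
  have dh: "definable_term (\<lambda>e. app h (e 0))" by (intro definability)
  have B: "y \<epsilon> B \<longleftrightarrow> (\<exists>x. x \<epsilon> M \<and> y = app h x)" for y unfolding B_def by (rule mem_Repl[OF dh])
  have On: "Ord n" by (rule Ord_mem[OF Ord_omega n])
  have sB: "sub B n" unfolding sub_def B using h(1) by blast
  have oB: "ordinals B" by (rule ords_sub[OF On sB])
  have k: "order_type B \<epsilon> omega" by (rule mem_sub[OF Ord_omega Ord_otp[OF oB] otp_sub[OF oB sB On] n])
  define q where "q x = rank_in B (app h x)" for x
  have q: "q x \<epsilon> order_type B" if "x \<epsilon> M" for x unfolding q_def mem_otp B using that by blast
  have q_inj: "x = y" if "x \<epsilon> M" "y \<epsilon> M" "q x = q y" for x y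
    by (rule h(2)[OF that(1,2)], rule rk_inj[OF oB]) (use that in \<open>auto simp: B q_def\<close>)
  have q_onto: "\<exists>x. x \<epsilon> M \<and> q x = i" if "i \<epsilon> order_type B" for i
    using that unfolding mem_otp B q_def by blast
  have df: "definable (\<lambda>e. \<exists>x. x \<epsilon> M \<and> e 0 = pair (q x) x)" unfolding q_def by (intro definability)
  define f where "f = Sep (prd (order_type B) M) (\<lambda>p. \<exists>x. x \<epsilon> M \<and> p = pair (q x) x)"
  have f: "p \<epsilon> f \<longleftrightarrow> (\<exists>x. x \<epsilon> M \<and> p = pair (q x) x)" for p
    unfolding f_def mem_Sep[OF df] using q by auto
  have m: "maps_to f i x \<longleftrightarrow> x \<epsilon> M \<and> i = q x" for i x
    unfolding maps_to_iff f by auto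
  have "is_function f (order_type B) M"
    unfolding is_function_def is_pair_iff m f using q q_onto q_inj by metis
  then have "is_injection f (order_type B) M" "is_surjection f (order_type B) M"
    unfolding is_injection_def is_surjection_def m using q by auto
  moreover have "is_omega omega" unfolding is_omega_def using mem_omega by blast
  ultimately show ?thesis unfolding finite_set_def using k by blast
qed

lemma generalized_cantor:
  assumes M: "infinite_set M" and W: "is_omega W" and C: "is_product C W M" and P: "is_powerset P M"
  shows "\<not> is_surjection f C P"
proof
  assume s: "is_surjection f C P"
  have W: "W = omega"
    by (rule ext) (use W in \<open>unfold is_omega_def mem_omega, blast\<close>)
  have C: "p \<epsilon> C \<longleftrightarrow> (\<exists>n x. n \<epsilon> omega \<and> x \<epsilon> M \<and> p = pair n x)" for p
    using C unfolding is_product_def is_pair_iff W by (rule spec)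
  have P: "Y \<epsilon> P \<longleftrightarrow> sub Y M" for Y using P unfolding is_powerset_def sub_def by blast
  have fP: "b \<epsilon> P" if "pair a b \<epsilon> f" for a b
  proof -
    have "\<exists>c d. c \<epsilon> C \<and> d \<epsilon> P \<and> pair a b = pair c d"
      using s that unfolding is_surjection_def is_function_def is_pair_iff by blast
    then show ?thesis by auto
  qed
  have ex1: "\<exists>!b. pair a b \<epsilon> f" if "a \<epsilon> C" for a
    using s that unfolding is_surjection_def is_function_def maps_to_iff by blast
  have app: "app f a = b" if "a \<epsilon> C" "pair a b \<epsilon> f" for a b
    unfolding app_def by (rule uniq_eq[where P = "\<lambda>y. pair a y \<epsilon> f"]) (use that(2) ex1[OF that(1)] in blast)+
  show False
  proof (rule no_surjection_onto_pow[of M f])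
    show "\<not> fin M" using M finite_set_of_fin unfolding infinite_set_def by blast
    show "sub (app f (pair n x)) M" if nx: "n \<epsilon> omega" "x \<epsilon> M" for n x
    proof -
      have c: "pair n x \<epsilon> C" using nx C by blast
      obtain b where b: "pair (pair n x) b \<epsilon> f" using ex1[OF c] by blast
      then show ?thesis using fP[OF b] unfolding app[OF c b] P by blast
    qed
    show "\<exists>n x. n \<epsilon> omega \<and> x \<epsilon> M \<and> app f (pair n x) = Y" if Y: "sub Y M" for Y
    proof -
      have "Y \<epsilon> P" using Y P by blast
      then obtain a where a: "a \<epsilon> C" "pair a Y \<epsilon> f"
        using s unfolding is_surjection_def maps_to_iff by blast
      obtain n x where nx: "n \<epsilon> omega" "x \<epsilon> M" "a = pair n x" using a(1) unfolding C by blast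
      then show ?thesis using app[OF a] by blast
    qed
  qed
qed

end

theorem theorem3p8:
  fixes mem :: "'a \<Rightarrow> 'a \<Rightarrow> bool"
  assumes "ZF mem"
  shows "\<forall>M. set_structure.infinite_set mem M \<longrightarrow>
    \<not> (\<exists>W C P f. set_structure.is_omega mem W \<and> set_structure.is_product mem C W M \<and>
          set_structure.is_powerset mem P M \<and> set_structure.is_surjection mem f C P)"
  using ZF.generalized_cantor[OF assms] by blast

end
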